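(* Fix a prime $p$ and integers $d\ge 3$ and $i\ge 2$. Let $F$ be the free group of rank $d$ and let $F=F_1\ge F_2\ge\cdots$ be its lower $p$-series. Suppose that $U$ is a normal subgroup of $F$ lying in $F_2$. Let $$Q=(U\cap F_i)F_{i+1}/F_{i+1},$$ $$R=(U_2\cap F_{i+1})F_{i+2}/F_{i+2},$$ $$S=(U^p[U,F]\cap F_{i+1})F_{i+2}/F_{i+2}.$$ Viewing $Q$, $R$ and $S$ as $\mathbb{F}_p$-vector spaces, their dimensions satisfy $\dim(R)\ge\dim(Q)$ and $\dim(S)\ge\frac32\dim(Q)$.
   Context: The lower $p$-series of a group $G$ is defined by $G_1=G$ and $G_{i+1}=G_i^p[G_i,G]$, where for a subgroup $H$, $H^p$ denotes the subgroup generated by the $p$-th powers of elements of $H$. Each quotient $G_i/G_{i+1}$ is an elementary abelian $p$-group, hence an $\mathbb{F}_p$-vector space. $U_2=U^p[U,U]$ is the second term of the lower $p$-series of the group $U$. *)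

theory Defs
  imports
    "HOL-Algebra.Generated_Groups"
    "HOL-Algebra.Zassenhaus"
    "HOL-Algebra.SndIsomorphismGrp"
    "HOL-Number_Theory.Residues"
    "Jordan_Normal_Form.Missing_VectorSpace"
begin

(* A word is a list of letters (b, x); the letter (True, x) stands for x and (False, x) for its
   inverse. *)
definition word_value :: "('a, 'b) monoid_scheme \<Rightarrow> (bool \<times> 'a) list \<Rightarrow> 'a" where
  "word_value G w =
     foldr (\<lambda>(b, x) g. (if b then x else inv\<^bsub>G\<^esub> x) \<otimes>\<^bsub>G\<^esub> g) w \<one>\<^bsub>G\<^esub>"

definition reduced_word :: "(bool \<times> 'a) list \<Rightarrow> bool" where
  "reduced_word w \<longleftrightarrow> successively (\<lambda>(b, x) (c, y). \<not> (x = y \<and> b \<noteq> c)) w"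

definition free_basis :: "('a, 'b) monoid_scheme \<Rightarrow> 'a set \<Rightarrow> bool" where
  "free_basis G B \<longleftrightarrow>
     B \<subseteq> carrier G \<and> generate G B = carrier G \<and>
     (\<forall>w. w \<noteq> [] \<and> set w \<subseteq> UNIV \<times> B \<and> reduced_word w \<longrightarrow> word_value G w \<noteq> \<one>\<^bsub>G\<^esub>)"

definition free_group_of_rank :: "('a, 'b) monoid_scheme \<Rightarrow> nat \<Rightarrow> bool" where
  "free_group_of_rank G d \<longleftrightarrow>
     group G \<and> (\<exists>B. finite B \<and> card B = d \<and> free_basis G B)"

definition power_subgroup :: "('a, 'b) monoid_scheme \<Rightarrow> 'a set \<Rightarrow> nat \<Rightarrow> 'a set" where
  "power_subgroup G H p = generate G ((\<lambda>h. h [^]\<^bsub>G\<^esub> p) ` H)"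

(* For H = K this is the library's derived subgroup. *)
definition commutator_subgroup :: "('a, 'b) monoid_scheme \<Rightarrow> 'a set \<Rightarrow> 'a set \<Rightarrow> 'a set" where
  "commutator_subgroup G H K =
     generate G (\<Union>h\<in>H. \<Union>k\<in>K. {h \<otimes>\<^bsub>G\<^esub> k \<otimes>\<^bsub>G\<^esub> inv\<^bsub>G\<^esub> h \<otimes>\<^bsub>G\<^esub> inv\<^bsub>G\<^esub> k})"

(* Terms are numbered from 1; the value at index 0 is a dummy. *)
fun lower_p_series :: "nat \<Rightarrow> ('a, 'b) monoid_scheme \<Rightarrow> nat \<Rightarrow> 'a set" where
  "lower_p_series p G 0 = carrier G"
| "lower_p_series p G (Suc 0) = carrier G"
| "lower_p_series p G (Suc (Suc n)) =
     power_subgroup G (lower_p_series p G (Suc n)) p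
       <#>\<^bsub>G\<^esub> commutator_subgroup G (lower_p_series p G (Suc n)) (carrier G)"

(* H N / N *)
definition section_group :: "('a, 'b) monoid_scheme \<Rightarrow> 'a set \<Rightarrow> 'a set \<Rightarrow> 'a set monoid" where
  "section_group G H N = (G\<lparr>carrier := H <#>\<^bsub>G\<^esub> N\<rparr>) Mod N"

(* The group A written additively, with scalars acting by powers: the representatives 0, ..., p - 1
   of the residue ring are integers.  The ring multiplication and unit that the module record type
   inherits play no role. *)
definition Fp_space :: "('a, 'b) monoid_scheme \<Rightarrow> (int, 'a) module" where
  "Fp_space A =
     \<lparr>carrier = carrier A, monoid.mult = undefined, one = undefined,
      zero = \<one>\<^bsub>A\<^esub>, add = (\<otimes>\<^bsub>A\<^esub>), smult = (\<lambda>k x. x [^]\<^bsub>A\<^esub> k)\<rparr>"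

definition Fp_dim :: "nat \<Rightarrow> ('a, 'b) monoid_scheme \<Rightarrow> nat" where
  "Fp_dim p A = vectorspace.dim (residue_ring (int p)) (Fp_space A)"

lemma Fp_space_vectorspace:
  assumes p: "prime p" and A: "comm_group A"
    and exponent: "\<And>x. x \<in> carrier A \<Longrightarrow> x [^]\<^bsub>A\<^esub> p = \<one>\<^bsub>A\<^esub>"
  shows "vectorspace (residue_ring (int p)) (Fp_space A)"
proof -
  interpret A: comm_group A by (rule A)
  interpret R: residues_prime p "residue_ring (int p)"
    by unfold_locales (use p in simp_all)
  let ?R = "residue_ring (int p)"
  have pow_mod: "x [^]\<^bsub>A\<^esub> (k mod int p) = x [^]\<^bsub>A\<^esub> k" if x: "x \<in> carrier A" for x and k :: int
  proof -
    have "x [^]\<^bsub>A\<^esub> k = x [^]\<^bsub>A\<^esub> (int p * (k div int p) + k mod int p)" by simp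
    also have "\<dots> = (x [^]\<^bsub>A\<^esub> int p) [^]\<^bsub>A\<^esub> (k div int p) \<otimes>\<^bsub>A\<^esub> x [^]\<^bsub>A\<^esub> (k mod int p)"
      using x by (simp only: A.int_pow_mult A.int_pow_pow)
    also have "\<dots> = x [^]\<^bsub>A\<^esub> (k mod int p)"
      using x exponent[OF x] by (simp add: int_pow_int)
    finally show ?thesis by simp
  qed
  have "abelian_group (Fp_space A)"
    by (rule abelian_groupI)
       (auto simp: Fp_space_def A.m_ac intro!: bexI[of _ "inv\<^bsub>A\<^esub> _"])
  then have "Module.module ?R (Fp_space A)"
    by (intro Module.moduleI R.cring)
       (auto simp: Fp_space_def R.res_add_eq R.res_mult_eq R.res_one_eq pow_mod A.int_pow_mult
         A.int_pow_distrib A.int_pow_pow mult.commute)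
  then show ?thesis
    by (simp add: vectorspace_def R.is_field)
qed

lemma section_group_vectorspace:
  assumes p: "prime p" and G: "group G" and N: "N \<lhd> G" and H: "subgroup H G"
    and exponent: "\<And>x. x \<in> H \<Longrightarrow> x [^]\<^bsub>G\<^esub> p \<in> N"
    and commute: "\<And>x y. x \<in> H \<Longrightarrow> y \<in> H \<Longrightarrow>
      x \<otimes>\<^bsub>G\<^esub> y \<otimes>\<^bsub>G\<^esub> inv\<^bsub>G\<^esub> x \<otimes>\<^bsub>G\<^esub> inv\<^bsub>G\<^esub> y \<in> N"
  shows "vectorspace (residue_ring (int p)) (Fp_space (section_group G H N))"
proof -
  interpret G: group G by (rule G)
  interpret N: normal N G by (rule N)
  let ?K = "H <#>\<^bsub>G\<^esub> N"
  have HG: "H \<subseteq> carrier G" using H by (rule subgroup.subset)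
  have K: "subgroup ?K G"
    by (metis G.commut_normal G.mult_norm_subgroup H N)
  have NK: "N \<subseteq> ?K"
  proof
    fix n assume n: "n \<in> N"
    then have "\<one>\<^bsub>G\<^esub> \<otimes>\<^bsub>G\<^esub> n \<in> ?K"
      unfolding set_mult_def using subgroup.one_closed[OF H] by blast
    then show "n \<in> ?K" using n by simp
  qed
  interpret M: normal N "G\<lparr>carrier := ?K\<rparr>"
    by (rule G.normal_restrict_supergroup[OF K N NK])
  have coset: "N #>\<^bsub>G\<^esub> (h \<otimes>\<^bsub>G\<^esub> n) = N #>\<^bsub>G\<^esub> h" if "h \<in> H" "n \<in> N" for h n
  proof -
    have h: "h \<in> carrier G" "n \<in> carrier G" using that HG N.subset by auto
    have "h \<otimes>\<^bsub>G\<^esub> n = (h \<otimes>\<^bsub>G\<^esub> n \<otimes>\<^bsub>G\<^esub> inv\<^bsub>G\<^esub> h) \<otimes>\<^bsub>G\<^esub> h"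
      using h by (simp add: G.m_assoc)
    then have "h \<otimes>\<^bsub>G\<^esub> n \<in> N #>\<^bsub>G\<^esub> h"
      using N.inv_op_closed2[OF h(1) that(2)] by (auto simp: r_coset_def)
    then show ?thesis using G.repr_independence h(1) N.subgroup_axioms by metis
  qed
  have carrier: "carrier (section_group G H N) = (\<lambda>h. N #>\<^bsub>G\<^esub> h) ` H"
  proof -
    have "carrier (section_group G H N) = (\<lambda>h. N #>\<^bsub>G\<^esub> h) ` ?K"
      by (auto simp: section_group_def FactGroup_def RCOSETS_def r_coset_def)
    also have "\<dots> = (\<lambda>h. N #>\<^bsub>G\<^esub> h) ` H"
    proof
      show "(\<lambda>h. N #>\<^bsub>G\<^esub> h) ` ?K \<subseteq> (\<lambda>h. N #>\<^bsub>G\<^esub> h) ` H"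
        using coset by (auto simp: set_mult_def)
      have "H \<subseteq> ?K"
      proof
        fix h assume h: "h \<in> H"
        then have "h \<otimes>\<^bsub>G\<^esub> \<one>\<^bsub>G\<^esub> \<in> ?K"
          unfolding set_mult_def using N.one_closed by blast
        then show "h \<in> ?K" using h HG by auto
      qed
      then show "(\<lambda>h. N #>\<^bsub>G\<^esub> h) ` H \<subseteq> (\<lambda>h. N #>\<^bsub>G\<^esub> h) ` ?K" by blast
    qed
    finally show ?thesis .
  qed
  have mult: "monoid.mult (section_group G H N) = (<#>\<^bsub>G\<^esub>)"
    by (intro ext) (simp add: section_group_def FactGroup_def set_mult_def)
  have one: "\<one>\<^bsub>section_group G H N\<^esub> = N"
    by (simp add: section_group_def FactGroup_def)
  have grp: "group (section_group G H N)"
    unfolding section_group_def by (rule M.factorgroup_is_group)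
  have "comm_group (section_group G H N)"
  proof (rule group.group_comm_groupI[OF grp])
    fix a b assume "a \<in> carrier (section_group G H N)" "b \<in> carrier (section_group G H N)"
    then obtain x y where xy: "x \<in> H" "y \<in> H" "a = N #>\<^bsub>G\<^esub> x" "b = N #>\<^bsub>G\<^esub> y"
      unfolding carrier by blast
    have c: "x \<in> carrier G" "y \<in> carrier G" using xy HG by auto
    have "x \<otimes>\<^bsub>G\<^esub> y =
        (x \<otimes>\<^bsub>G\<^esub> y \<otimes>\<^bsub>G\<^esub> inv\<^bsub>G\<^esub> x \<otimes>\<^bsub>G\<^esub> inv\<^bsub>G\<^esub> y) \<otimes>\<^bsub>G\<^esub> (y \<otimes>\<^bsub>G\<^esub> x)"
      using c by (simp add: G.m_assoc) (simp add: G.m_assoc[symmetric])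
    then have "x \<otimes>\<^bsub>G\<^esub> y \<in> N #>\<^bsub>G\<^esub> (y \<otimes>\<^bsub>G\<^esub> x)"
      using commute[OF xy(1,2)] by (auto simp: r_coset_def)
    then have "N #>\<^bsub>G\<^esub> (x \<otimes>\<^bsub>G\<^esub> y) = N #>\<^bsub>G\<^esub> (y \<otimes>\<^bsub>G\<^esub> x)"
      using G.repr_independence c N.subgroup_axioms G.m_closed by metis
    then show "a \<otimes>\<^bsub>section_group G H N\<^esub> b = b \<otimes>\<^bsub>section_group G H N\<^esub> a"
      using c by (simp add: mult xy N.rcos_sum)
  qed
  moreover have "a [^]\<^bsub>section_group G H N\<^esub> p = \<one>\<^bsub>section_group G H N\<^esub>"
    if a: "a \<in> carrier (section_group G H N)" for a
  proof -
    interpret S: group "section_group G H N" by (rule grp)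
    obtain x where x: "x \<in> H" "a = N #>\<^bsub>G\<^esub> x" using a unfolding carrier by blast
    have c: "x \<in> carrier G" using x HG by auto
    have "a [^]\<^bsub>section_group G H N\<^esub> k = N #>\<^bsub>G\<^esub> (x [^]\<^bsub>G\<^esub> k)" for k :: nat
      using c by (induction k) (simp_all add: one mult x N.rcos_sum N.subset)
    then show ?thesis
      using exponent[OF x(1)] by (simp add: one G.coset_join2 N.subgroup_axioms N.mem_carrier)
  qed
  ultimately show ?thesis using p by (intro Fp_space_vectorspace)
qed

lemma (in group) power_subgroup_normal:
  assumes "H \<lhd> G"
  shows "power_subgroup G H p \<lhd> G"
proof -
  interpret H: normal H G by (rule assms)
  have conj_pow: "g \<otimes> h [^] n \<otimes> inv g = (g \<otimes> h \<otimes> inv g) [^] n"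
    if "g \<in> carrier G" "h \<in> carrier G" for g h and n :: nat
  proof (induction n)
    case (Suc n)
    have "g \<otimes> h [^] Suc n \<otimes> inv g = (g \<otimes> h [^] n \<otimes> inv g) \<otimes> (g \<otimes> h \<otimes> inv g)"
      using that by (simp add: m_assoc) (simp add: m_assoc[symmetric])
    then show ?case by (simp add: Suc)
  qed (use that in simp)
  show ?thesis
    unfolding power_subgroup_def
  proof (rule normal_generateI)
    show "(\<lambda>h. h [^] p) ` H \<subseteq> carrier G" using H.subset by auto
    fix h g assume "h \<in> (\<lambda>h. h [^] p) ` H" and g: "g \<in> carrier G"
    then obtain k where k: "k \<in> H" "h = k [^] p" by blast
    then have "g \<otimes> h \<otimes> inv g = (g \<otimes> k \<otimes> inv g) [^] p"
      using g H.subset by (auto simp: conj_pow)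
    then show "g \<otimes> h \<otimes> inv g \<in> (\<lambda>h. h [^] p) ` H"
      using H.inv_op_closed2[OF g k(1)] by blast
  qed
qed

lemma (in group) commutator_subgroup_normal:
  assumes "H \<lhd> G" "K \<lhd> G"
  shows "commutator_subgroup G H K \<lhd> G"
proof -
  interpret H: normal H G by (rule assms(1))
  interpret K: normal K G by (rule assms(2))
  show ?thesis
    unfolding commutator_subgroup_def
  proof (rule normal_generateI)
    show "(\<Union>h\<in>H. \<Union>k\<in>K. {h \<otimes> k \<otimes> inv h \<otimes> inv k}) \<subseteq> carrier G" by auto
    fix x g assume "x \<in> (\<Union>h\<in>H. \<Union>k\<in>K. {h \<otimes> k \<otimes> inv h \<otimes> inv k})" and g: "g \<in> carrier G"
    then obtain h k where hk: "h \<in> H" "k \<in> K" "x = h \<otimes> k \<otimes> inv h \<otimes> inv k" by blast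
    define h' k' where "h' = g \<otimes> h \<otimes> inv g" and "k' = g \<otimes> k \<otimes> inv g"
    have c: "h \<in> carrier G" "k \<in> carrier G" using hk by auto
    have cancel: "inv g \<otimes> (g \<otimes> y) = y" if "y \<in> carrier G" for y
      using g that by (simp add: m_assoc[symmetric])
    have "h' \<in> H" "k' \<in> K"
      using H.inv_op_closed2[OF g hk(1)] K.inv_op_closed2[OF g hk(2)] by (auto simp: h'_def k'_def)
    moreover have "g \<otimes> x \<otimes> inv g = h' \<otimes> k' \<otimes> inv h' \<otimes> inv k'"
      using g c by (simp add: hk(3) h'_def k'_def m_assoc inv_mult_group cancel)
    ultimately show "g \<otimes> x \<otimes> inv g \<in> (\<Union>h\<in>H. \<Union>k\<in>K. {h \<otimes> k \<otimes> inv h \<otimes> inv k})" by blast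
  qed
qed

lemma (in group) lower_p_series_normal: "lower_p_series p G n \<lhd> G"
  by (induction n rule: induct_nat_012)
     (auto intro!: normal_self normal_subgroup_set_mult_closed power_subgroup_normal
       commutator_subgroup_normal)

lemma lower_p_series_section_vectorspace:
  assumes p: "prime p" and G: "group G" and H: "subgroup H G"
    and sub: "H \<subseteq> lower_p_series p G (Suc n)"
  shows "vectorspace (residue_ring (int p))
           (Fp_space (section_group G H (lower_p_series p G (Suc (Suc n)))))"
proof (rule section_group_vectorspace[OF p G _ H])
  interpret group G by (rule G)
  let ?L = "lower_p_series p G (Suc n)"
  let ?P = "power_subgroup G ?L p" and ?C = "commutator_subgroup G ?L (carrier G)"
  have L: "?L \<lhd> G" by (rule lower_p_series_normal)
  have P: "subgroup ?P G"
    by (rule normal_imp_subgroup[OF power_subgroup_normal[OF L]])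
  have C: "subgroup ?C G"
    by (rule normal_imp_subgroup[OF commutator_subgroup_normal[OF L normal_self]])
  have PC: "?P \<subseteq> lower_p_series p G (Suc (Suc n))" "?C \<subseteq> lower_p_series p G (Suc (Suc n))"
  proof -
    show "?P \<subseteq> lower_p_series p G (Suc (Suc n))"
    proof
      fix x assume x: "x \<in> ?P"
      then have "x \<otimes>\<^bsub>G\<^esub> \<one>\<^bsub>G\<^esub> \<in> ?P <#>\<^bsub>G\<^esub> ?C"
        unfolding set_mult_def using subgroup.one_closed[OF C] by blast
      then show "x \<in> lower_p_series p G (Suc (Suc n))"
        using subgroup.mem_carrier[OF P x] by simp
    qed
    show "?C \<subseteq> lower_p_series p G (Suc (Suc n))"
    proof
      fix x assume x: "x \<in> ?C"
      then have "\<one>\<^bsub>G\<^esub> \<otimes>\<^bsub>G\<^esub> x \<in> ?P <#>\<^bsub>G\<^esub> ?C"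
        unfolding set_mult_def using subgroup.one_closed[OF P] by blast
      then show "x \<in> lower_p_series p G (Suc (Suc n))"
        using subgroup.mem_carrier[OF C x] by simp
    qed
  qed
  have HG: "H \<subseteq> carrier G" using H by (rule subgroup.subset)
  show "lower_p_series p G (Suc (Suc n)) \<lhd> G" by (rule lower_p_series_normal)
  show "x [^]\<^bsub>G\<^esub> p \<in> lower_p_series p G (Suc (Suc n))" if "x \<in> H" for x
  proof -
    have "x [^]\<^bsub>G\<^esub> p \<in> ?P"
      unfolding power_subgroup_def using that sub by (blast intro: generate.incl)
    then show ?thesis using PC by blast
  qed
  show "x \<otimes>\<^bsub>G\<^esub> y \<otimes>\<^bsub>G\<^esub> inv\<^bsub>G\<^esub> x \<otimes>\<^bsub>G\<^esub> inv\<^bsub>G\<^esub> y \<in> lower_p_series p G (Suc (Suc n))"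
    if "x \<in> H" "y \<in> H" for x y
  proof -
    have "x \<otimes>\<^bsub>G\<^esub> y \<otimes>\<^bsub>G\<^esub> inv\<^bsub>G\<^esub> x \<otimes>\<^bsub>G\<^esub> inv\<^bsub>G\<^esub> y \<in> ?C"
      unfolding commutator_subgroup_def using that sub HG by (blast intro: generate.incl)
    then show ?thesis using PC by blast
  qed
qed

end

theory Submission
  imports Defs "HOL-Library.Function_Algebras"
begin

text \<open>Let \<open>L n\<close> be the lower \<open>p\<close>-series of the free group. The Magnus map \<open>x \<mapsto> 1 + X\<close> into the
  noncommutative power series over the integers sends \<open>L n\<close> into \<open>1 + I ^ n\<close>, where \<open>I\<close> is the ideal
  generated by \<open>p\<close> and the variables, and in fact an element of \<open>L n\<close> lies in \<open>L (n + 1)\<close> exactly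
  if its image lies in \<open>1 + I ^ (n + 1)\<close>. For this one needs that the free Lie algebra over the field
  with \<open>p\<close> elements embeds into the free associative algebra, which Lazard elimination proves
  directly for the Lie ring of the filtration.

  So \<open>L n / L (n + 1)\<close> becomes a space of noncommutative polynomials. For \<open>n \<ge> 2\<close> the \<open>p\<close>-th power
  map becomes the inclusion into the space for \<open>n + 1\<close>, which bounds the dimension of \<open>R\<close>, and the
  commutator with a basis element \<open>x\<close> becomes the bracket with the variable \<open>X\<close>. The bound for \<open>S\<close>
  thus reduces to an estimate for the brackets of a finite space of polynomials with three variables.\<close>

subsection \<open>Noncommutative power series with integer coefficients\<close>

text \<open>The coefficients have to be integers: modulo \<open>p\<close>, raising
  \<open>1 + f\<close> to the \<open>p\<close>-th power forgets everything but \<open>f ^ p\<close>.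
  The associated graded ring of the powers of \<open>I\<close> is a polynomial ring in a central
  \<open>t\<close>, the class of \<open>p\<close>, over noncommutative polynomials modulo
  \<open>p\<close>. For \<open>p = 2\<close> the square of an element of weight 1 is not given by
  multiplication by \<open>t\<close>, since \<open>(1 + X) ^ 2 = 1 + 2 X + X ^ 2\<close>; hence
  \<open>i \<ge> 2\<close>, and hence the special treatment of weight 1 in the computation of the
  kernel. Bracketing with a variable kills the powers of that variable, and injectivity breaks down
  on them. The remedy is that the coefficient of \<open>x ^ n\<close> in the image of
  \<open>g\<close> is a binomial coefficient in the exponent sum of \<open>x\<close>, so that these
  terms vanish as soon as the linear one does. Dimensions are compared through orders of finite
  groups of functions on words: the bound for \<open>S\<close> is obtained as
  \<open>card A ^ 3 \<le> card N ^ 2\<close>, where both sides are powers of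
  \<open>p\<close>.\<close>

primrec word_conv :: "('x list \<Rightarrow> int) \<Rightarrow> ('x list \<Rightarrow> int) \<Rightarrow> 'x list \<Rightarrow> int" where
  "word_conv f g [] = f [] * g []"
| "word_conv f g (x # u) = f [] * g (x # u) + word_conv (\<lambda>v. f (x # v)) g u"

lemma word_conv_add_left:
  "word_conv (\<lambda>v. f v + g v) h u = word_conv f h u + word_conv g h u"
  by (induction u arbitrary: f g) (simp_all add: algebra_simps)

lemma word_conv_add_right:
  "word_conv f (\<lambda>v. g v + h v) u = word_conv f g u + word_conv f h u"
  by (induction u arbitrary: f) (simp_all add: algebra_simps)

lemma word_conv_scale_left: "word_conv (\<lambda>v. c * f v) g u = c * word_conv f g u"
  by (induction u arbitrary: f) (simp_all add: algebra_simps)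

lemma word_conv_zero_left: "word_conv (\<lambda>v. 0) g u = 0"
  by (induction u) simp_all

text \<open>The second equation of \<open>word_conv\<close> is a product rule for the left quotient
  \<open>\<lambda>v. f (x # v)\<close>. Hence the induction on the word keeps \<open>f\<close>
  general and puts the quotient in its place.\<close>

lemma word_conv_assoc: "word_conv (word_conv f g) h u = word_conv f (word_conv g h) u"
proof (induction u arbitrary: f)
  case (Cons x u)
  have "word_conv (\<lambda>v. word_conv f g (x # v)) h u =
      f [] * word_conv (\<lambda>v. g (x # v)) h u + word_conv (word_conv (\<lambda>v. f (x # v)) g) h u"
    by (simp add: word_conv_add_left word_conv_scale_left)
  then show ?case by (simp add: Cons.IH algebra_simps)
qed simp

lemma word_conv_one_left: "word_conv (\<lambda>v. if v = [] then 1 else 0) g u = g u"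
  by (cases u) (simp_all add: word_conv_zero_left)

lemma word_conv_one_right: "word_conv f (\<lambda>v. if v = [] then 1 else 0) u = f u"
  by (induction u arbitrary: f) simp_all

typedef 'x ncps = "UNIV :: ('x list \<Rightarrow> int) set"
  morphisms wcoeff ncps ..

setup_lifting type_definition_ncps

lemma ncps_eqI: "(\<And>u. wcoeff f u = wcoeff g u) \<Longrightarrow> f = g"
  by (simp add: wcoeff_inject[symmetric] fun_eq_iff)

instantiation ncps :: (type) ring_1
begin

lift_definition zero_ncps :: "'a ncps" is "\<lambda>u. 0" .
lift_definition one_ncps :: "'a ncps" is "\<lambda>u. if u = [] then 1 else 0" .
lift_definition plus_ncps :: "'a ncps \<Rightarrow> 'a ncps \<Rightarrow> 'a ncps" is "\<lambda>f g u. f u + g u" .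
lift_definition minus_ncps :: "'a ncps \<Rightarrow> 'a ncps \<Rightarrow> 'a ncps" is "\<lambda>f g u. f u - g u" .
lift_definition uminus_ncps :: "'a ncps \<Rightarrow> 'a ncps" is "\<lambda>f u. - f u" .
lift_definition times_ncps :: "'a ncps \<Rightarrow> 'a ncps \<Rightarrow> 'a ncps" is word_conv .

instance
proof
  fix f g h :: "'a ncps"
  show "f * g * h = f * (g * h)"
    by transfer (simp add: word_conv_assoc fun_eq_iff)
  show "(f + g) * h = f * h + g * h"
    by transfer (simp add: word_conv_add_left fun_eq_iff)
  show "f * (g + h) = f * g + f * h"
    by transfer (simp add: word_conv_add_right fun_eq_iff)
  show "1 * f = f"
    by transfer (simp add: word_conv_one_left fun_eq_iff)
  show "f * 1 = f"
    by transfer (simp add: word_conv_one_right fun_eq_iff)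
  show "(0 :: 'a ncps) \<noteq> 1"
    by transfer (auto simp: fun_eq_iff)
qed (transfer, simp add: algebra_simps)+

end

lemma wcoeff_0 [simp]: "wcoeff 0 u = 0" by transfer simp
lemma wcoeff_1: "wcoeff 1 u = (if u = [] then 1 else 0)" by transfer simp
lemma wcoeff_add [simp]: "wcoeff (f + g) u = wcoeff f u + wcoeff g u" by transfer simp
lemma wcoeff_minus [simp]: "wcoeff (f - g) u = wcoeff f u - wcoeff g u" by transfer simp
lemma wcoeff_uminus [simp]: "wcoeff (- f) u = - wcoeff f u" by transfer simp
lemma wcoeff_mult: "wcoeff (f * g) u = word_conv (wcoeff f) (wcoeff g) u" by transfer simp
lemma wcoeff_mult_Nil [simp]: "wcoeff (f * g) [] = wcoeff f [] * wcoeff g []" by (simp add: wcoeff_mult)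

lemma wcoeff_sum [simp]: "wcoeff (sum f A) u = (\<Sum>a\<in>A. wcoeff (f a) u)"
  by (induction A rule: infinite_finite_induct) auto

lemma wcoeff_of_nat_mult [simp]: "wcoeff (of_nat n * f) u = int n * wcoeff f u"
  by (induction n) (simp_all add: algebra_simps)

lemma wcoeff_of_int_mult [simp]: "wcoeff (of_int n * f) u = n * wcoeff f u"
proof (cases n rule: int_cases2)
  case (nonneg m)
  then show ?thesis by simp
next
  case (nonpos m)
  then show ?thesis by simp
qed

lift_definition letter :: "'x \<Rightarrow> 'x ncps" is "\<lambda>x u. if u = [x] then 1 else 0" .

lemma wcoeff_letter: "wcoeff (letter x) u = (if u = [x] then 1 else 0)"
  by transfer simp

lemma wcoeff_letter_mult:
  "wcoeff (letter x * f) u = (case u of [] \<Rightarrow> 0 | y # v \<Rightarrow> if y = x then wcoeff f v else 0)"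
proof (cases u)
  case (Cons y v)
  have "wcoeff (letter x * f) (y # v) = word_conv (\<lambda>v. if y = x \<and> v = [] then 1 else 0) (wcoeff f) v"
    by (simp add: wcoeff_mult wcoeff_letter conj_commute cong: if_cong)
  then show ?thesis
    using word_conv_one_left[of "wcoeff f" v] word_conv_zero_left[of "wcoeff f" v]
    by (cases "y = x") (simp_all add: Cons)
qed (simp add: wcoeff_letter)

lemma wcoeff_mult_letter:
  "wcoeff (f * letter x) u = (if u \<noteq> [] \<and> last u = x then wcoeff f (butlast u) else 0)"
proof -
  have "word_conv g (\<lambda>u. if u = [x] then 1 else 0) u
      = (if u \<noteq> [] \<and> last u = x then g (butlast u) else 0)" for g
    by (induction u arbitrary: g) auto
  then show ?thesis by (simp add: wcoeff_mult wcoeff_letter[abs_def])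
qed

text \<open>Stands for \<open>I ^ n\<close>: a word of length \<open>l\<close> supplies
  \<open>l\<close> factors of \<open>I\<close>, and \<open>p\<close> has to supply the others.
  Truncated subtraction makes the condition void on words of length at least
  \<open>n\<close>.\<close>

definition adic :: "nat \<Rightarrow> nat \<Rightarrow> 'x ncps set" where
  "adic p n = {f. \<forall>u. int p ^ (n - length u) dvd wcoeff f u}"

lemma adicI: "(\<And>u. int p ^ (n - length u) dvd wcoeff f u) \<Longrightarrow> f \<in> adic p n"
  by (simp add: adic_def)

lemma adicD: "f \<in> adic p n \<Longrightarrow> int p ^ (n - length u) dvd wcoeff f u"
  by (simp add: adic_def)

lemma adic_zero [simp]: "0 \<in> adic p n" by (simp add: adic_def)

lemma adic_0 [simp]: "f \<in> adic p 0" by (simp add: adic_def)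

lemma adic_add: "f \<in> adic p n \<Longrightarrow> g \<in> adic p n \<Longrightarrow> f + g \<in> adic p n"
  by (simp add: adic_def)

lemma adic_uminus: "f \<in> adic p n \<Longrightarrow> - f \<in> adic p n"
  by (simp add: adic_def)

lemma adic_diff: "f \<in> adic p n \<Longrightarrow> g \<in> adic p n \<Longrightarrow> f - g \<in> adic p n"
  by (simp add: adic_def)

lemma adic_sum: "(\<And>a. a \<in> A \<Longrightarrow> f a \<in> adic p n) \<Longrightarrow> sum f A \<in> adic p n"
  by (induction A rule: infinite_finite_induct) (auto intro: adic_add)

lemma adic_mono: "f \<in> adic p n \<Longrightarrow> m \<le> n \<Longrightarrow> f \<in> adic p m"
  by (meson adicI adicD le_imp_power_dvd dvd_trans diff_le_mono)

lemma adic_p_mult: "(f :: 'a ncps) \<in> adic p n \<Longrightarrow> of_nat p * f \<in> adic p (Suc n)"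
proof (rule adicI)
  fix u :: "'a list" assume f: "f \<in> adic p n"
  have "int p ^ (Suc n - length u) dvd int p ^ Suc (n - length u)"
    by (rule le_imp_power_dvd) simp
  also have "\<dots> dvd int p * wcoeff f u"
    using adicD[OF f, of u] by simp
  finally show "int p ^ (Suc n - length u) dvd wcoeff (of_nat p * f) u" by simp
qed

lemma adic_mult:
  assumes "f \<in> adic p m" "g \<in> adic p n"
  shows "f * g \<in> adic p (m + n)"
proof -
  have "int p ^ (m + n - length u) dvd word_conv f g u"
    if "\<And>v. int p ^ (m - length v) dvd f v" and g: "\<And>v. int p ^ (n - length v) dvd g v"
    for f g and u :: "'a list"
    using that(1)
  proof (induction u arbitrary: f m)
    case Nil
    then show ?case using mult_dvd_mono[OF Nil[of "[]"] g[of "[]"]] by (simp add: power_add)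
  next
    case (Cons x u)
    have "int p ^ (m + n - length (x # u)) dvd int p ^ (m + (n - length (x # u)))"
      by (rule le_imp_power_dvd) simp
    also have "\<dots> dvd f [] * g (x # u)"
      using mult_dvd_mono[OF Cons.prems[of "[]"] g[of "x # u"]] by (simp add: power_add)
    finally have 1: "int p ^ (m + n - length (x # u)) dvd f [] * g (x # u)" .
    \<comment> \<open>A left quotient loses one unit of weight. For \<open>m = 0\<close> the
      truncated \<open>m - 1\<close> is again 0, and the comparison of exponents still
      holds.\<close>
    have "int p ^ (m + n - length (x # u)) dvd int p ^ (m - 1 + n - length u)"
      by (rule le_imp_power_dvd) simp
    also have "\<dots> dvd word_conv (\<lambda>v. f (x # v)) g u"
    proof (rule Cons.IH)
      fix v show "int p ^ (m - 1 - length v) dvd f (x # v)"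
        using Cons.prems[of "x # v"] by simp
    qed
    finally show ?case using 1 by simp
  qed
  then show ?thesis
    using adicD[OF assms(1)] adicD[OF assms(2)] by (intro adicI) (simp add: wcoeff_mult)
qed

lemma adic_power: "f \<in> adic p m \<Longrightarrow> f ^ n \<in> adic p (n * m)"
  by (induction n) (auto intro: adic_mult)

lemma letter_adic: "letter x \<in> adic p 1"
  by (rule adicI) (simp add: wcoeff_letter)

lemma binomial_one_plus: "(1 + f :: 'r :: ring_1) ^ n = (\<Sum>r\<le>n. of_nat (n choose r) * f ^ r)"
proof (induction n)
  case (Suc n)
  have "(1 + f) ^ Suc n = (\<Sum>r\<le>n. of_nat (n choose r) * f ^ r)
      + (\<Sum>r\<le>n. of_nat (n choose r) * f ^ Suc r)"
    by (simp only: power_Suc2 Suc) (simp add: distrib_left sum_distrib_right mult.assoc power_commutes)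
  also have "(\<Sum>r\<le>n. of_nat (n choose r) * f ^ r) = (\<Sum>r\<le>Suc n. of_nat (n choose r) * f ^ r)"
    by (simp add: binomial_eq_0)
  also have "\<dots> = 1 + (\<Sum>r\<le>n. of_nat (n choose Suc r) * f ^ Suc r)"
    by (simp only: sum.atMost_Suc_shift) simp
  also have "1 + (\<Sum>r\<le>n. of_nat (n choose Suc r) * f ^ Suc r) + (\<Sum>r\<le>n. of_nat (n choose r) * f ^ Suc r)
      = 1 + (\<Sum>r\<le>n. of_nat (Suc n choose Suc r) * f ^ Suc r)"
    by (simp add: algebra_simps sum.distrib)
  also have "\<dots> = (\<Sum>r\<le>Suc n. of_nat (Suc n choose r) * f ^ r)"
    by (simp only: sum.atMost_Suc_shift) simp
  finally show ?case .
qed simp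

text \<open>For \<open>n = 1\<close> the term \<open>f ^ p\<close> need not lie in \<open>adic p (n + 2)\<close>, but it vanishes on short words.\<close>
lemma wcoeff_power_p:
  assumes p: "prime p" and f: "f \<in> adic p n" "wcoeff f [] = 0" and n: "n \<ge> 1"
    and u: "n \<ge> 2 \<or> length u < p"
  shows "int p ^ (n + 2 - length u) dvd wcoeff ((1 + f) ^ p - 1 - of_nat p * f) u"
proof -
  have p2: "p \<ge> 2" using p by (rule prime_ge_2_nat)
  have eq: "(1 + f) ^ p - 1 - of_nat p * f = (\<Sum>r\<in>{2..<p}. of_nat (p choose r) * f ^ r) + f ^ p"
  proof -
    have "{..p} = insert 0 (insert 1 (insert p {2..<p}))" using p2 by auto
    then show ?thesis using p2 by (simp add: binomial_one_plus)
  qed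
  \<comment> \<open>The binomial coefficient contributes one factor \<open>p\<close>, the power of
    \<open>f\<close> has weight \<open>r * n \<ge> 2 * n \<ge> n + 1\<close>.\<close>
  have mid: "of_nat (p choose r) * f ^ r \<in> adic p (n + 2)" if r: "r \<in> {2..<p}" for r
  proof -
    have "p dvd (p choose r)"
      using r p by (intro dvd_choose_prime) auto
    then obtain c where c: "p choose r = p * c" ..
    have "n + 1 \<le> 2 * n" using n by simp
    also have "\<dots> \<le> r * n" using r by simp
    finally have "f ^ r \<in> adic p (n + 1)"
      using adic_mono[OF adic_power[OF f(1)]] by blast
    then have "of_nat c * f ^ r \<in> adic p (n + 1)"
      by (auto simp: adic_def)
    from adic_p_mult[OF this] show ?thesis by (simp add: c mult.assoc)
  qed
  \<comment> \<open>Since \<open>f\<close> has no constant term, \<open>f ^ k\<close> starts in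
    length \<open>k\<close>.\<close>
  have zero: "wcoeff (f ^ k) v = 0" if "length v < k" for k v
    using that
  proof (induction k arbitrary: v)
    case (Suc k)
    have "word_conv g (wcoeff (f ^ k)) v = 0" if "g [] = 0" "length v < Suc k" for g v
      using that(2)
    proof -
      have gen: "word_conv g h v = 0" if "\<And>w. length w < k \<Longrightarrow> h w = (0::int)" "length v < k" for g h v
        using that(2) by (induction v arbitrary: g) (simp_all add: that(1))
      show ?thesis using that gen[OF Suc.IH] by (cases v) auto
    qed
    then show ?case using Suc.prems f(2) by (simp add: wcoeff_mult)
  qed simp
  have "int p ^ (n + 2 - length u) dvd wcoeff (f ^ p) u"
  proof (cases "n \<ge> 2")
    case True
    have "n + 2 \<le> 2 * n" using True by simp
    also have "\<dots> \<le> p * n" using p2 by simp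
    finally show ?thesis using adicD[OF adic_mono[OF adic_power[OF f(1)]]] by blast
  next
    case False
    then show ?thesis using u zero by simp
  qed
  moreover have "int p ^ (n + 2 - length u) dvd wcoeff (\<Sum>r\<in>{2..<p}. of_nat (p choose r) * f ^ r) u"
    by (rule adicD[OF adic_sum[OF mid]])
  ultimately show ?thesis unfolding eq by simp
qed

section \<open>Commutator calculus\<close>

context group
begin

definition comm :: "'a \<Rightarrow> 'a \<Rightarrow> 'a" where
  "comm x y = x \<otimes> y \<otimes> inv x \<otimes> inv y"

lemma comm_closed [simp, intro]: "x \<in> carrier G \<Longrightarrow> y \<in> carrier G \<Longrightarrow> comm x y \<in> carrier G"
  by (simp add: comm_def)

lemma inv_cancel [simp]:
  assumes "x \<in> carrier G" "y \<in> carrier G"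
  shows "inv x \<otimes> (x \<otimes> y) = y" "x \<otimes> (inv x \<otimes> y) = y"
  using assms by (simp_all add: m_assoc[symmetric])

lemmas free_simps = comm_def m_assoc inv_mult_group

lemma inv_comm: "x \<in> carrier G \<Longrightarrow> y \<in> carrier G \<Longrightarrow> inv (comm x y) = comm y x"
  by (simp add: free_simps)

text \<open>The conjugate of \<open>comm x' y\<close> by \<open>x\<close> is written as
  \<open>comm x (comm x' y) \<otimes> comm x' y\<close>, which exhibits the deviation from
  additivity as a commutator of higher weight.\<close>

lemma comm_mult_left:
  "x \<in> carrier G \<Longrightarrow> x' \<in> carrier G \<Longrightarrow> y \<in> carrier G \<Longrightarrow>
    comm (x \<otimes> x') y = comm x (comm x' y) \<otimes> (comm x' y \<otimes> comm x y)"
  by (simp add: free_simps)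

lemma comm_mult_right:
  "x \<in> carrier G \<Longrightarrow> y \<in> carrier G \<Longrightarrow> y' \<in> carrier G \<Longrightarrow>
    comm x (y \<otimes> y') = comm x y \<otimes> (comm y (comm x y') \<otimes> comm x y')"
  by (simp add: free_simps)

lemma comm_conj:
  "x \<in> carrier G \<Longrightarrow> y \<in> carrier G \<Longrightarrow> z \<in> carrier G \<Longrightarrow>
    comm z (comm x y) = comm (comm z x \<otimes> x) (comm z y \<otimes> y) \<otimes> inv (comm x y)"
  by (simp add: free_simps)

lemma mult_eq_comm_mult: "x \<in> carrier G \<Longrightarrow> y \<in> carrier G \<Longrightarrow> x \<otimes> y = comm x y \<otimes> (y \<otimes> x)"
  by (simp add: free_simps)

text \<open>Collection in class two: moving an \<open>x\<close> to the left past a \<open>y\<close>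
  costs one central factor \<open>comm y x\<close>. Their number is \<open>n choose 2\<close>, but
  later it only matters that the correction is some power of \<open>comm y x\<close>.\<close>

lemma power_mult_central_comm:
  assumes x: "x \<in> carrier G" and y: "y \<in> carrier G"
    and c: "comm y x \<otimes> x = x \<otimes> comm y x" "comm y x \<otimes> y = y \<otimes> comm y x"
  shows "\<exists>s::nat. (x \<otimes> y) [^] (n::nat) = comm y x [^] s \<otimes> (x [^] n \<otimes> y [^] n)"
proof -
  define t where "t = comm y x"
  have t: "t \<in> carrier G" using x y by (simp add: t_def)
  have yx: "y \<otimes> x = t \<otimes> (x \<otimes> y)" using x y by (simp add: t_def mult_eq_comm_mult[symmetric])
  have commute: "t [^] (m::nat) \<otimes> w [^] (k::nat) = w [^] k \<otimes> t [^] m"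
    if "w \<in> carrier G" "t \<otimes> w = w \<otimes> t" for w m k
    using group_commutes_pow[OF group_commutes_pow[OF that(2) t that(1), symmetric] that(1)] t
    by simp
  have cx: "t [^] (m::nat) \<otimes> x [^] (k::nat) = x [^] k \<otimes> t [^] m"
    and cy: "t [^] (m::nat) \<otimes> y [^] (k::nat) = y [^] k \<otimes> t [^] m" for m k
    using commute x y c by (simp_all add: t_def)
  have yn: "y [^] (n::nat) \<otimes> x = t [^] n \<otimes> (x \<otimes> y [^] n)" for n
  proof (induction n)
    case (Suc n)
    have "y [^] Suc n \<otimes> x = y [^] n \<otimes> t [^] (1::nat) \<otimes> (x \<otimes> y)"
      using x y t yx by (simp add: m_assoc)
    also have "\<dots> = t \<otimes> (y [^] n \<otimes> x) \<otimes> y"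
    proof -
      have "y [^] n \<otimes> t = t \<otimes> y [^] n" using cy[of 1 n] t by simp
      then have "y [^] n \<otimes> t \<otimes> (x \<otimes> y) = t \<otimes> y [^] n \<otimes> (x \<otimes> y)" by simp
      then show ?thesis using x y t by (simp add: m_assoc)
    qed
    also have "\<dots> = (t \<otimes> t [^] n) \<otimes> (x \<otimes> y [^] Suc n)"
      using x y t by (simp add: Suc m_assoc)
    also have "t \<otimes> t [^] n = t [^] Suc n" using t by (metis nat_pow_Suc2)
    finally show ?case .
  qed (use x in simp)
  show ?thesis
  proof (induction n)
    case (Suc n)
    then obtain s :: nat where s: "(x \<otimes> y) [^] n = t [^] s \<otimes> (x [^] n \<otimes> y [^] n)"
      unfolding t_def by blast
    have "(x \<otimes> y) [^] Suc n = t [^] s \<otimes> x [^] n \<otimes> (y [^] n \<otimes> x) \<otimes> y"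
      using x y t by (simp add: s m_assoc)
    also have "\<dots> = t [^] s \<otimes> (x [^] n \<otimes> t [^] n) \<otimes> (x \<otimes> y [^] n) \<otimes> y"
      using x y t by (simp add: yn m_assoc)
    also have "\<dots> = (t [^] s \<otimes> t [^] n) \<otimes> (x [^] Suc n \<otimes> y [^] Suc n)"
      using x y t by (simp add: cx[symmetric] m_assoc)
    also have "t [^] s \<otimes> t [^] n = t [^] (s + n)" using t by (simp add: nat_pow_mult)
    finally show ?case unfolding t_def by blast
  qed (use x y in \<open>auto intro: exI[of _ 0]\<close>)
qed

end

section \<open>Filtrations compatible with commutators and p-th powers\<close>

locale p_filtration = group G for G (structure) +
  fixes p :: nat and L :: "nat \<Rightarrow> 'a set"
  assumes L_normal: "L n \<lhd> G"
    and L_1: "L 1 = carrier G"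
    and L_Suc_subset: "L (Suc n) \<subseteq> L n"
    and L_power: "n \<ge> 1 \<Longrightarrow> x \<in> L n \<Longrightarrow> x [^] p \<in> L (Suc n)"
    and L_comm: "m \<ge> 1 \<Longrightarrow> n \<ge> 1 \<Longrightarrow> x \<in> L m \<Longrightarrow> y \<in> L n \<Longrightarrow> comm x y \<in> L (m + n)"
begin

lemma L_subgroup: "subgroup (L n) G" using L_normal by (rule normal_imp_subgroup)

lemma L_carrier: "x \<in> L n \<Longrightarrow> x \<in> carrier G"
  using L_subgroup by (rule subgroup.mem_carrier)

lemma L_mult: "x \<in> L n \<Longrightarrow> y \<in> L n \<Longrightarrow> x \<otimes> y \<in> L n"
  using L_subgroup by (rule subgroup.m_closed)

lemma L_inv: "x \<in> L n \<Longrightarrow> inv x \<in> L n"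
  using L_subgroup by (rule subgroup.m_inv_closed)

lemma L_one: "\<one> \<in> L n"
  using L_subgroup by (rule subgroup.one_closed)

lemma L_mono: "m \<le> n \<Longrightarrow> L n \<subseteq> L m"
  using lift_Suc_antimono_le[of L m n] L_Suc_subset by blast

lemma L_monoD: "x \<in> L n \<Longrightarrow> m \<le> n \<Longrightarrow> x \<in> L m"
  using L_mono by blast

text \<open>Identities of the associated graded Lie ring are stated as equalities of such cosets in
  the group itself; products play the part of sums and \<open>comm\<close> that of the
  bracket.\<close>

abbreviation cl :: "nat \<Rightarrow> 'a \<Rightarrow> 'a set" where "cl n x \<equiv> L n #> x"

lemma cl_hom: "group_hom G (G Mod L n) (cl n)"
  using L_normal by (intro group_hom.intro group_hom_axioms.intro)
    (auto intro: normal.factorgroup_is_group normal.r_coset_hom_Mod is_group)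

lemma cl_mult:
  "x \<in> carrier G \<Longrightarrow> y \<in> carrier G \<Longrightarrow> cl n (x \<otimes> y) = cl n x \<otimes>\<^bsub>G Mod L n\<^esub> cl n y"
  by (rule group_hom.hom_mult[OF cl_hom])

lemma cl_inv: "x \<in> carrier G \<Longrightarrow> cl n (inv x) = inv\<^bsub>G Mod L n\<^esub> cl n x"
  by (rule group_hom.hom_inv[OF cl_hom])

lemma cl_eq_iff: "x \<in> carrier G \<Longrightarrow> y \<in> carrier G \<Longrightarrow> cl n x = cl n y \<longleftrightarrow> x \<otimes> inv y \<in> L n"
  by (metis L_subgroup is_group repr_independence repr_independenceD rcos_self subgroup.rcos_module)

lemma cl_absorb: "z \<in> L n \<Longrightarrow> x \<in> carrier G \<Longrightarrow> cl n (z \<otimes> x) = cl n x"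
  using L_carrier[of z n] by (simp add: cl_eq_iff m_assoc)

lemma cl_mem: "cl n x = cl n y \<Longrightarrow> x \<in> carrier G \<Longrightarrow> y \<in> L n \<Longrightarrow> x \<in> L n"
  using L_mult[of "x \<otimes> inv y" n y] L_carrier[of y n] by (simp add: cl_eq_iff m_assoc)

lemma cl_decomp:
  assumes "cl n x = cl n y" "x \<in> carrier G" "y \<in> carrier G"
  obtains z where "z \<in> L n" "x = z \<otimes> y"
  using assms that[of "x \<otimes> inv y"] by (simp add: cl_eq_iff m_assoc)

lemma cl_mult_cong:
  assumes "cl n x = cl n x'" "cl n y = cl n y'"
    and "x \<in> carrier G" "x' \<in> carrier G" "y \<in> carrier G" "y' \<in> carrier G"
  shows "cl n (x \<otimes> y) = cl n (x' \<otimes> y')"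
  using assms by (simp add: cl_mult)

lemma cl_inv_cong:
  "cl n x = cl n y \<Longrightarrow> x \<in> carrier G \<Longrightarrow> y \<in> carrier G \<Longrightarrow> cl n (inv x) = cl n (inv y)"
  by (simp add: cl_inv)

lemma cl_comm_swap:
  "m \<ge> 1 \<Longrightarrow> n \<ge> 1 \<Longrightarrow> x \<in> L m \<Longrightarrow> y \<in> L n \<Longrightarrow> k \<le> m + n \<Longrightarrow> cl k (x \<otimes> y) = cl k (y \<otimes> x)"
  using cl_absorb[of "comm x y" k "y \<otimes> x"] L_comm[of m n x y] L_monoD L_carrier
  by (simp flip: mult_eq_comm_mult)

text \<open>The correction \<open>comm x (comm x' y)\<close> has weight \<open>2 * i + j\<close>,
  which exceeds \<open>i + j\<close> because \<open>i \<ge> 1\<close>.\<close>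

lemma cl_comm_mult_left:
  assumes "i \<ge> 1" "j \<ge> 1" "x \<in> L i" "x' \<in> L i" "y \<in> L j" "k \<le> Suc (i + j)"
  shows "cl k (comm (x \<otimes> x') y) = cl k (comm x y \<otimes> comm x' y)"
proof -
  note c = assms(3-5)[THEN L_carrier]
  have 1: "comm x y \<in> L (i + j)" "comm x' y \<in> L (i + j)" using assms by (auto intro: L_comm)
  have "comm x (comm x' y) \<in> L (i + (i + j))" using 1 assms by (auto intro: L_comm)
  then have "comm x (comm x' y) \<in> L k" by (rule L_monoD) (use assms in simp)
  then have "cl k (comm (x \<otimes> x') y) = cl k (comm x' y \<otimes> comm x y)"
    using c by (simp add: comm_mult_left cl_absorb)
  also have "\<dots> = cl k (comm x y \<otimes> comm x' y)"
    using 1 assms by (intro cl_comm_swap[of "i + j" "i + j"]) auto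
  finally show ?thesis .
qed

lemma cl_comm_mult_right:
  assumes "i \<ge> 1" "j \<ge> 1" "x \<in> L i" "y \<in> L j" "y' \<in> L j" "k \<le> Suc (i + j)"
  shows "cl k (comm x (y \<otimes> y')) = cl k (comm x y \<otimes> comm x y')"
proof -
  note c = assms(3-5)[THEN L_carrier]
  have 1: "comm x y \<in> L (i + j)" "comm x y' \<in> L (i + j)" using assms by (auto intro: L_comm)
  have "comm y (comm x y') \<in> L (j + (i + j))" using 1 assms by (auto intro: L_comm)
  then have "comm y (comm x y') \<in> L k" by (rule L_monoD) (use assms in simp)
  then show ?thesis
    using c unfolding comm_mult_right[OF c] by (intro cl_mult_cong[OF refl cl_absorb]) auto
qed

text \<open>With its right-hand counterpart this makes the bracket of graded pieces well defined:
  changing \<open>x\<close> within its class changes the commutator by an element of weight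
  \<open>Suc i + j\<close>.\<close>

lemma cl_comm_cong_left:
  assumes "i \<ge> 1" "j \<ge> 1" "x' \<in> L i" "x \<in> carrier G" "y \<in> L j" "cl (Suc i) x = cl (Suc i) x'" "k \<le> Suc (i + j)"
  shows "cl k (comm x y) = cl k (comm x' y)"
proof -
  note c = assms(3,5)[THEN L_carrier]
  obtain z where z: "z \<in> L (Suc i)" "x = z \<otimes> x'" using cl_decomp[OF assms(6)] c assms(4) by blast
  have "comm z y \<in> L (Suc i + j)" using z assms by (intro L_comm) auto
  then have "comm z y \<in> L k" by (rule L_monoD) (use assms in simp)
  moreover have "z \<in> L i" using z L_Suc_subset by blast
  ultimately show ?thesis
    using cl_comm_mult_left[OF assms(1,2) \<open>z \<in> L i\<close> assms(3,5,7)] c by (simp add: cl_absorb z)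
qed

lemma cl_comm_cong_right:
  assumes "i \<ge> 1" "j \<ge> 1" "x \<in> L i" "y \<in> carrier G" "y' \<in> L j" "cl (Suc j) y = cl (Suc j) y'" "k \<le> Suc (i + j)"
  shows "cl k (comm x y) = cl k (comm x y')"
proof -
  have "cl k (comm y x) = cl k (comm y' x)"
    using assms by (intro cl_comm_cong_left[of j i]) auto
  then have "cl k (inv (comm y x)) = cl k (inv (comm y' x))"
    using assms L_carrier by (intro cl_inv_cong) auto
  then show ?thesis using assms L_carrier by (simp add: inv_comm)
qed

lemma cl_comm_inv_left:
  assumes "i \<ge> 1" "j \<ge> 1" "x \<in> L i" "y \<in> L j" "k \<le> Suc (i + j)"
  shows "cl k (comm (inv x) y) = cl k (inv (comm x y))"
proof -
  note c = assms(3,4)[THEN L_carrier]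
  have "cl k (comm (x \<otimes> inv x) y) = cl k (comm x y \<otimes> comm (inv x) y)"
    using assms by (intro cl_comm_mult_left) (auto intro: L_inv)
  then have "cl k (comm x y \<otimes> comm (inv x) y) = cl k \<one>"
    using c by (simp add: comm_def)
  then have "cl k (inv (comm x y) \<otimes> (comm x y \<otimes> comm (inv x) y)) = cl k (inv (comm x y) \<otimes> \<one>)"
    using c by (intro cl_mult_cong) auto
  then show ?thesis using c by simp
qed

lemma cl_comm_inv_right:
  assumes "i \<ge> 1" "j \<ge> 1" "x \<in> L i" "y \<in> L j" "k \<le> Suc (i + j)"
  shows "cl k (comm x (inv y)) = cl k (inv (comm x y))"
proof -
  have "cl k (inv (comm (inv y) x)) = cl k (inv (inv (comm y x)))"
    using assms L_carrier by (intro cl_inv_cong cl_comm_inv_left[of j i]) auto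
  then show ?thesis using assms L_carrier by (simp add: inv_comm)
qed

text \<open>Conjugation by \<open>z\<close> is an automorphism, which yields the Jacobi identity as a derivation rule.\<close>
lemma cl_jacobi:
  assumes "i \<ge> 1" "j \<ge> 1" "l \<ge> 1" "x \<in> L i" "y \<in> L j" "z \<in> L l" "k \<le> Suc (i + j + l)"
  shows "cl k (comm z (comm x y)) = cl k (comm x (comm z y) \<otimes> comm (comm z x) y)"
proof -
  note c = assms(4-6)[THEN L_carrier]
  define a b where "a = comm z x" and "b = comm z y"
  have a: "a \<in> L (l + i)" and b: "b \<in> L (l + j)"
    using assms by (auto simp: a_def b_def intro: L_comm)
  have ab: "a \<in> carrier G" "b \<in> carrier G" using c by (auto simp: a_def b_def)
  have by_L: "b \<otimes> y \<in> L j"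
    using L_monoD[OF b, of j] assms(5) by (intro L_mult) auto
  have xy: "comm x y \<in> L (i + j)" using assms by (auto intro: L_comm)
  have ay: "comm a y \<in> L (l + i + j)" using a assms by (intro L_comm[of "l + i" j]) auto
  \<comment> \<open>Conjugation by \<open>z\<close> turns \<open>x\<close> into
    \<open>a \<otimes> x\<close> and \<open>y\<close> into \<open>b \<otimes> y\<close>. When the
    commutator of these is expanded, only \<open>comm x b\<close>, \<open>comm a y\<close> and
    \<open>comm x y\<close> have weight at most \<open>i + j + l\<close>, and
    \<open>comm x y\<close> cancels.\<close>
  have 1: "cl k (comm x (b \<otimes> y)) = cl k (comm x b \<otimes> comm x y)"
  proof -
    have "comm b (comm x y) \<in> L (l + j + (i + j))" using b xy assms by (intro L_comm[of "l + j" "i + j"]) auto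
    then have "comm b (comm x y) \<in> L k" by (rule L_monoD) (use assms in simp)
    then show ?thesis
      using c ab unfolding comm_mult_right[OF c(1) ab(2) c(2)]
      by (intro cl_mult_cong[OF refl cl_absorb]) auto
  qed
  have 2: "cl k (comm a (b \<otimes> y)) = cl k (comm a y)"
  proof -
    have "comm a b \<in> L (l + i + (l + j))" using a b assms by (intro L_comm[of "l + i" "l + j"]) auto
    then have "comm a b \<in> L k" by (rule L_monoD) (use assms in simp)
    moreover have "comm b (comm a y) \<in> L (l + j + (l + i + j))" using b ay assms by (intro L_comm[of "l + j" "l + i + j"]) auto
    then have "comm b (comm a y) \<in> L k" by (rule L_monoD) (use assms in simp)
    ultimately show ?thesis using c ab by (simp add: comm_mult_right cl_absorb)
  qed
  have 3: "cl k (comm (a \<otimes> x) (b \<otimes> y)) = cl k (comm x (b \<otimes> y) \<otimes> comm a (b \<otimes> y))"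
  proof -
    have "comm x (b \<otimes> y) \<in> L (i + j)" using by_L assms by (intro L_comm) auto
    then have "comm a (comm x (b \<otimes> y)) \<in> L (l + i + (i + j))" using a assms by (intro L_comm[of "l + i" "i + j"]) auto
    then have "comm a (comm x (b \<otimes> y)) \<in> L k" by (rule L_monoD) (use assms in simp)
    then show ?thesis using c ab by (simp add: comm_mult_left cl_absorb)
  qed
  have "cl k (comm z (comm x y)) = cl k (comm (a \<otimes> x) (b \<otimes> y) \<otimes> inv (comm x y))"
    using c by (simp add: comm_conj[of x y z] a_def b_def)
  also have "\<dots> = cl k (comm x b \<otimes> (comm x y \<otimes> comm a y \<otimes> inv (comm x y)))"
    using 1 2 3 c ab by (simp add: cl_mult m_assoc[symmetric])
  also have "\<dots> = cl k (comm x b \<otimes> (comm a y \<otimes> comm x y \<otimes> inv (comm x y)))"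
  proof -
    have "cl k (comm x y \<otimes> comm a y) = cl k (comm a y \<otimes> comm x y)"
      using xy ay assms by (intro cl_comm_swap[of "i + j" "l + i + j"]) auto
    then show ?thesis using c ab by (simp add: cl_mult)
  qed
  also have "\<dots> = cl k (comm x b \<otimes> comm a y)" using c ab by (simp add: m_assoc)
  finally show ?thesis by (simp add: a_def b_def)
qed

end

subsection \<open>Independence modulo p\<close>

definition p_multiples :: "nat \<Rightarrow> 'x ncps set" where
  "p_multiples p = {f. \<forall>u. int p dvd wcoeff f u}"

lemma p_multiples_iff: "f \<in> p_multiples p \<longleftrightarrow> (\<exists>g. f = of_nat p * g)"
proof
  assume "f \<in> p_multiples p"
  then have "f = of_nat p * ncps (\<lambda>u. wcoeff f u div int p)"
    by (intro ncps_eqI) (simp add: p_multiples_def ncps_inverse)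
  then show "\<exists>g. f = of_nat p * g" ..
qed (auto simp: p_multiples_def)

lemma p_multiples_0 [simp]: "0 \<in> p_multiples p"
  by (simp add: p_multiples_def)

lemma p_multiples_add: "f \<in> p_multiples p \<Longrightarrow> g \<in> p_multiples p \<Longrightarrow> f + g \<in> p_multiples p"
  by (simp add: p_multiples_def)

lemma p_multiples_diff: "f \<in> p_multiples p \<Longrightarrow> g \<in> p_multiples p \<Longrightarrow> f - g \<in> p_multiples p"
  by (simp add: p_multiples_def)

lemma p_multiples_sum: "(\<And>a. a \<in> A \<Longrightarrow> f a \<in> p_multiples p) \<Longrightarrow> sum f A \<in> p_multiples p"
  by (induction A rule: infinite_finite_induct) (auto intro: p_multiples_add)

lemma p_multiples_mult_left: "f \<in> p_multiples p \<Longrightarrow> g * f \<in> p_multiples p"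
  by (auto simp: p_multiples_iff) (metis mult.assoc mult_of_nat_commute)

lemma p_multiples_of_int: "(of_int j :: 'x ncps) \<in> p_multiples p \<longleftrightarrow> int p dvd j"
proof -
  have "wcoeff (of_int j * 1 :: 'x ncps) u = j * wcoeff 1 u" for u
    by (rule wcoeff_of_int_mult)
  then show ?thesis by (auto simp: p_multiples_def wcoeff_1)
qed

text \<open>Independence modulo \<open>p\<close> in a right module: the coefficients are arbitrary
  series, not just integers. This stronger notion is the one that elimination preserves.\<close>

definition right_indep :: "nat \<Rightarrow> 'i set \<Rightarrow> ('i \<Rightarrow> 'x ncps) \<Rightarrow> bool" where
  "right_indep p Y \<epsilon> \<longleftrightarrow> (\<forall>Z f. finite Z \<longrightarrow> Z \<subseteq> Y \<longrightarrow>
     (\<Sum>y\<in>Z. \<epsilon> y * f y) \<in> p_multiples p \<longrightarrow> (\<forall>y\<in>Z. f y \<in> p_multiples p))"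

lemma right_indepD:
  "right_indep p Y \<epsilon> \<Longrightarrow> finite Z \<Longrightarrow> Z \<subseteq> Y \<Longrightarrow> (\<Sum>y\<in>Z. \<epsilon> y * f y) \<in> p_multiples p \<Longrightarrow>
    y \<in> Z \<Longrightarrow> f y \<in> p_multiples p"
  unfolding right_indep_def by blast

definition ad :: "'r :: ring \<Rightarrow> 'r \<Rightarrow> 'r" where
  "ad x e = x * e - e * x"

lemma ad_add_left: "ad (e + e') f = ad e f + ad e' f"
  by (simp add: ad_def algebra_simps)

lemma ad_add_right: "ad e (f + f') = ad e f + ad e f'"
  by (simp add: ad_def algebra_simps)

lemma ad_self: "ad e e = 0"
  by (simp add: ad_def)

lemma ad_swap: "ad e f = - ad f e"
  by (simp add: ad_def)

lemma ad_of_int_left: "ad (of_int j * e) f = of_int j * ad e (f :: 'r :: ring_1)"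
proof -
  have "f * (of_int j * e) = of_int j * (f * e)" by (metis mult.assoc mult_of_int_commute)
  then show ?thesis by (simp add: ad_def right_diff_distrib mult.assoc)
qed

lemma ad_of_int_right: "ad e (of_int j * f) = of_int j * ad e (f :: 'r :: ring_1)"
  by (metis ad_of_int_left ad_swap mult_minus_right)

text \<open>For \<open>j \<le> k\<close> this is \<open>(k choose j) * (- x) ^ (k - j)\<close>,
  given by Pascal's rule: the right-hand factor of \<open>x ^ j * e\<close> in the
  \<open>k\<close>-fold bracket. Later only unitriangularity is used.\<close>

fun ad_coeff :: "'r :: ring_1 \<Rightarrow> nat \<Rightarrow> nat \<Rightarrow> 'r" where
  "ad_coeff x 0 0 = 1"
| "ad_coeff x 0 (Suc j) = 0"
| "ad_coeff x (Suc k) 0 = - ad_coeff x k 0 * x"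
| "ad_coeff x (Suc k) (Suc j) = ad_coeff x k j - ad_coeff x k (Suc j) * x"

lemma ad_coeff_diag: "ad_coeff x k k = 1" and ad_coeff_gt: "k < j \<Longrightarrow> ad_coeff x k j = 0"
proof -
  show gt: "k < j \<Longrightarrow> ad_coeff x k j = 0" for k j
    by (induction x k j rule: ad_coeff.induct) auto
  show "ad_coeff x k k = 1"
    by (induction k) (auto simp: gt)
qed

lemma ad_power_expand: "k \<le> K \<Longrightarrow> (ad x ^^ k) e = (\<Sum>j\<le>K. x ^ j * (e * ad_coeff x k j))"
proof (induction k)
  case 0
  have "(\<Sum>j\<le>K. x ^ j * (e * ad_coeff x 0 j)) = (\<Sum>j\<le>K. if j = 0 then e else 0)"
    by (intro sum.cong refl) (auto simp: gr0_conv_Suc)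
  then show ?case by simp
next
  case (Suc k)
  then obtain K' where K: "K = Suc K'" by (cases K) auto
  have top: "ad_coeff x k (Suc K') = 0" using Suc.prems by (intro ad_coeff_gt) (simp add: K)
  have "(ad x ^^ Suc k) e = x * (\<Sum>j\<le>K. x ^ j * (e * ad_coeff x k j))
      - (\<Sum>j\<le>K. x ^ j * (e * ad_coeff x k j)) * x"
    using Suc.IH[OF Suc_leD[OF Suc.prems]] by (simp, simp add: ad_def)
  also have "x * (\<Sum>j\<le>K. x ^ j * (e * ad_coeff x k j)) = (\<Sum>j\<le>K'. x ^ Suc j * (e * ad_coeff x k j))"
    by (simp add: K top sum_distrib_left mult.assoc)
  also have "(\<Sum>j\<le>K. x ^ j * (e * ad_coeff x k j)) * x
      = e * ad_coeff x k 0 * x + (\<Sum>j\<le>K'. x ^ Suc j * (e * ad_coeff x k (Suc j))) * x"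
    unfolding K sum.atMost_Suc_shift by (simp add: distrib_right)
  also have "(\<Sum>j\<le>K'. x ^ Suc j * (e * ad_coeff x k j)) -
      (e * ad_coeff x k 0 * x + (\<Sum>j\<le>K'. x ^ Suc j * (e * ad_coeff x k (Suc j))) * x)
      = (\<Sum>j\<le>K. x ^ j * (e * ad_coeff x (Suc k) j))"
    unfolding K sum.atMost_Suc_shift
    by (simp add: sum_distrib_right right_diff_distrib sum_subtractf mult.assoc)
  finally show ?case .
qed

text \<open>All terms with \<open>j > 0\<close> share a left factor \<open>\<epsilon> x\<close>.
  Pulling it out leaves a combination of the independent family with some series \<open>r\<close> as
  the coefficient of \<open>\<epsilon> x\<close>; so \<open>r\<close> vanishes modulo
  \<open>p\<close> as well, and it is a sum of the same shape with smaller \<open>K\<close>.\<close>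

lemma right_indep_horner:
  assumes "right_indep p Y \<epsilon>" "x \<in> Y" "finite Z" "Z \<subseteq> Y - {x}"
    and "(\<Sum>j\<le>K. \<epsilon> x ^ j * (\<Sum>y\<in>Z. \<epsilon> y * g y j)) \<in> p_multiples p" "j \<le> K" "y \<in> Z"
  shows "g y j \<in> p_multiples p"
  using assms(5-)
proof (induction K arbitrary: g j)
  case 0
  then show ?case
    using right_indepD[OF assms(1,3), of "\<lambda>y. g y 0" y] assms(4) by auto
next
  case (Suc K)
  define r where "r = (\<Sum>j\<le>K. \<epsilon> x ^ j * (\<Sum>y\<in>Z. \<epsilon> y * g y (Suc j)))"
  define f where "f = (\<lambda>y. if y = x then r else g y 0)"
  have "(\<Sum>j\<le>Suc K. \<epsilon> x ^ j * (\<Sum>y\<in>Z. \<epsilon> y * g y j)) = (\<Sum>y\<in>Z. \<epsilon> y * g y 0) + \<epsilon> x * r"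
    unfolding sum.atMost_Suc_shift r_def by (simp add: sum_distrib_left mult.assoc)
  also have "(\<Sum>y\<in>Z. \<epsilon> y * g y 0) = (\<Sum>y\<in>Z. \<epsilon> y * f y)"
    using assms(4) by (intro sum.cong) (auto simp: f_def)
  also have "\<dots> + \<epsilon> x * r = (\<Sum>y\<in>insert x Z. \<epsilon> y * f y)"
    using assms(3,4) by (subst sum.insert) (auto simp: f_def)
  finally have sum: "(\<Sum>y\<in>insert x Z. \<epsilon> y * f y) \<in> p_multiples p" using Suc.prems(1) by simp
  have f: "f z \<in> p_multiples p" if "z \<in> insert x Z" for z
    by (rule right_indepD[OF assms(1) _ _ sum that]) (use assms in auto)
  show ?case
  proof (cases j)
    case 0
    have "y \<noteq> x" using Suc.prems(3) assms(4) by auto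
    then show ?thesis using f[of y] Suc.prems(3) by (simp add: f_def 0)
  next
    case (Suc i)
    have "r \<in> p_multiples p" using f[of x] by (simp add: f_def)
    then show ?thesis using Suc.IH[of "\<lambda>y j. g y (Suc j)" i] Suc.prems Suc by (simp add: r_def)
  qed
qed

text \<open>By \<open>ad_power_expand\<close> the brackets arise from the products
  \<open>\<epsilon> x ^ j * \<epsilon> y\<close> through the unitriangular coefficients
  \<open>ad_coeff\<close>. The products are independent by \<open>right_indep_horner\<close>, and
  the \<open>f y k\<close> are recovered downwards from \<open>k = K\<close>.\<close>

lemma right_indep_ad:
  assumes "right_indep p Y \<epsilon>" "x \<in> Y" "finite Z" "Z \<subseteq> Y - {x}"
    and "(\<Sum>y\<in>Z. \<Sum>k\<le>K. (ad (\<epsilon> x) ^^ k) (\<epsilon> y) * f y k) \<in> p_multiples p" and y: "y \<in> Z"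
  shows "k \<le> K \<Longrightarrow> f y k \<in> p_multiples p"
proof -
  define g where "g = (\<lambda>y j. \<Sum>k\<le>K. ad_coeff (\<epsilon> x) k j * f y k)"
  have "(\<Sum>y\<in>Z. \<Sum>k\<le>K. (ad (\<epsilon> x) ^^ k) (\<epsilon> y) * f y k)
      = (\<Sum>y\<in>Z. \<Sum>k\<le>K. \<Sum>j\<le>K. \<epsilon> x ^ j * (\<epsilon> y * (ad_coeff (\<epsilon> x) k j * f y k)))"
    by (intro sum.cong refl) (simp add: ad_power_expand[of _ K] sum_distrib_right mult.assoc)
  also have "\<dots> = (\<Sum>y\<in>Z. \<Sum>j\<le>K. \<epsilon> x ^ j * (\<epsilon> y * g y j))"
  proof (rule sum.cong[OF refl])
    fix y
    show "(\<Sum>k\<le>K. \<Sum>j\<le>K. \<epsilon> x ^ j * (\<epsilon> y * (ad_coeff (\<epsilon> x) k j * f y k)))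
        = (\<Sum>j\<le>K. \<epsilon> x ^ j * (\<epsilon> y * g y j))"
      by (subst sum.swap) (simp add: g_def sum_distrib_left)
  qed
  also have "\<dots> = (\<Sum>j\<le>K. \<epsilon> x ^ j * (\<Sum>y\<in>Z. \<epsilon> y * g y j))"
    by (subst sum.swap) (simp add: sum_distrib_left)
  finally have g: "g y j \<in> p_multiples p" if "j \<le> K" for j
    using right_indep_horner[OF assms(1-4), where K = K and g = g] assms(5) that y by simp
  show "k \<le> K \<Longrightarrow> f y k \<in> p_multiples p"
  proof (induction "K - k" arbitrary: k rule: less_induct)
    case less
    have "g y k = (\<Sum>i\<in>{..K} - {k}. ad_coeff (\<epsilon> x) i k * f y i) + f y k"
      unfolding g_def using less.prems by (subst sum.remove[of _ k]) (auto simp: ad_coeff_diag)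
    moreover have "(\<Sum>i\<in>{..K} - {k}. ad_coeff (\<epsilon> x) i k * f y i) \<in> p_multiples p"
    proof (rule p_multiples_sum)
      fix i assume i: "i \<in> {..K} - {k}"
      show "ad_coeff (\<epsilon> x) i k * f y i \<in> p_multiples p"
      proof (cases "i < k")
        case False
        then show ?thesis using i less.prems by (intro p_multiples_mult_left less.hyps) auto
      qed (simp add: ad_coeff_gt)
    qed
    ultimately show ?case using p_multiples_diff[OF g[OF less.prems]] by fastforce
  qed
qed

text \<open>Lazard elimination of \<open>x\<close>: every other index \<open>y = (b, ks)\<close> gives rise to the indices
  \<open>(b, k # ks)\<close>, which stand for the \<open>k\<close>-fold bracket of \<open>y\<close> with \<open>x\<close>.\<close>
definition elim_index :: "('b \<times> nat list) set \<Rightarrow> 'b \<times> nat list \<Rightarrow> ('b \<times> nat list) set" where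
  "elim_index Y x = (\<lambda>(y, k). (fst y, k # snd y)) ` ((Y - {x}) \<times> UNIV)"

text \<open>The operation \<open>a\<close> is a parameter because weights, group elements and series
  are eliminated by the same formula, with \<open>\<lambda>n. v + n\<close>, \<open>comm\<close> and
  \<open>ad\<close>.\<close>

definition elim_fam :: "('c \<Rightarrow> 'c) \<Rightarrow> ('b \<times> nat list \<Rightarrow> 'c) \<Rightarrow> 'b \<times> nat list \<Rightarrow> 'c" where
  "elim_fam a \<epsilon> z = (a ^^ hd (snd z)) (\<epsilon> (fst z, tl (snd z)))"

lemma elim_fam_Cons [simp]: "elim_fam a \<epsilon> (b, k # ks) = (a ^^ k) (\<epsilon> (b, ks))"
  by (simp add: elim_fam_def)

lemma elim_indexE:
  assumes "z \<in> elim_index Y x"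
  obtains b k ks where "z = (b, k # ks)" "(b, ks) \<in> Y" "(b, ks) \<noteq> x"
proof -
  from assms obtain y k where "y \<in> Y" "y \<noteq> x" "z = (fst y, k # snd y)"
    unfolding elim_index_def by auto
  then show thesis using that[of "fst y" k "snd y"] by simp
qed

lemma elim_indexI: "(b, ks) \<in> Y \<Longrightarrow> (b, ks) \<noteq> x \<Longrightarrow> (b, k # ks) \<in> elim_index Y x"
  unfolding elim_index_def by (intro image_eqI[of _ _ "((b, ks), k)"]) auto

lemma right_indep_elim:
  assumes "right_indep p Y \<epsilon>" "x \<in> Y"
  shows "right_indep p (elim_index Y x) (elim_fam (ad (\<epsilon> x)) \<epsilon>)"
  unfolding right_indep_def
proof (intro allI impI ballI)
  fix Z :: "('a \<times> nat list) set" and f and z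
  assume Z: "finite Z" "Z \<subseteq> elim_index Y x"
    and sum: "(\<Sum>y\<in>Z. elim_fam (ad (\<epsilon> x)) \<epsilon> y * f y) \<in> p_multiples p" and z: "z \<in> Z"
  define i where "i = (\<lambda>(y, k). (fst y, k # snd y) :: 'a \<times> nat list)"
  have inj: "inj i" by (auto simp: inj_def i_def)
  define Z0 where "Z0 = (\<lambda>z. (fst z, tl (snd z))) ` Z"
  define K where "K = Max ((\<lambda>z. hd (snd z)) ` Z)"
  \<comment> \<open>Padding with 0 turns the finite index set into a full rectangle
    \<open>Z0 \<times> {..K}\<close>, as \<open>right_indep_ad\<close> expects.\<close>
  define F where "F = (\<lambda>y k. if i (y, k) \<in> Z then f (i (y, k)) else 0)"
  have Z0: "finite Z0" "Z0 \<subseteq> Y - {x}"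
    using Z by (auto simp: Z0_def elim!: elim_indexE dest!: subsetD)
  have hd_le: "hd (snd z) \<le> K" if "z \<in> Z" for z
    unfolding K_def using Z(1) that by (intro Max_ge) auto
  have sub: "Z \<subseteq> i ` (Z0 \<times> {..K})"
  proof
    fix z assume z: "z \<in> Z"
    then obtain b k ks where "z = (b, k # ks)" using Z(2) by (blast elim: elim_indexE)
    then show "z \<in> i ` (Z0 \<times> {..K})"
      using z hd_le[OF z] by (intro image_eqI[of _ _ "((b, ks), k)"]) (force simp: i_def Z0_def)+
  qed
  have "(\<Sum>y\<in>Z0. \<Sum>k\<le>K. (ad (\<epsilon> x) ^^ k) (\<epsilon> y) * F y k)
      = (\<Sum>(y, k)\<in>Z0 \<times> {..K}. (ad (\<epsilon> x) ^^ k) (\<epsilon> y) * F y k)"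
    by (rule sum.cartesian_product)
  also have "\<dots> = (\<Sum>z\<in>i ` (Z0 \<times> {..K}). elim_fam (ad (\<epsilon> x)) \<epsilon> z * (if z \<in> Z then f z else 0))"
    by (subst sum.reindex[OF inj_on_subset[OF inj subset_UNIV]])
      (auto intro!: sum.cong simp: F_def i_def)
  also have "\<dots> = (\<Sum>y\<in>Z. elim_fam (ad (\<epsilon> x)) \<epsilon> y * f y)"
    using Z0(1) sub by (intro sum.mono_neutral_cong_right) auto
  finally have *: "(\<Sum>y\<in>Z0. \<Sum>k\<le>K. (ad (\<epsilon> x) ^^ k) (\<epsilon> y) * F y k) \<in> p_multiples p"
    using sum by simp
  obtain y k where yk: "y \<in> Z0" "k \<le> K" "z = i (y, k)" using sub z by auto
  have "F y k \<in> p_multiples p"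
    by (rule right_indep_ad[OF assms Z0 * yk(1,2)])
  then show "f z \<in> p_multiples p" using z by (simp add: F_def yk(3))
qed

definition right_span :: "'i set \<Rightarrow> ('i \<Rightarrow> 'x ncps) \<Rightarrow> 'x ncps set" where
  "right_span Y \<epsilon> = {\<Sum>y\<in>Z. \<epsilon> y * f y | Z f. finite Z \<and> Z \<subseteq> Y}"

lemma right_span_0: "0 \<in> right_span Y \<epsilon>"
  unfolding right_span_def by (rule CollectI, rule exI[of _ "{}"]) auto

lemma right_span_gen: "y \<in> Y \<Longrightarrow> \<epsilon> y \<in> right_span Y \<epsilon>"
  unfolding right_span_def by (rule CollectI, rule exI[of _ "{y}"], rule exI[of _ "\<lambda>_. 1"]) auto

lemma right_span_mono: "e \<in> right_span Y \<epsilon> \<Longrightarrow> Y \<subseteq> Y' \<Longrightarrow> e \<in> right_span Y' \<epsilon>"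
  unfolding right_span_def by blast

lemma right_span_mult: "e \<in> right_span Y \<epsilon> \<Longrightarrow> e * f \<in> right_span Y \<epsilon>"
  unfolding right_span_def
proof clarify
  fix Z g assume "finite Z" "Z \<subseteq> Y"
  then show "\<exists>Z' g'. (\<Sum>y\<in>Z. \<epsilon> y * g y) * f = (\<Sum>y\<in>Z'. \<epsilon> y * g' y) \<and> finite Z' \<and> Z' \<subseteq> Y"
    by (intro exI[of _ Z] exI[of _ "\<lambda>y. g y * f"]) (simp add: sum_distrib_right mult.assoc)
qed

lemma right_span_add:
  assumes "e \<in> right_span Y \<epsilon>" "e' \<in> right_span Y \<epsilon>"
  shows "e + e' \<in> right_span Y \<epsilon>"
proof -
  obtain Z f Z' f' where Z: "finite Z" "Z \<subseteq> Y" "e = (\<Sum>y\<in>Z. \<epsilon> y * f y)"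
    "finite Z'" "Z' \<subseteq> Y" "e' = (\<Sum>y\<in>Z'. \<epsilon> y * f' y)"
    using assms unfolding right_span_def by blast
  define F F' where "F = (\<lambda>y. if y \<in> Z then f y else 0)" and "F' = (\<lambda>y. if y \<in> Z' then f' y else 0)"
  have "e = (\<Sum>y\<in>Z \<union> Z'. \<epsilon> y * F y)" "e' = (\<Sum>y\<in>Z \<union> Z'. \<epsilon> y * F' y)"
    using Z by (auto intro!: sum.mono_neutral_cong_left simp: F_def F'_def)
  then have "e + e' = (\<Sum>y\<in>Z \<union> Z'. \<epsilon> y * (F y + F' y))"
    by (simp add: distrib_left sum.distrib)
  then show ?thesis
    unfolding right_span_def using Z(1,2,4,5)
    by (intro CollectI exI[of _ "Z \<union> Z'"] exI[of _ "\<lambda>y. F y + F' y"]) auto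
qed

lemma right_span_uminus: "e \<in> right_span Y \<epsilon> \<Longrightarrow> - e \<in> right_span Y \<epsilon>"
  using right_span_mult[of e Y \<epsilon> "- 1"] by simp


section \<open>Lazard elimination in the associated graded Lie ring\<close>

context p_filtration
begin

text \<open>The graph of the correspondence between Lie polynomials in the associated graded Lie ring of
  \<open>L\<close> and Lie polynomials in the free associative ring. That it is single-valued modulo \<open>p\<close>
  (\<open>lie_rel_injective\<close>) replaces the embedding of the free Lie algebra into its enveloping algebra.\<close>
inductive lie_rel :: "'i set \<Rightarrow> ('i \<Rightarrow> nat) \<Rightarrow> ('i \<Rightarrow> 'a) \<Rightarrow> ('i \<Rightarrow> 'x ncps) \<Rightarrow>
    nat \<Rightarrow> 'a \<Rightarrow> 'x ncps \<Rightarrow> bool"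
  for Y w \<theta> \<epsilon> where
  gen: "y \<in> Y \<Longrightarrow> lie_rel Y w \<theta> \<epsilon> (w y) (\<theta> y) (\<epsilon> y)"
| zero: "m \<ge> 1 \<Longrightarrow> g \<in> L (Suc m) \<Longrightarrow> lie_rel Y w \<theta> \<epsilon> m g 0"
| mult: "lie_rel Y w \<theta> \<epsilon> m g e \<Longrightarrow> lie_rel Y w \<theta> \<epsilon> m h f \<Longrightarrow> lie_rel Y w \<theta> \<epsilon> m (g \<otimes> h) (e + f)"
| inv: "lie_rel Y w \<theta> \<epsilon> m g e \<Longrightarrow> lie_rel Y w \<theta> \<epsilon> m (inv g) (- e)"
| bracket: "lie_rel Y w \<theta> \<epsilon> m g e \<Longrightarrow> lie_rel Y w \<theta> \<epsilon> n h f \<Longrightarrow>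
    lie_rel Y w \<theta> \<epsilon> (m + n) (comm g h) (ad e f)"

definition lie_gens :: "nat \<Rightarrow> 'i set \<Rightarrow> ('i \<Rightarrow> nat) \<Rightarrow> ('i \<Rightarrow> 'a) \<Rightarrow> bool" where
  "lie_gens v Y w \<theta> \<longleftrightarrow> v \<ge> 1 \<and> (\<forall>y\<in>Y. v \<le> w y \<and> \<theta> y \<in> L (w y))"

lemma lie_rel_mem:
  assumes "lie_gens v Y w \<theta>" "lie_rel Y w \<theta> \<epsilon> m g e"
  shows "m \<ge> 1 \<and> g \<in> L m"
  using assms(2)
proof (induction rule: lie_rel.induct)
  case (gen y)
  then show ?case using assms(1) unfolding lie_gens_def by (auto intro: order_trans)
next
  case (zero m g)
  then show ?case using L_Suc_subset by blast
next
  case (bracket m g e n h f)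
  then show ?case using L_comm[of m n g h] by auto
qed (auto intro: L_mult L_inv)

text \<open>Rule \<open>zero\<close> relates everything of weight \<open>Suc m\<close> to 0, so a
  relation in weight \<open>m\<close> sees only the class of the group element.\<close>

lemma lie_rel_cl:
  assumes "lie_gens v Y w \<theta>" "lie_rel Y w \<theta> \<epsilon> m g e" "cl (Suc m) g' = cl (Suc m) g" "g' \<in> carrier G"
  shows "lie_rel Y w \<theta> \<epsilon> m g' e"
proof -
  have g: "m \<ge> 1" "g \<in> L m" using lie_rel_mem[OF assms(1,2)] by auto
  obtain z where "z \<in> L (Suc m)" "g' = z \<otimes> g"
    using cl_decomp[OF assms(3,4) L_carrier[OF g(2)]] .
  then show ?thesis
    using lie_rel.mult[OF lie_rel.zero[OF g(1)] assms(2)] by simp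
qed

lemma lie_rel_int_pow:
  assumes "lie_gens v Y w \<theta>" "lie_rel Y w \<theta> \<epsilon> m g e"
  shows "lie_rel Y w \<theta> \<epsilon> m (g [^] (k::int)) (of_int k * e)"
proof -
  have g: "m \<ge> 1" "g \<in> L m" using lie_rel_mem[OF assms] by auto
  have nat: "lie_rel Y w \<theta> \<epsilon> m (g [^] (n::nat)) (of_nat n * e)" for n
  proof (induction n)
    case (Suc n)
    then show ?case using lie_rel.mult[OF Suc assms(2)] by (simp add: algebra_simps)
  qed (use g L_one in \<open>auto intro: lie_rel.zero\<close>)
  show ?thesis
  proof (cases k rule: int_cases2)
    case (nonneg n)
    then show ?thesis using nat[of n] by (simp add: int_pow_int)
  next
    case (nonpos n)
    then show ?thesis
      using lie_rel.inv[OF nat[of n]] L_carrier[OF g(2)] by (simp add: int_pow_neg int_pow_int)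
  qed
qed

lemma cl_comm_int_pow_left:
  assumes "i \<ge> 1" "j \<ge> 1" "x \<in> L i" "y \<in> L j" "k \<le> Suc (i + j)"
  shows "cl k (comm (x [^] (n::int)) y) = cl k (comm x y [^] n)"
proof -
  note c = assms(3,4)[THEN L_carrier]
  have pow: "x [^] (m::nat) \<in> L i" for m
    by (induction m) (auto intro: L_one L_mult assms)
  have nat: "cl k (comm (x [^] (m::nat)) y) = cl k (comm x y [^] m)" for m
  proof (induction m)
    case 0
    then show ?case using c by (simp add: comm_def)
  next
    case (Suc m)
    have "cl k (comm (x [^] Suc m) y) = cl k (comm (x [^] m) y \<otimes> comm x y)"
      using assms pow by (simp add: cl_comm_mult_left)
    also have "\<dots> = cl k (comm x y [^] m \<otimes> comm x y)"
      using c Suc by (intro cl_mult_cong) auto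
    finally show ?case by simp
  qed
  show ?thesis
  proof (cases n rule: int_cases2)
    case (nonneg m)
    then show ?thesis using nat[of m] by (simp add: int_pow_int)
  next
    case (nonpos m)
    have "cl k (comm (inv (x [^] m)) y) = cl k (inv (comm (x [^] m) y))"
      using assms pow by (intro cl_comm_inv_left) auto
    also have "\<dots> = cl k (inv (comm x y [^] m))"
      using nat[of m] c by (intro cl_inv_cong) auto
    finally show ?thesis using c nonpos by (simp add: int_pow_neg int_pow_int)
  qed
qed

lemma lie_gens_elim:
  assumes "lie_gens v Y w \<theta>" "x \<in> Y" "w x = v"
  shows "lie_gens v (elim_index Y x) (elim_fam (\<lambda>n. v + n) w) (elim_fam (comm (\<theta> x)) \<theta>)"
proof -
  have x: "\<theta> x \<in> L v" "v \<ge> 1" using assms by (auto simp: lie_gens_def)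
  have weight: "((\<lambda>n. v + n) ^^ k) n = k * v + n" for k n
    by (induction k) auto
  have mem: "(comm (\<theta> x) ^^ k) g \<in> L (k * v + n)" if "g \<in> L n" "n \<ge> 1" for k n g
  proof (induction k)
    case (Suc k)
    have "comm (\<theta> x) ((comm (\<theta> x) ^^ k) g) \<in> L (v + (k * v + n))"
      using that x by (intro L_comm Suc) auto
    then show ?case by (simp add: add.assoc)
  qed (use that in simp)
  have "v \<le> w (b, ks) \<and> \<theta> (b, ks) \<in> L (w (b, ks))" if "(b, ks) \<in> Y" for b ks
    using assms(1) that unfolding lie_gens_def by blast
  then show ?thesis
    using x(2) mem unfolding lie_gens_def
    by (fastforce elim!: elim_indexE simp: weight intro: trans_le_add2 order_trans)
qed

text \<open>The eliminated family generates an ideal: bracketing with \<open>x\<close> raises the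
  exponent \<open>k\<close> of a generator by one, and the Jacobi identity carries this over to
  brackets.\<close>

lemma lie_rel_ad:
  assumes "lie_gens v Y w \<theta>" "x \<in> Y" "w x = v"
    and "lie_rel (elim_index Y x) (elim_fam (\<lambda>n. v + n) w) (elim_fam (comm (\<theta> x)) \<theta>)
      (elim_fam (ad (\<epsilon> x)) \<epsilon>) m g e" (is "?R m g e")
  shows "lie_rel (elim_index Y x) (elim_fam (\<lambda>n. v + n) w) (elim_fam (comm (\<theta> x)) \<theta>)
      (elim_fam (ad (\<epsilon> x)) \<epsilon>) (v + m) (comm (\<theta> x) g) (ad (\<epsilon> x) e)"
  using assms(4)
proof (induction rule: lie_rel.induct)
  case (gen y)
  obtain b k ks where y: "y = (b, k # ks)" "(b, ks) \<in> Y" "(b, ks) \<noteq> x" using elim_indexE[OF gen] .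
  from lie_rel.gen[OF elim_indexI[OF y(2,3), of "Suc k"], of "elim_fam (\<lambda>n. v + n) w"
      "elim_fam (comm (\<theta> x)) \<theta>" "elim_fam (ad (\<epsilon> x)) \<epsilon>"]
  show ?case by (simp add: y(1))
next
  case (zero m g)
  have x: "\<theta> x \<in> L v" "v \<ge> 1" using assms by (auto simp: lie_gens_def)
  have "comm (\<theta> x) g \<in> L (v + Suc m)" using x zero by (intro L_comm) auto
  then show ?case using zero x by (auto simp: ad_def intro!: lie_rel.zero)
next
  case (mult m g e h f)
  have x: "\<theta> x \<in> L v" "v \<ge> 1" using assms by (auto simp: lie_gens_def)
  note gens = lie_gens_elim[OF assms(1-3)]
  note mem = lie_rel_mem[OF gens mult.hyps(1)] lie_rel_mem[OF gens mult.hyps(2)]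
  have "cl (Suc (v + m)) (comm (\<theta> x) (g \<otimes> h)) = cl (Suc (v + m)) (comm (\<theta> x) g \<otimes> comm (\<theta> x) h)"
    using x mem by (intro cl_comm_mult_right) auto
  from lie_rel_cl[OF gens lie_rel.mult[OF mult.IH] this] show ?case
    using x(1) mem by (simp add: L_carrier[of _ m] L_carrier[of _ v] ad_def algebra_simps)
next
  case (inv m g e)
  have x: "\<theta> x \<in> L v" "v \<ge> 1" using assms by (auto simp: lie_gens_def)
  note gens = lie_gens_elim[OF assms(1-3)]
  note mem = lie_rel_mem[OF gens inv.hyps]
  have "cl (Suc (v + m)) (comm (\<theta> x) (inv g)) = cl (Suc (v + m)) (inv (comm (\<theta> x) g))"
    using x mem by (intro cl_comm_inv_right[of v m]) auto
  from lie_rel_cl[OF gens lie_rel.inv[OF inv.IH] this] show ?case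
    using x(1) mem by (simp add: L_carrier[of _ m] L_carrier[of _ v] ad_def algebra_simps)
next
  case (bracket m g e n h f)
  have x: "\<theta> x \<in> L v" "v \<ge> 1" using assms by (auto simp: lie_gens_def)
  note gens = lie_gens_elim[OF assms(1-3)]
  note mem = lie_rel_mem[OF gens bracket.hyps(1)] lie_rel_mem[OF gens bracket.hyps(2)]
  have "?R (m + (v + n)) (comm g (comm (\<theta> x) h)) (ad e (ad (\<epsilon> x) f))"
    "?R (v + m + n) (comm (comm (\<theta> x) g) h) (ad (ad (\<epsilon> x) e) f)"
    by (intro lie_rel.bracket bracket.hyps bracket.IH)+
  then have "?R (v + (m + n)) (comm g (comm (\<theta> x) h) \<otimes> comm (comm (\<theta> x) g) h)
      (ad e (ad (\<epsilon> x) f) + ad (ad (\<epsilon> x) e) f)"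
    by (intro lie_rel.mult) (simp_all add: ac_simps)
  from lie_rel_cl[OF gens this cl_jacobi[of m n v g h "\<theta> x"]]
  have "?R (v + (m + n)) (comm (\<theta> x) (comm g h)) (ad e (ad (\<epsilon> x) f) + ad (ad (\<epsilon> x) e) f)"
    using x mem by (simp add: L_carrier[of _ m] L_carrier[of _ n] L_carrier[of _ v])
  then show ?case by (simp add: ad_def algebra_simps)
qed

text \<open>A bracket is \<open>e * f - f * e\<close>, so it stays in the right ideal of the
  generators occurring in \<open>e\<close> and \<open>f\<close>. In the least weight this confines a
  Lie element to the generators of that weight, where independence can be applied.\<close>

lemma right_span_lie_rel:
  assumes "lie_rel Y w \<theta> \<epsilon> m g e"
  shows "e \<in> right_span {y \<in> Y. w y \<le> m} \<epsilon>"
  using assms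
proof (induction rule: lie_rel.induct)
  case (bracket m g e n h f)
  have "e \<in> right_span {y \<in> Y. w y \<le> m + n} \<epsilon>" "f \<in> right_span {y \<in> Y. w y \<le> m + n} \<epsilon>"
    by (rule right_span_mono[OF bracket.IH(1)], force, rule right_span_mono[OF bracket.IH(2)], force)
  then have "e * f + - (f * e) \<in> right_span {y \<in> Y. w y \<le> m + n} \<epsilon>"
    by (intro right_span_add right_span_uminus right_span_mult)
  then show ?case by (simp add: ad_def)
qed (auto intro: right_span_gen right_span_0 right_span_add right_span_uminus)


text \<open>Lazard's decomposition: a Lie element is an integer multiple of \<open>x\<close> plus an
  element of the ideal from \<open>lie_rel_ad\<close>. As \<open>x\<close> is homogeneous of weight
  \<open>v\<close>, the multiple can be nonzero only in weight \<open>v\<close>.\<close>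

lemma lie_rel_elim:
  fixes \<epsilon> :: "'i \<times> nat list \<Rightarrow> 'x ncps"
  assumes gens: "lie_gens v Y w \<theta>" and x: "x \<in> Y" "w x = v"
    and "lie_rel Y w \<theta> \<epsilon> m g e"
  defines "R \<equiv> lie_rel (elim_index Y x) (elim_fam (\<lambda>n. v + n) w) (elim_fam (comm (\<theta> x)) \<theta>)
      (elim_fam (ad (\<epsilon> x)) \<epsilon>)"
  shows "\<exists>(j::int) g' e'. R m g' e' \<and> (j \<noteq> 0 \<longrightarrow> m = v) \<and>
    cl (Suc m) g = cl (Suc m) (\<theta> x [^] j \<otimes> g') \<and> e = of_int j * \<epsilon> x + e'"
  using assms(4)
proof (induction rule: lie_rel.induct)
  note gens' = lie_gens_elim[OF gens x]
  have z: "\<theta> x \<in> L v" "v \<ge> 1" "\<theta> x \<in> carrier G"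
    using gens x by (auto simp: lie_gens_def intro: L_carrier)
  have R_mem: "g \<in> L n" "n \<ge> 1" "g \<in> carrier G" if "R n g e" for n g e
    using lie_rel_mem[OF gens' that[unfolded R_def]] L_carrier by auto
  {
    case (gen y)
    show ?case
    proof (cases "y = x")
      case True
      have "R v \<one> 0" unfolding R_def using z L_one by (intro lie_rel.zero)
      then show ?thesis
        using True x z by (intro exI[of _ 1] exI[of _ \<one>] exI[of _ 0]) (simp add: int_pow_1)
    next
      case False
      obtain b ks where y: "y = (b, ks)" by (cases y)
      have "R (w y) (\<theta> y) (\<epsilon> y)"
        using lie_rel.gen[OF elim_indexI[of b ks Y x 0], of "elim_fam (\<lambda>n. v + n) w"
            "elim_fam (comm (\<theta> x)) \<theta>" "elim_fam (ad (\<epsilon> x)) \<epsilon>"] gen False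
        by (simp add: y R_def)
      then show ?thesis
        using R_mem[of "w y" "\<theta> y" "\<epsilon> y"] by (intro exI[of _ 0] exI[of _ "\<theta> y"] exI[of _ "\<epsilon> y"]) simp
    qed
  next
    case (zero m g)
    then have "R m g 0" unfolding R_def by (intro lie_rel.zero)
    then show ?case using R_mem[of m g 0] by (intro exI[of _ 0] exI[of _ g] exI[of _ 0]) simp
  next
    case (mult m g e h f)
    obtain j :: int and g' e' where g: "R m g' e'" "j \<noteq> 0 \<longrightarrow> m = v"
      "cl (Suc m) g = cl (Suc m) (\<theta> x [^] j \<otimes> g')" "e = of_int j * \<epsilon> x + e'" using mult.IH(1) by blast
    obtain l :: int and h' f' where h: "R m h' f'" "l \<noteq> 0 \<longrightarrow> m = v"
      "cl (Suc m) h = cl (Suc m) (\<theta> x [^] l \<otimes> h')" "f = of_int l * \<epsilon> x + f'" using mult.IH(2) by blast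
    have c: "g \<in> carrier G" "h \<in> carrier G" "g' \<in> carrier G" "h' \<in> carrier G"
      using lie_rel_mem[OF gens mult.hyps(1)] lie_rel_mem[OF gens mult.hyps(2)]
        R_mem(3)[OF g(1)] R_mem(3)[OF h(1)] by (auto intro: L_carrier)
    have "cl (Suc m) (g \<otimes> h) = cl (Suc m) (\<theta> x [^] j \<otimes> g' \<otimes> (\<theta> x [^] l \<otimes> h'))"
      using g h c z by (intro cl_mult_cong) auto
    also have "\<dots> = cl (Suc m) (\<theta> x [^] j \<otimes> (g' \<otimes> \<theta> x [^] l) \<otimes> h')"
      using c z by (simp add: m_assoc)
    also have "\<dots> = cl (Suc m) (\<theta> x [^] j \<otimes> (\<theta> x [^] l \<otimes> g') \<otimes> h')"
    proof -
      have "\<theta> x [^] l \<in> L m"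
        using h(2) subgroup_int_pow_closed[OF L_subgroup z(1), of l] L_one by (cases "l = 0") auto
      then have "cl (Suc m) (g' \<otimes> \<theta> x [^] l) = cl (Suc m) (\<theta> x [^] l \<otimes> g')"
        using R_mem[OF g(1)] by (intro cl_comm_swap[of m m]) auto
      then show ?thesis using c z by (simp add: cl_mult)
    qed
    also have "\<dots> = cl (Suc m) (\<theta> x [^] (j + l) \<otimes> (g' \<otimes> h'))"
      using c z by (simp add: m_assoc int_pow_mult)
    finally have "cl (Suc m) (g \<otimes> h) = cl (Suc m) (\<theta> x [^] (j + l) \<otimes> (g' \<otimes> h'))" .
    moreover have "R m (g' \<otimes> h') (e' + f')" using g h unfolding R_def by (intro lie_rel.mult)
    ultimately show ?case
      using g(2,4) h(2,4)
      by (intro exI[of _ "j + l"] exI[of _ "g' \<otimes> h'"] exI[of _ "e' + f'"]) (auto simp: algebra_simps)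
  next
    case (inv m g e)
    obtain j :: int and g' e' where g: "R m g' e'" "j \<noteq> 0 \<longrightarrow> m = v"
      "cl (Suc m) g = cl (Suc m) (\<theta> x [^] j \<otimes> g')" "e = of_int j * \<epsilon> x + e'" using inv.IH by blast
    have c: "g \<in> carrier G" "g' \<in> carrier G"
      using lie_rel_mem[OF gens inv.hyps] R_mem(3)[OF g(1)] by (auto intro: L_carrier)
    have "cl (Suc m) (inv g) = cl (Suc m) (inv (\<theta> x [^] j \<otimes> g'))"
      using g c z by (intro cl_inv_cong) auto
    also have "\<dots> = cl (Suc m) (inv g' \<otimes> \<theta> x [^] (- j))"
      using c z by (simp add: inv_mult_group int_pow_neg)
    also have "\<dots> = cl (Suc m) (\<theta> x [^] (- j) \<otimes> inv g')"
    proof -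
      have "\<theta> x [^] (- j) \<in> L m"
        using g(2) subgroup_int_pow_closed[OF L_subgroup z(1), of "- j"] L_one by (cases "j = 0") auto
      then show ?thesis
        using R_mem[OF g(1)] by (intro cl_comm_swap[of m m]) (auto intro: L_inv)
    qed
    finally have "cl (Suc m) (inv g) = cl (Suc m) (\<theta> x [^] (- j) \<otimes> inv g')" .
    moreover have "R m (inv g') (- e')" using g unfolding R_def by (intro lie_rel.inv)
    ultimately show ?case
      using g(2,4)
      by (intro exI[of _ "- j"] exI[of _ "inv g'"] exI[of _ "- e'"]) (auto simp: algebra_simps)
  next
    \<comment> \<open>Expanding the bracket of \<open>j x + g'\<close> and \<open>l x + h'\<close>,
      the term with \<open>x\<close> twice vanishes and \<open>lie_rel_ad\<close> keeps the others
      in the ideal. So the new multiple of \<open>x\<close> is 0.\<close>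
    case (bracket m g e n h f)
    obtain j :: int and g' e' where g: "R m g' e'" "j \<noteq> 0 \<longrightarrow> m = v"
      "cl (Suc m) g = cl (Suc m) (\<theta> x [^] j \<otimes> g')" "e = of_int j * \<epsilon> x + e'" using bracket.IH(1) by blast
    obtain l :: int and h' f' where h: "R n h' f'" "l \<noteq> 0 \<longrightarrow> n = v"
      "cl (Suc n) h = cl (Suc n) (\<theta> x [^] l \<otimes> h')" "f = of_int l * \<epsilon> x + f'" using bracket.IH(2) by blast
    note mem = lie_rel_mem[OF gens bracket.hyps(1)] lie_rel_mem[OF gens bracket.hyps(2)]
    note memR = R_mem[OF g(1)] R_mem[OF h(1)]
    have c: "g \<in> carrier G" "h \<in> carrier G" using mem L_carrier by blast+
    have zj: "\<theta> x [^] j \<in> L m" and zl: "\<theta> x [^] l \<in> L n"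
      using g(2) h(2) subgroup_int_pow_closed[OF L_subgroup z(1)] L_one
      by (cases "j = 0"; cases "l = 0"; auto)+
    let ?k = "Suc (m + n)"
    have "cl ?k (comm g h) = cl ?k (comm (\<theta> x [^] j \<otimes> g') h)"
      using g(3) mem memR zj c by (intro cl_comm_cong_left[of m n]) (auto intro: L_mult)
    also have "\<dots> = cl ?k (comm (\<theta> x [^] j \<otimes> g') (\<theta> x [^] l \<otimes> h'))"
      using h(3) mem memR zj zl c by (intro cl_comm_cong_right[of m n]) (auto intro: L_mult)
    also have "\<dots> = cl ?k (comm (\<theta> x [^] j) (\<theta> x [^] l \<otimes> h') \<otimes> comm g' (\<theta> x [^] l \<otimes> h'))"
      using mem memR zj zl by (intro cl_comm_mult_left[of m n]) (auto intro: L_mult)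
    also have "\<dots> = cl ?k ((comm (\<theta> x [^] j) (\<theta> x [^] l) \<otimes> comm (\<theta> x [^] j) h') \<otimes>
        (comm g' (\<theta> x [^] l) \<otimes> comm g' h'))"
      using mem memR zj zl z by (intro cl_mult_cong cl_comm_mult_right[of m n]) auto
    also have "comm (\<theta> x [^] j) (\<theta> x [^] l) = \<one>"
    proof -
      have "\<theta> x [^] j \<otimes> \<theta> x [^] l = \<theta> x [^] l \<otimes> \<theta> x [^] j"
        using z by (simp add: int_pow_mult[symmetric] add.commute)
      then have "\<theta> x [^] l \<otimes> \<theta> x [^] j = comm (\<theta> x [^] j) (\<theta> x [^] l) \<otimes> (\<theta> x [^] l \<otimes> \<theta> x [^] j)"
        using z mult_eq_comm_mult[of "\<theta> x [^] j" "\<theta> x [^] l"] by simp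
      then show ?thesis using z by (simp add: r_cancel_one')
    qed
    finally have cl: "cl ?k (comm g h) = cl ?k (comm (\<theta> x [^] j) h' \<otimes> (comm g' (\<theta> x [^] l) \<otimes> comm g' h'))"
      using z memR by simp
    have one: "R (m + n) \<one> 0"
      unfolding R_def by (rule lie_rel.zero[OF _ L_one]) (use mem in simp)
    have A: "R (m + n) (comm (\<theta> x [^] j) h') (of_int j * ad (\<epsilon> x) f')"
    proof (cases "j = 0")
      case True
      then have "comm (\<theta> x [^] j) h' = \<one>" using memR z by (simp add: comm_def)
      then show ?thesis using one True by simp
    next
      case False
      then have m: "m = v" using g(2) by simp
      have "R (v + n) (comm (\<theta> x) h' [^] j) (of_int j * ad (\<epsilon> x) f')"
        unfolding R_def by (rule lie_rel_int_pow[OF gens' lie_rel_ad[OF gens x h(1)[unfolded R_def]]])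
      from lie_rel_cl[OF gens' this[unfolded R_def] cl_comm_int_pow_left[of v n]] show ?thesis
        using memR z mem by (simp add: R_def m)
    qed
    have B: "R (m + n) (comm g' (\<theta> x [^] l)) (- (of_int l * ad (\<epsilon> x) e'))"
    proof (cases "l = 0")
      case True
      then have "comm g' (\<theta> x [^] l) = \<one>" using memR z by (simp add: comm_def)
      then show ?thesis using one True by simp
    next
      case False
      then have n: "n = v" using h(2) by simp
      have "R (v + m) (comm (\<theta> x) g' [^] l) (of_int l * ad (\<epsilon> x) e')"
        unfolding R_def by (rule lie_rel_int_pow[OF gens' lie_rel_ad[OF gens x g(1)[unfolded R_def]]])
      from lie_rel_cl[OF gens' this[unfolded R_def] cl_comm_int_pow_left[of v m]]
      have "R (v + m) (comm (\<theta> x [^] l) g') (of_int l * ad (\<epsilon> x) e')"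
        using memR z mem by (simp add: R_def)
      from lie_rel.inv[OF this[unfolded R_def]] show ?thesis
        using memR z by (simp add: R_def n inv_comm add.commute)
    qed
    have C: "R (m + n) (comm g' h') (ad e' f')"
      using g(1) h(1) unfolding R_def by (rule lie_rel.bracket)
    note A [unfolded R_def] B [unfolded R_def] C [unfolded R_def]
    note lie_rel.mult[OF this(1) lie_rel.mult[OF this(2,3)]]
    from lie_rel_cl[OF gens' this cl] have "R (m + n) (comm g h) (of_int j * ad (\<epsilon> x) f' + (- (of_int l * ad (\<epsilon> x) e') + ad e' f'))"
      using c by (simp add: R_def)
    moreover have "ad e f = of_int j * ad (\<epsilon> x) f' + (- (of_int l * ad (\<epsilon> x) e') + ad e' f')"
      unfolding g(4) h(4) ad_add_left ad_add_right ad_of_int_left ad_of_int_right ad_self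
        ad_swap[of e' "\<epsilon> x"] by simp
    ultimately have "R (m + n) (comm g h) (ad e f)" by (simp only:)
    moreover have "cl (Suc (m + n)) (comm g h) = cl (Suc (m + n)) (\<theta> x [^] (0::int) \<otimes> comm g h)"
      using c by simp
    moreover have "ad e f = of_int 0 * \<epsilon> x + ad e f" by simp
    ultimately show ?case by blast
  }
qed

text \<open>Base of the induction below: no generator has weight less than \<open>v\<close>, so only
  rule \<open>zero\<close> can start a derivation there.\<close>

lemma lie_rel_trivial:
  assumes "lie_gens v Y w \<theta>" "lie_rel Y w \<theta> \<epsilon> m g e" "m < v"
  shows "g \<in> L (Suc m)"
  using assms(2,3)
proof (induction rule: lie_rel.induct)
  case (gen y)
  then show ?case using assms(1) by (auto simp: lie_gens_def)
next
  case (bracket m g e n h f)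
  then have "g \<in> L (Suc m)" "h \<in> L n" "n \<ge> 1" using lie_rel_mem[OF assms(1)] by auto
  then show ?case using L_comm[of "Suc m" n g h] by simp
qed (auto intro: L_mult L_inv)

text \<open>Outer induction on the least weight \<open>v\<close> of a generator, inner induction on the number of
  generators of weight \<open>v\<close>: elimination removes one of them and adds only heavier ones.\<close>
theorem lie_rel_injective:
  fixes Y :: "('i \<times> nat list) set" and \<epsilon> :: "'i \<times> nat list \<Rightarrow> 'x ncps"
  assumes "right_indep p Y \<epsilon>" "lie_gens v Y w \<theta>" "finite {y \<in> Y. w y \<le> m}"
    and "lie_rel Y w \<theta> \<epsilon> m g e" "e \<in> p_multiples p"
  shows "g \<in> L (Suc m)"
  using assms
proof (induction "Suc m - v" arbitrary: v Y w \<theta> \<epsilon> g e rule: less_induct)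
  case less
  note outer = less.hyps
  show ?case using less.prems
  proof (induction "card {y \<in> Y. w y = v}" arbitrary: Y w \<theta> \<epsilon> g e rule: less_induct)
    case less
    note gens = less.prems(2)
    have v: "v \<ge> 1" using gens by (simp add: lie_gens_def)
    note mem = lie_rel_mem[OF gens less.prems(4)]
    consider "m < v" | "v \<le> m" "{y \<in> Y. w y = v} = {}" | x where "v \<le> m" "x \<in> Y" "w x = v"
      by fastforce
    then show ?case
    proof cases
      case 1
      then show ?thesis by (rule lie_rel_trivial[OF gens less.prems(4)])
    next
      case 2
      have "lie_gens (Suc v) Y w \<theta>"
        using gens 2 by (fastforce simp: lie_gens_def Suc_le_eq le_less)
      then show ?thesis
        using outer[of "Suc v" Y \<epsilon> w \<theta> g e] less.prems 2 by auto
    next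
      case 3
      note x = 3(2,3)
      have z: "\<theta> x \<in> L v" "\<theta> x \<in> carrier G"
        using gens x by (auto simp: lie_gens_def intro: L_carrier)
      have weight: "((\<lambda>n. v + n) ^^ k) n = k * v + n" for k n
        by (induction k) auto
      let ?Y = "elim_index Y x" and ?w = "elim_fam (\<lambda>n. v + n) w"
        and ?\<theta> = "elim_fam (comm (\<theta> x)) \<theta>" and ?\<epsilon> = "elim_fam (ad (\<epsilon> x)) \<epsilon>"
      note gens' = lie_gens_elim[OF gens x]
      have w_ge: "v \<le> w y" if "y \<in> Y" for y using gens that by (auto simp: lie_gens_def)
      have "{y \<in> ?Y. ?w y \<le> m} \<subseteq> (\<lambda>(y, k). (fst y, k # snd y)) ` ({y \<in> Y. w y \<le> m} \<times> {..m})"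
      proof
        fix y assume "y \<in> {y \<in> ?Y. ?w y \<le> m}"
        then obtain b k ks where y: "y = (b, k # ks)" "(b, ks) \<in> Y" "k * v + w (b, ks) \<le> m"
          by (auto elim!: elim_indexE simp: weight)
        have "k \<le> k * v" using v by simp
        then have "k \<le> m" "w (b, ks) \<le> m" using y(3) by linarith+
        then show "y \<in> (\<lambda>(y, k). (fst y, k # snd y)) ` ({y \<in> Y. w y \<le> m} \<times> {..m})"
          using y by (intro image_eqI[of _ _ "((b, ks), k)"]) auto
      qed
      then have fin: "finite {y \<in> ?Y. ?w y \<le> m}"
        by (rule finite_subset) (use less.prems(3) in simp)
      \<comment> \<open>In weight \<open>v\<close> the eliminated family consists of the unbracketed
        copies (\<open>k = 0\<close>) of the other generators of weight \<open>v\<close>, because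
        \<open>v \<ge> 1\<close>.\<close>
      have low: "\<exists>b ks. y = (b, 0 # ks) \<and> (b, ks) \<in> Y - {x} \<and> w (b, ks) = v"
        if "y \<in> ?Y" "?w y \<le> v" for y
      proof -
        obtain b k ks where y: "y = (b, k # ks)" "(b, ks) \<in> Y" "(b, ks) \<noteq> x" "k * v + w (b, ks) \<le> v"
          using \<open>y \<in> ?Y\<close> \<open>?w y \<le> v\<close> by (auto elim!: elim_indexE simp: weight)
        have "k * v = 0" "w (b, ks) = v" using w_ge[OF y(2)] y(4) by linarith+
        then show ?thesis using y v by auto
      qed
      have fin_v: "finite {y \<in> Y. w y = v}"
        by (rule finite_subset[OF _ less.prems(3)]) (use 3 in auto)
      have "card {y \<in> ?Y. ?w y = v} \<le> card {y \<in> Y - {x}. w y = v}"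
      proof (rule card_inj_on_le)
        show "inj_on (\<lambda>y. (fst y, tl (snd y))) {y \<in> ?Y. ?w y = v}"
        proof (rule inj_onI)
          fix y y' assume "y \<in> {y \<in> ?Y. ?w y = v}" "y' \<in> {y \<in> ?Y. ?w y = v}"
          with low[of y] low[of y'] obtain b ks b' ks' where "y = (b, 0 # ks)" "y' = (b', 0 # ks')"
            by auto
          then show "(fst y, tl (snd y)) = (fst y', tl (snd y')) \<Longrightarrow> y = y'" by simp
        qed
        show "(\<lambda>y. (fst y, tl (snd y))) ` {y \<in> ?Y. ?w y = v} \<subseteq> {y \<in> Y - {x}. w y = v}"
        proof (rule image_subsetI)
          fix y assume "y \<in> {y \<in> ?Y. ?w y = v}"
          with low[of y] show "(fst y, tl (snd y)) \<in> {y \<in> Y - {x}. w y = v}" by auto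
        qed
        show "finite {y \<in> Y - {x}. w y = v}" by (rule finite_subset[OF _ fin_v]) auto
      qed
      also have "\<dots> < card {y \<in> Y. w y = v}"
        using x by (intro psubset_card_mono[OF fin_v]) auto
      finally have card: "card {y \<in> ?Y. ?w y = v} < card {y \<in> Y. w y = v}" .
      obtain j :: int and g' e' where g': "lie_rel ?Y ?w ?\<theta> ?\<epsilon> m g' e'" "j \<noteq> 0 \<longrightarrow> m = v"
        "cl (Suc m) g = cl (Suc m) (\<theta> x [^] j \<otimes> g')" "e = of_int j * \<epsilon> x + e'"
        using lie_rel_elim[OF gens x less.prems(4)] by blast
      \<comment> \<open>If \<open>j \<noteq> 0\<close> then \<open>m = v\<close>, so
        \<open>e'\<close> is a right combination of the other generators of weight \<open>v\<close>.
        Then \<open>e\<close> is a combination of the original family with the integer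
        \<open>j\<close> as the coefficient of \<open>\<epsilon> x\<close>, and independence applies
        to it.\<close>
      have j: "int p dvd j"
      proof (cases "j = 0")
        case False
        then have m: "m = v" using g'(2) by simp
        obtain Z f where Z: "finite Z" "Z \<subseteq> {y \<in> ?Y. ?w y \<le> v}" "e' = (\<Sum>y\<in>Z. ?\<epsilon> y * f y)"
          using right_span_lie_rel[OF g'(1)] unfolding right_span_def m by blast
        define Z0 where "Z0 = (\<lambda>y. (fst y, tl (snd y))) ` Z"
        define f' where "f' = (\<lambda>y. if y = x then of_int j else f (fst y, 0 # snd y))"
        have Z_low: "y = (fst y, 0 # tl (snd y))" "(fst y, tl (snd y)) \<in> Y - {x}" if "y \<in> Z" for y
        proof -
          have "y \<in> ?Y" "?w y \<le> v" using Z(2) that by auto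
          from low[OF this] show "y = (fst y, 0 # tl (snd y))" "(fst y, tl (snd y)) \<in> Y - {x}" by auto
        qed
        have Z_eq: "Z = (\<lambda>y. (fst y, 0 # snd y)) ` Z0"
          using Z_low(1) by (auto simp: Z0_def image_image)
        have Z0: "finite Z0" "Z0 \<subseteq> Y - {x}"
          using Z(1) Z_low(2) by (auto simp: Z0_def)
        have "e' = (\<Sum>y\<in>Z0. \<epsilon> y * f' y)"
          unfolding Z(3) Z_eq using Z0
          by (subst sum.reindex) (auto simp: inj_on_def f'_def elim_fam_def intro!: sum.cong)
        then have "e = (\<Sum>y\<in>insert x Z0. \<epsilon> y * f' y)"
          using Z0 g'(4) by (subst sum.insert) (auto simp: f'_def mult_of_int_commute)
        then have "(\<Sum>y\<in>insert x Z0. \<epsilon> y * f' y) \<in> p_multiples p" using less.prems(5) by simp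
        from right_indepD[OF less.prems(1) _ _ this, of x] have "f' x \<in> p_multiples p"
          using Z0 x by auto
        then show ?thesis by (simp add: f'_def p_multiples_of_int)
      qed simp
      have "e' = e - of_int j * \<epsilon> x" using g'(4) by simp
      also have "\<dots> \<in> p_multiples p"
        using j less.prems(5) by (auto simp: p_multiples_def)
      finally have "g' \<in> L (Suc m)"
        using less.hyps[OF card right_indep_elim[OF less.prems(1) x(1)] gens' fin g'(1)]
          outer by blast
      \<comment> \<open>When \<open>j \<noteq> 0\<close>, the eliminated generator has weight
        \<open>v = m\<close>, and its \<open>p\<close>-th power lies one step deeper.\<close>
      moreover have "\<theta> x [^] j \<in> L (Suc m)"
      proof (cases "j = 0")
        case False
        obtain i where i: "j = int p * i" using j by (auto elim: dvdE)
        have "\<theta> x [^] j = (\<theta> x [^] p) [^] i"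
          using z by (simp add: i int_pow_pow[symmetric] int_pow_int)
        also have "\<dots> \<in> L (Suc v)"
          using L_power[OF v z(1)] by (intro subgroup_int_pow_closed L_subgroup)
        finally show ?thesis using g'(2) False by simp
      qed (simp add: L_one)
      ultimately show ?thesis
        using cl_mem[OF g'(3)] mem L_carrier L_mult by blast
    qed
  qed
qed

end

subsection \<open>The lower p-series as a filtration\<close>

context group
begin

lemma comm_inv_right:
  "x \<in> carrier G \<Longrightarrow> y \<in> carrier G \<Longrightarrow> comm x (inv y) = inv y \<otimes> inv (comm x y) \<otimes> inv (inv y)"
  by (simp add: free_simps)

lemma comm_mult_right_conj:
  "x \<in> carrier G \<Longrightarrow> y \<in> carrier G \<Longrightarrow> y' \<in> carrier G \<Longrightarrow>
    comm x (y \<otimes> y') = comm x y \<otimes> (y \<otimes> comm x y' \<otimes> inv y)"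
  by (simp add: free_simps)

text \<open>Allows \<open>comm x y \<in> N\<close> to be tested on generators of the term that
  contains \<open>y\<close>.\<close>

lemma comm_into_normal_subgroup:
  assumes "N \<lhd> G" "x \<in> carrier G"
  shows "subgroup {y \<in> carrier G. comm x y \<in> N} G"
proof -
  interpret N: normal N G by (rule assms)
  show ?thesis
  proof (unfold_locales, auto simp: comm_def[of x \<one>] assms comm_mult_right_conj)
    fix y y' assume "y \<in> carrier G" "y' \<in> carrier G" "comm x y \<in> N" "comm x y' \<in> N"
    then show "comm x y \<otimes> (y \<otimes> comm x y' \<otimes> inv y) \<in> N"
      using N.inv_op_closed2[of y "comm x y'"] N.m_closed by blast
  next
    fix y assume y: "y \<in> carrier G" "comm x y \<in> N"
    then show "comm x (inv y) \<in> N"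
      using N.inv_op_closed2[of "inv y" "inv (comm x y)"] assms by (simp only: comm_inv_right) auto
  qed
qed

lemma hall_witt:
  assumes "x \<in> carrier G" "y \<in> carrier G" "z \<in> carrier G"
  shows "(y \<otimes> comm x (comm (inv y) z) \<otimes> inv y) \<otimes> (z \<otimes> comm y (comm (inv z) x) \<otimes> inv z) \<otimes>
    (x \<otimes> comm z (comm (inv x) y) \<otimes> inv x) = \<one>"
  using assms by (simp add: free_simps)

lemma lower_p_series_subgroup: "subgroup (lower_p_series p G n) G"
  by (intro normal_imp_subgroup lower_p_series_normal)

lemma lower_p_series_closed: "x \<in> lower_p_series p G n \<Longrightarrow> x \<in> carrier G"
  by (rule subgroup.mem_carrier[OF lower_p_series_subgroup])

lemma lower_p_series_power:
  assumes "n \<ge> 1" "x \<in> lower_p_series p G n"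
  shows "x [^] p \<in> lower_p_series p G (Suc n)"
proof -
  obtain k where n: "n = Suc k" using assms(1) by (cases n) auto
  let ?L = "lower_p_series p G n"
  have C: "subgroup (commutator_subgroup G ?L (carrier G)) G"
    by (intro normal_imp_subgroup commutator_subgroup_normal lower_p_series_normal normal_self)
  have "x [^] p \<in> power_subgroup G ?L p"
    unfolding power_subgroup_def using assms by (intro generate.incl) auto
  moreover have "x [^] p \<in> carrier G"
    using assms by (intro nat_pow_closed lower_p_series_closed)
  ultimately have "x [^] p \<otimes> \<one> \<in> power_subgroup G ?L p <#> commutator_subgroup G ?L (carrier G)"
    using subgroup.one_closed[OF C] unfolding set_mult_def by blast
  then show ?thesis using \<open>x [^] p \<in> carrier G\<close> by (simp add: n)
qed

lemma lower_p_series_comm1: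
  assumes "n \<ge> 1" "x \<in> lower_p_series p G n" "y \<in> carrier G"
  shows "comm x y \<in> lower_p_series p G (Suc n)"
proof -
  obtain k where n: "n = Suc k" using assms(1) by (cases n) auto
  let ?L = "lower_p_series p G n"
  have P: "subgroup (power_subgroup G ?L p) G"
    by (intro normal_imp_subgroup power_subgroup_normal lower_p_series_normal)
  have x: "x \<in> carrier G"
    using assms by (intro lower_p_series_closed)
  have "comm x y \<in> commutator_subgroup G ?L (carrier G)"
    unfolding commutator_subgroup_def comm_def using assms by (intro generate.incl) auto
  then have "\<one> \<otimes> comm x y \<in> power_subgroup G ?L p <#> commutator_subgroup G ?L (carrier G)"
    using subgroup.one_closed[OF P] unfolding set_mult_def by blast
  then show ?thesis using assms x by (simp add: n)
qed

lemma lower_p_series_least: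
  assumes "n \<ge> 1" "subgroup H G"
    and "\<And>x. x \<in> lower_p_series p G n \<Longrightarrow> x [^] p \<in> H"
    and "\<And>x y. x \<in> lower_p_series p G n \<Longrightarrow> y \<in> carrier G \<Longrightarrow> comm x y \<in> H"
  shows "lower_p_series p G (Suc n) \<subseteq> H"
proof -
  obtain k where n: "n = Suc k" using assms(1) by (cases n) auto
  have "power_subgroup G (lower_p_series p G n) p \<subseteq> H"
    unfolding power_subgroup_def using assms by (intro generate_subgroup_incl) auto
  moreover have "commutator_subgroup G (lower_p_series p G n) (carrier G) \<subseteq> H"
    unfolding commutator_subgroup_def
    using assms by (intro generate_subgroup_incl) (auto simp: comm_def)
  ultimately show ?thesis
    using subgroup.m_closed[OF assms(2)] by (auto simp: n set_mult_def)
qed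

lemma lower_p_series_Suc_subset: "lower_p_series p G (Suc i) \<subseteq> lower_p_series p G i"
proof (cases "i = 0")
  case False
  let ?L = "lower_p_series p G"
  have sub: "subgroup (?L i) G" by (intro normal_imp_subgroup lower_p_series_normal)
  show ?thesis
  proof (rule lower_p_series_least[OF _ sub])
    fix x assume x: "x \<in> ?L i"
    have "x [^] int p \<in> ?L i" by (rule subgroup_int_pow_closed[OF sub x])
    then show "x [^] p \<in> ?L i" by (simp add: int_pow_int)
    fix y assume y: "y \<in> carrier G"
    have "x \<otimes> (y \<otimes> inv x \<otimes> inv y) \<in> ?L i"
      using normal.inv_op_closed2[OF lower_p_series_normal, of y "inv x" p i] x y
        subgroup.m_closed[OF sub] subgroup.m_inv_closed[OF sub] by blast
    then show "comm x y \<in> ?L i"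
      using subgroup.mem_carrier[OF sub x] y by (simp add: comm_def m_assoc)
  qed (use False in simp)
qed simp

lemma lower_p_series_antimono: "m \<le> n \<Longrightarrow> lower_p_series p G n \<subseteq> lower_p_series p G m"
  using lift_Suc_antimono_le[of "lower_p_series p G" m n] lower_p_series_Suc_subset by blast

text \<open>It suffices to treat the generators \<open>k [^] p\<close> and \<open>comm k g\<close>
  of the next term. Modulo \<open>N\<close> the element \<open>c = comm x k\<close> commutes with
  \<open>k\<close>, which gives \<open>comm x (k [^] p) = c [^] p\<close> there. For
  \<open>comm k g\<close> the Hall-Witt identity expresses the claim through two commutators covered
  by the induction hypothesis; one of them needs it with \<open>Suc m\<close> in place of
  \<open>m\<close>.\<close>

lemma lower_p_series_comm:
  assumes "m \<ge> 1" "n \<ge> 1" "x \<in> lower_p_series p G m" "y \<in> lower_p_series p G n"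
  shows "comm x y \<in> lower_p_series p G (m + n)"
  using assms
proof (induction n arbitrary: m x y)
  case (Suc n)
  let ?L = "lower_p_series p G"
  have sub: "subgroup (?L i) G" for i by (intro normal_imp_subgroup lower_p_series_normal)
  have car: "x \<in> carrier G" if "x \<in> ?L i" for i x
    using subgroup.mem_carrier[OF sub that] .
  show ?case
  proof (cases "n = 0")
    case True
    then show ?thesis using lower_p_series_comm1[of m x p y] Suc.prems by simp
  next
    case False
    then have n: "n \<ge> 1" by simp
    define N where "N = ?L (m + Suc n)"
    have N: "N \<lhd> G" unfolding N_def by (rule lower_p_series_normal)
    interpret N: normal N G by (rule N)
    have x: "x \<in> carrier G" using Suc.prems car by blast
    have "?L (Suc n) \<subseteq> {y \<in> carrier G. comm x y \<in> N}"
    proof (rule lower_p_series_least[OF n comm_into_normal_subgroup[OF N x]])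
      fix k assume k: "k \<in> ?L n"
      define c where "c = comm x k"
      have kc: "k \<in> carrier G" "c \<in> carrier G" using k car x by (auto simp: c_def)
      have c: "c \<in> ?L (m + n)" unfolding c_def using Suc.IH[OF Suc.prems(1) n Suc.prems(3) k] .
      interpret h: group_hom G "G Mod N" "\<lambda>a. N #> a"
        by (intro group_hom.intro group_hom_axioms.intro N.factorgroup_is_group N.r_coset_hom_Mod is_group)
      have "comm c k \<in> ?L (m + n + n)" using Suc.IH[OF _ n c k] n by simp
      moreover have "?L (m + n + n) \<subseteq> N"
        unfolding N_def using n by (intro lower_p_series_antimono) auto
      ultimately have "comm c k \<in> N" by blast
      then have "N #> (c \<otimes> k) = N #> (k \<otimes> c)"
        using kc mult_eq_comm_mult[of c k] h.hom_mult N.rcos_const[OF is_group]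
        by (metis coset_mult_assoc comm_closed m_closed N.subset)
      then have "(N #> c) \<otimes>\<^bsub>G Mod N\<^esub> (N #> k) = (N #> k) \<otimes>\<^bsub>G Mod N\<^esub> (N #> c)"
        using kc by (simp only: h.hom_mult)
      from h.H.pow_mult_distrib[OF this] have "N #> ((c \<otimes> k) [^] p) = N #> (c [^] p \<otimes> k [^] p)"
        using kc by (simp only: h.hom_nat_pow h.hom_mult h.hom_closed nat_pow_closed m_closed)
      moreover have "comm x (k [^] p) = (c \<otimes> k) [^] p \<otimes> inv (k [^] p)"
      proof -
        have "x \<otimes> k [^] (j::nat) \<otimes> inv x = (x \<otimes> k \<otimes> inv x) [^] j" for j
        proof (induction j)
          case (Suc j)
          have "x \<otimes> k [^] Suc j \<otimes> inv x = (x \<otimes> k [^] j \<otimes> inv x) \<otimes> (x \<otimes> k \<otimes> inv x)"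
            using x kc by (simp add: m_assoc)
          then show ?case by (simp add: Suc)
        qed (use x in simp)
        moreover have "x \<otimes> k \<otimes> inv x = c \<otimes> k" using x kc by (simp add: c_def free_simps)
        ultimately show ?thesis using x kc by (simp add: comm_def)
      qed
      ultimately have "N #> comm x (k [^] p) = N #> (c [^] p \<otimes> k [^] p \<otimes> inv (k [^] p))"
        using kc h.hom_mult by simp
      also have "c [^] p \<otimes> k [^] p \<otimes> inv (k [^] p) = c [^] p" using kc by (simp add: m_assoc)
      also have "N #> c [^] p = N"
        using lower_p_series_power[OF _ c] n by (intro N.rcos_const[OF is_group]) (simp add: N_def)
      finally have "comm x (k [^] p) \<in> N"
        using x kc rcos_self[OF _ N.subgroup_axioms, of "comm x (k [^] p)"] by simp
      then show "k [^] p \<in> {y \<in> carrier G. comm x y \<in> N}" using kc by simp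
    next
      fix k g assume k: "k \<in> ?L n" and g: "g \<in> carrier G"
      have kc: "k \<in> carrier G" using k car by blast
      have inv_L: "inv x \<in> ?L m" "inv k \<in> ?L n"
        using Suc.prems(3) k subgroup.m_inv_closed[OF sub] by auto
      have "comm x (inv g) \<in> ?L (Suc m)"
        using lower_p_series_comm1[OF Suc.prems(1,3), of "inv g"] g by simp
      then have "inv (comm x (inv g)) \<in> ?L (Suc m)" by (rule subgroup.m_inv_closed[OF sub])
      then have "comm (comm (inv g) x) (inv k) \<in> ?L (Suc m + n)"
        using Suc.IH[OF _ n _ inv_L(2), of "Suc m"] x g by (simp add: inv_comm)
      then have "inv (comm (comm (inv g) x) (inv k)) \<in> N"
        unfolding N_def by (intro subgroup.m_inv_closed[OF sub]) simp
      then have 1: "comm (inv k) (comm (inv g) x) \<in> N" using x kc g by (simp add: inv_comm)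
      have "comm (inv x) (inv k) \<in> ?L (m + n)" using Suc.IH[OF Suc.prems(1) n inv_L] .
      then have "comm (comm (inv x) (inv k)) g \<in> N"
        unfolding N_def using lower_p_series_comm1[of "m + n" _ p g] g n by simp
      then have "inv (comm (comm (inv x) (inv k)) g) \<in> N" by (rule N.m_inv_closed)
      then have 2: "comm g (comm (inv x) (inv k)) \<in> N" using x kc g by (simp add: inv_comm)
      \<comment> \<open>Hall-Witt is applied to \<open>inv k\<close>, so that its inner commutator
        becomes \<open>comm k g\<close>. The factors \<open>b\<close> and \<open>c\<close> lie in
        \<open>N\<close>, hence so does \<open>a\<close>.\<close>
      define a where "a = inv k \<otimes> comm x (comm k g) \<otimes> inv (inv k)"
      define b where "b = (g \<otimes> comm (inv k) (comm (inv g) x) \<otimes> inv g)"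
      define c where "c = (x \<otimes> comm g (comm (inv x) (inv k)) \<otimes> inv x)"
      have "b \<in> N" "c \<in> N"
        unfolding b_def c_def using N.inv_op_closed2 1 2 x g by auto
      moreover have "a \<in> carrier G" using x kc g by (simp add: a_def)
      moreover have "a \<otimes> b \<otimes> c = \<one>"
        using hall_witt[of x "inv k" g] x kc g by (simp add: a_def b_def c_def)
      ultimately have "a = inv (b \<otimes> c)"
        by (metis N.mem_carrier m_assoc m_closed inv_equality)
      then have "a \<in> N" using \<open>b \<in> N\<close> \<open>c \<in> N\<close> by auto
      then have "k \<otimes> a \<otimes> inv k \<in> N" using kc by (rule N.inv_op_closed2[rotated])
      also have "k \<otimes> a \<otimes> inv k = comm x (comm k g)"
        using x kc g by (simp add: a_def m_assoc)
      finally show "comm k g \<in> {y \<in> carrier G. comm x y \<in> N}" using kc g by simp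
    qed
    then show ?thesis using Suc.prems(4) by (auto simp: N_def)
  qed
qed simp

end

subsection \<open>The Magnus map\<close>

text \<open>For an inverse letter this is the geometric series of \<open>- letter x\<close>.\<close>

definition letter_value :: "bool \<times> 'x \<Rightarrow> 'x ncps" where
  "letter_value = (\<lambda>(b, x). if b then 1 + letter x
     else ncps (\<lambda>u. if set u \<subseteq> {x} then (- 1) ^ length u else 0))"

definition magnus_word :: "(bool \<times> 'x) list \<Rightarrow> 'x ncps" where
  "magnus_word w = foldr (\<lambda>a f. letter_value a * f) w 1"

lemma letter_value_inverse: "letter_value (b, x) * letter_value (\<not> b, x) = 1"
proof -
  define q where "q = ncps (\<lambda>u. if set u \<subseteq> {x} then (- 1) ^ length u else (0::int))"
  have q: "wcoeff q u = (if set u \<subseteq> {x} then (- 1) ^ length u else 0)" for u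
    by (simp add: q_def ncps_inverse)
  have "wcoeff ((1 + letter x) * q) u = wcoeff 1 u" for u
    by (cases u) (auto simp: distrib_right wcoeff_letter_mult wcoeff_letter q wcoeff_1)
  moreover have "wcoeff (q * (1 + letter x)) u = wcoeff 1 u" for u
    by (cases u rule: rev_cases) (auto simp: distrib_left wcoeff_mult_letter wcoeff_letter q wcoeff_1)
  ultimately show ?thesis
    by (auto simp: letter_value_def q_def[symmetric] intro: ncps_eqI)
qed

lemma magnus_word_append: "magnus_word (v @ w) = magnus_word v * magnus_word w"
  by (induction v) (simp_all add: magnus_word_def mult.assoc)

lemma not_reducedE:
  assumes "\<not> reduced_word w"
  obtains u b x v where "w = u @ [(b, x), (\<not> b, x)] @ v"
proof -
  have "\<exists>u b x v. w = u @ [(b, x), (\<not> b, x)] @ v"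
    using assms
  proof (induction w rule: induct_list012)
    case (3 a c w)
    obtain b x where a: "a = (b, x)" by (cases a)
    show ?case
    proof (cases "c = (\<not> b, x)")
      case True
      then show ?thesis using a by (intro exI[of _ "[]"]) auto
    next
      case False
      then have "\<not> reduced_word (c # w)"
        using 3 a by (cases c) (auto simp: reduced_word_def)
      then obtain u b x v where "c # w = u @ [(b, x), (\<not> b, x)] @ v" using 3 by blast
      then show ?thesis by (intro exI[of _ "a # u"]) auto
    qed
  qed (auto simp: reduced_word_def)
  then show thesis using that by blast
qed

definition word_inverse :: "(bool \<times> 'x) list \<Rightarrow> (bool \<times> 'x) list" where
  "word_inverse w = rev (map (\<lambda>(b, x). (\<not> b, x)) w)"

lemma word_inverse_Cons: "word_inverse ((b, x) # w) = word_inverse w @ [(\<not> b, x)]"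
  by (simp add: word_inverse_def)

lemma set_word_inverse: "set w \<subseteq> UNIV \<times> B \<Longrightarrow> set (word_inverse w) \<subseteq> UNIV \<times> B"
  by (auto simp: word_inverse_def)

lemma magnus_word_word_inverse: "magnus_word (word_inverse w) * magnus_word w = 1"
proof (induction w)
  case (Cons a w)
  obtain b x where a: "a = (b, x)" by (cases a)
  have "magnus_word (word_inverse (a # w)) * magnus_word (a # w)
      = magnus_word (word_inverse w) * (letter_value (\<not> b, x) * letter_value (b, x)) * magnus_word w"
    by (simp add: a word_inverse_Cons magnus_word_append) (simp add: magnus_word_def mult.assoc)
  then show ?case using Cons letter_value_inverse[of "\<not> b" x] by simp
qed (simp add: word_inverse_def magnus_word_def)

context group
begin

lemma word_value_closed: "set w \<subseteq> UNIV \<times> carrier G \<Longrightarrow> word_value G w \<in> carrier G"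
  by (induction w) (auto simp: word_value_def)

lemma word_value_append:
  "set v \<subseteq> UNIV \<times> carrier G \<Longrightarrow> set w \<subseteq> UNIV \<times> carrier G \<Longrightarrow>
    word_value G (v @ w) = word_value G v \<otimes> word_value G w"
proof (induction v)
  case Nil
  then show ?case using word_value_closed[of w] by (simp add: word_value_def)
next
  case (Cons a v)
  then show ?case using word_value_closed[of v] word_value_closed[of w]
    by (auto simp: word_value_def m_assoc)
qed

lemma word_value_word_inverse:
  "set w \<subseteq> UNIV \<times> carrier G \<Longrightarrow> word_value G (word_inverse w) = inv (word_value G w)"
proof (induction w)
  case Nil
  then show ?case by (simp add: word_inverse_def word_value_def)
next
  case (Cons a w)
  obtain b x where a: "a = (b, x)" by (cases a)
  have "word_value G (word_inverse (a # w)) = word_value G (word_inverse w) \<otimes> word_value G [(\<not> b, x)]"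
    unfolding a word_inverse_Cons using Cons.prems set_word_inverse[of w "carrier G"] a
    by (intro word_value_append) auto
  then show ?case
    using Cons word_value_closed[of w] by (auto simp: a word_value_def inv_mult_group)
qed

text \<open>By freeness a nonempty word of value 1 is not reduced. Deleting a cancelling pair
  changes neither its value nor its series, and the shorter word is covered by induction.\<close>

lemma magnus_word_relator:
  assumes "free_basis G B" "set w \<subseteq> UNIV \<times> B" "word_value G w = \<one>"
  shows "magnus_word w = 1"
  using assms(2,3)
proof (induction w rule: length_induct)
  case (1 w)
  have B: "B \<subseteq> carrier G" using assms(1) by (simp add: free_basis_def)
  show ?case
  proof (cases "w = []")
    case False
    then have "\<not> reduced_word w"
      using assms(1) 1(2,3) unfolding free_basis_def by blast
    then obtain u b x v where w: "w = u @ [(b, x), (\<not> b, x)] @ v" by (rule not_reducedE)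
    have sets: "set u \<subseteq> UNIV \<times> carrier G" "set v \<subseteq> UNIV \<times> carrier G" "x \<in> carrier G"
      using 1(2) B by (auto simp: w)
    have "word_value G w = word_value G u \<otimes> (word_value G [(b, x), (\<not> b, x)] \<otimes> word_value G v)"
      unfolding w using sets by (subst word_value_append; (subst word_value_append)?) auto
    also have "word_value G [(b, x), (\<not> b, x)] = \<one>" using sets by (auto simp: word_value_def)
    finally have "word_value G (u @ v) = \<one>"
      using sets 1(3) word_value_closed[of v] by (simp add: word_value_append)
    then have "magnus_word (u @ v) = 1"
      using 1(1)[rule_format, of "u @ v"] 1(2) by (auto simp: w)
    moreover have "magnus_word w = magnus_word u * (letter_value (b, x) * letter_value (\<not> b, x)) * magnus_word v"
      unfolding w magnus_word_append by (simp add: magnus_word_def mult.assoc)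
    ultimately show ?thesis by (simp add: letter_value_inverse magnus_word_append)
  qed (simp add: magnus_word_def)
qed

lemma word_value_surj:
  assumes "B \<subseteq> carrier G" "g \<in> generate G B"
  shows "\<exists>w. set w \<subseteq> UNIV \<times> B \<and> word_value G w = g"
  using assms(2)
proof (induction rule: generate.induct)
  case one
  then show ?case by (intro exI[of _ "[]"]) (simp add: word_value_def)
next
  case (incl h)
  then show ?case using assms(1) by (intro exI[of _ "[(True, h)]"]) (auto simp: word_value_def)
next
  case (inv h)
  then show ?case using assms(1) by (intro exI[of _ "[(False, h)]"]) (auto simp: word_value_def)
next
  case (eng g h)
  then obtain v w where "set v \<subseteq> UNIV \<times> B" "word_value G v = g" "set w \<subseteq> UNIV \<times> B" "word_value G w = h"
    by blast
  moreover have "UNIV \<times> B \<subseteq> UNIV \<times> carrier G" for U using assms(1) by blast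
  ultimately show ?case using word_value_append[of v w] by (intro exI[of _ "v @ w"]) fastforce
qed

text \<open>The series is read off from an arbitrarily chosen word. Two words for the same element
  differ by a relator, whose series is 1.\<close>

theorem magnus_map_exists:
  assumes "free_basis G B"
  obtains \<mu> :: "'a \<Rightarrow> 'a ncps" where
    "\<And>g h. g \<in> carrier G \<Longrightarrow> h \<in> carrier G \<Longrightarrow> \<mu> (g \<otimes> h) = \<mu> g * \<mu> h"
    "\<mu> \<one> = 1" "\<And>b. b \<in> B \<Longrightarrow> \<mu> b = 1 + letter b"
proof -
  have B: "B \<subseteq> carrier G" "generate G B = carrier G" using assms by (auto simp: free_basis_def)
  then have sub: "UNIV \<times> B \<subseteq> UNIV \<times> carrier G" by blast
  define word where "word = (\<lambda>g. SOME w. set w \<subseteq> UNIV \<times> B \<and> word_value G w = g)"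
  have word: "set (word g) \<subseteq> UNIV \<times> B" "word_value G (word g) = g" if "g \<in> carrier G" for g
    using someI_ex[OF word_value_surj[OF B(1), of g]] that B(2) by (auto simp: word_def)
  have eq: "magnus_word w = magnus_word (word g)"
    if "set w \<subseteq> UNIV \<times> B" "word_value G w = g" "g \<in> carrier G" for w g
  proof -
    have sets: "set w \<subseteq> UNIV \<times> carrier G" "set (word g) \<subseteq> UNIV \<times> carrier G"
      "set (word_inverse (word g)) \<subseteq> UNIV \<times> carrier G"
      using that(1) word(1)[OF that(3)] set_word_inverse[OF word(1)[OF that(3)]] sub by blast+
    have "word_value G (word_inverse (word g) @ w) = inv g \<otimes> g"
      using that(2) word(2)[OF that(3)] by (simp add: word_value_append word_value_word_inverse sets)
    then have "word_value G (word_inverse (word g) @ w) = \<one>" using that(3) by simp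
    then have one: "magnus_word (word_inverse (word g) @ w) = 1"
      using that(1) set_word_inverse[OF word(1)[OF that(3)]]
      by (intro magnus_word_relator[OF assms]) auto
    \<comment> \<open>\<open>magnus_word_word_inverse\<close> provides a left inverse; applied to
      the inverse word it provides the right inverse needed here.\<close>
    define v where "v = word_inverse (word_inverse (word g))"
    have v: "v = word g" by (simp add: v_def word_inverse_def rev_map comp_def case_prod_unfold)
    have "magnus_word (word g) * magnus_word (word_inverse (word g)) = 1"
      using magnus_word_word_inverse[of "word_inverse (word g)"] v by (simp add: v_def)
    then have "magnus_word w = magnus_word (word g) * (magnus_word (word_inverse (word g)) * magnus_word w)"
      by (simp add: mult.assoc[symmetric])
    then show ?thesis using one by (simp add: magnus_word_append)
  qed
  show thesis
  proof (rule that[of "\<lambda>g. magnus_word (word g)"])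
    fix g h assume gh: "g \<in> carrier G" "h \<in> carrier G"
    have "magnus_word (word g @ word h) = magnus_word (word (g \<otimes> h))"
      using word[OF gh(1)] word[OF gh(2)] gh
        word_value_append[OF subset_trans[OF word(1) sub] subset_trans[OF word(1) sub], OF gh]
      by (intro eq) auto
    then show "magnus_word (word (g \<otimes> h)) = magnus_word (word g) * magnus_word (word h)"
      by (simp add: magnus_word_append)
  next
    show "magnus_word (word \<one>) = 1"
      using eq[of "[]" \<one>] by (simp add: word_value_def magnus_word_def)
  next
    fix b assume "b \<in> B"
    then show "magnus_word (word b) = 1 + letter b"
      using eq[of "[(True, b)]" b] B by (auto simp: word_value_def magnus_word_def letter_value_def)
  qed
qed

end

subsection \<open>The Magnus filtration of a free group\<close>

declare lower_p_series.simps(3) [simp del]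

text \<open>Of freeness only the Magnus homomorphism is kept; finite generation by \<open>B\<close>
  is recorded separately.\<close>

locale free_p_series = group G for G (structure) +
  fixes p :: nat and B :: "'a set" and \<mu> :: "'a \<Rightarrow> 'a ncps"
  assumes p: "prime p"
    and B: "finite B" "B \<subseteq> carrier G" "generate G B = carrier G"
    and mu_mult: "g \<in> carrier G \<Longrightarrow> h \<in> carrier G \<Longrightarrow> \<mu> (g \<otimes> h) = \<mu> g * \<mu> h"
    and mu_one: "\<mu> \<one> = 1"
    and mu_B: "b \<in> B \<Longrightarrow> \<mu> b = 1 + letter b"
begin

abbreviation L :: "nat \<Rightarrow> 'a set" where "L \<equiv> lower_p_series p G"

sublocale p_filtration G p L
proof (intro p_filtration.intro p_filtration_axioms.intro)
  show "group G" by (rule is_group)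
  show "L n \<lhd> G" for n by (rule lower_p_series_normal)
  show "L 1 = carrier G" by simp
  show "L (Suc n) \<subseteq> L n" for n by (rule lower_p_series_Suc_subset)
  show "n \<ge> 1 \<Longrightarrow> x \<in> L n \<Longrightarrow> x [^] p \<in> L (Suc n)" for n x by (rule lower_p_series_power)
  show "m \<ge> 1 \<Longrightarrow> n \<ge> 1 \<Longrightarrow> x \<in> L m \<Longrightarrow> y \<in> L n \<Longrightarrow> comm x y \<in> L (m + n)" for m n x y
    by (rule lower_p_series_comm)
qed

definition \<delta> :: "'a \<Rightarrow> 'a ncps" where "\<delta> g = \<mu> g - 1"

lemma mu_eq: "\<mu> g = 1 + \<delta> g"
  by (simp add: \<delta>_def)

lemma delta_one: "\<delta> \<one> = 0"
  by (simp add: \<delta>_def mu_one)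

lemma delta_B: "b \<in> B \<Longrightarrow> \<delta> b = letter b"
  by (simp add: \<delta>_def mu_B)

lemma delta_mult:
  "g \<in> carrier G \<Longrightarrow> h \<in> carrier G \<Longrightarrow> \<delta> (g \<otimes> h) = \<delta> g + \<delta> h + \<delta> g * \<delta> h"
  by (simp add: \<delta>_def mu_mult algebra_simps)

lemma delta_inv:
  assumes "g \<in> carrier G"
  shows "\<delta> (inv g) = - \<delta> g - \<delta> g * \<delta> (inv g)"
proof -
  have "0 = \<delta> (g \<otimes> inv g)" using assms by (simp add: delta_one)
  also have "\<dots> = \<delta> g + \<delta> (inv g) + \<delta> g * \<delta> (inv g)" using assms by (intro delta_mult) auto
  finally show ?thesis by (simp add: algebra_simps eq_neg_iff_add_eq_0)
qed

lemma mu_pow: "g \<in> carrier G \<Longrightarrow> \<mu> (g [^] (n::nat)) = \<mu> g ^ n"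
  by (induction n) (simp_all add: mu_one mu_mult power_commutes)

lemma delta_pow: "g \<in> carrier G \<Longrightarrow> \<delta> (g [^] n) = (1 + \<delta> g) ^ n - 1" for n :: nat
  by (simp add: \<delta>_def mu_pow)

text \<open>\<open>comm g h - 1\<close> becomes \<open>g h - h g\<close> times the inverse of
  \<open>h g\<close>. The last factor is 1 modulo \<open>I\<close>, so the bracket is the leading
  term.\<close>

lemma delta_comm:
  assumes "g \<in> carrier G" "h \<in> carrier G"
  shows "\<delta> (comm g h) = ad (\<delta> g) (\<delta> h) + ad (\<delta> g) (\<delta> h) * \<delta> (inv g \<otimes> inv h)"
proof -
  have "\<mu> (comm g h \<otimes> (h \<otimes> g)) = \<mu> (g \<otimes> h)"
    using assms by (simp flip: mult_eq_comm_mult)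
  have one: "\<mu> h * \<mu> g * \<mu> (inv g \<otimes> inv h) = 1"
    using assms by (simp flip: mu_mult mu_one add: m_assoc)
  have "\<mu> (comm g h) = \<mu> g * \<mu> h * \<mu> (inv g \<otimes> inv h)"
    using assms by (simp add: comm_def mu_mult mult.assoc)
  then have "\<mu> (comm g h) - 1 = (\<mu> g * \<mu> h - \<mu> h * \<mu> g) * \<mu> (inv g \<otimes> inv h)"
    by (simp add: left_diff_distrib one)
  also have "\<mu> g * \<mu> h - \<mu> h * \<mu> g = ad (\<delta> g) (\<delta> h)"
    by (simp add: \<delta>_def ad_def algebra_simps)
  finally have "\<delta> (comm g h) = ad (\<delta> g) (\<delta> h) * \<mu> (inv g \<otimes> inv h)"
    by (simp add: \<delta>_def[of "comm g h"])
  then show ?thesis by (simp add: mu_eq[of "inv g \<otimes> inv h"] distrib_left)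
qed

lemma adic_ideal: "f \<in> adic p n \<Longrightarrow> f * g \<in> adic p n"
  using adic_mult[of f p n g 0] by simp

lemma adic_subgroup: "subgroup {g \<in> carrier G. \<delta> g \<in> adic p n} G"
  by (unfold_locales)
    (auto simp: delta_one delta_mult intro: adic_add adic_ideal,
      subst delta_inv, auto intro: adic_diff adic_uminus adic_ideal)

lemma generate_induct:
  assumes "subgroup {g \<in> carrier G. P g} G" "\<And>b. b \<in> B \<Longrightarrow> P b" "g \<in> carrier G"
  shows "P g"
proof -
  have "B \<subseteq> {g \<in> carrier G. P g}" using B(2) assms(2) by blast
  from generate_subgroup_incl[OF this assms(1)] show ?thesis using B(3) assms(3) by blast
qed

lemma delta_adic_1: "g \<in> carrier G \<Longrightarrow> \<delta> g \<in> adic p 1"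
  by (rule generate_induct[OF adic_subgroup]) (simp_all only: delta_B letter_adic)

lemma coeff_delta_Nil: "g \<in> carrier G \<Longrightarrow> wcoeff (\<delta> g) [] = 0"
proof (rule generate_induct)
  show "subgroup {g \<in> carrier G. wcoeff (\<delta> g) [] = 0} G"
    by (unfold_locales) (auto simp: delta_one delta_mult, subst delta_inv, auto)
qed (simp_all add: delta_B wcoeff_letter)

lemma ad_adic: "f \<in> adic p m \<Longrightarrow> g \<in> adic p n \<Longrightarrow> ad f g \<in> adic p (m + n)"
  using adic_mult[of f p m g n] adic_mult[of g p n f m] by (simp add: ad_def adic_diff add.commute)

lemma delta_comm_adic:
  assumes "g \<in> carrier G" "h \<in> carrier G" "\<delta> g \<in> adic p m" "\<delta> h \<in> adic p n"
  shows "\<delta> (comm g h) - ad (\<delta> g) (\<delta> h) \<in> adic p (Suc (m + n))"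
proof -
  have "ad (\<delta> g) (\<delta> h) * \<delta> (inv g \<otimes> inv h) \<in> adic p (m + n + 1)"
    using assms by (intro adic_mult ad_adic delta_adic_1) auto
  then show ?thesis using assms(1,2) by (simp add: delta_comm)
qed

lemma delta_pow_p:
  assumes "g \<in> carrier G" "\<delta> g \<in> adic p n" "n \<ge> 1" "n \<ge> 2 \<or> length u < p"
  shows "int p ^ (n + 2 - length u) dvd wcoeff (\<delta> (g [^] p)) u - int p * wcoeff (\<delta> g) u"
  using wcoeff_power_p[OF p assms(2) coeff_delta_Nil[OF assms(1)] assms(3,4)] assms(1)
  by (simp add: delta_pow)

text \<open>By minimality of the next term only \<open>p\<close>-th powers and commutators have to
  be checked.\<close>

lemma L_adic:
  assumes "n \<ge> 1" "g \<in> L n"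
  shows "\<delta> g \<in> adic p n"
  using assms
proof (induction n arbitrary: g)
  case (Suc n)
  show ?case
  proof (cases "n = 0")
    case False
    have "L (Suc n) \<subseteq> {g \<in> carrier G. \<delta> g \<in> adic p (Suc n)}"
    proof (rule lower_p_series_least[OF _ adic_subgroup])
      fix x assume x: "x \<in> L n"
      have d: "\<delta> x \<in> adic p n" using Suc.IH x False by simp
      have xc: "x \<in> carrier G" using x by (rule L_carrier)
      have "int p ^ (Suc n - length u) dvd wcoeff (\<delta> (x [^] p)) u" for u
      proof (cases "n \<ge> 2 \<or> length u < p")
        case True
        have "int p ^ (Suc n - length u) dvd int p ^ (n + 2 - length u)"
          by (rule le_imp_power_dvd) simp
        also have "\<dots> dvd wcoeff (\<delta> (x [^] p)) u - int p * wcoeff (\<delta> x) u"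
          using xc d False True by (intro delta_pow_p) auto
        finally have 1: "int p ^ (Suc n - length u) dvd wcoeff (\<delta> (x [^] p)) u - int p * wcoeff (\<delta> x) u" .
        have "int p ^ (Suc n - length u) dvd int p * wcoeff (\<delta> x) u"
          using adicD[OF adic_p_mult[OF d], of u] by simp
        from dvd_add[OF 1 this] show ?thesis by simp
      next
        \<comment> \<open>Here \<open>n = 1\<close> and the word has length at least
          \<open>p \<ge> 2\<close>, where membership in \<open>adic p 2\<close> imposes no
          condition.\<close>
        case u: False
        then have "Suc n - length u = 0" using prime_ge_2_nat[OF p] by simp
        then show ?thesis by simp
      qed
      then show "x [^] p \<in> {g \<in> carrier G. \<delta> g \<in> adic p (Suc n)}"
        using xc by (auto intro: adicI)
      fix y assume y: "y \<in> carrier G"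
      have "ad (\<delta> x) (\<delta> y) \<in> adic p (Suc n)"
        using ad_adic[OF d delta_adic_1[OF y]] by simp
      then have "\<delta> (comm x y) \<in> adic p (Suc n)"
        using xc y by (simp add: delta_comm adic_add adic_ideal)
      then show "comm x y \<in> {g \<in> carrier G. \<delta> g \<in> adic p (Suc n)}" using xc y by simp
    qed (use False in simp)
    then show ?thesis using Suc.prems by blast
  qed (use Suc.prems delta_adic_1 in simp)
qed simp

subsection \<open>The kernel of the Magnus filtration\<close>

text \<open>The empty list leaves room for the exponents that successive eliminations
  record.\<close>

definition gens :: "('a \<times> nat list) set" where "gens = B \<times> {[]}"

abbreviation free_lie :: "nat \<Rightarrow> 'a \<Rightarrow> 'a ncps \<Rightarrow> bool" where
  "free_lie \<equiv> lie_rel gens (\<lambda>_. 1) fst (letter \<circ> fst)"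

lemma lie_gens_gens: "lie_gens 1 gens (\<lambda>_. 1) fst"
  using B by (auto simp: lie_gens_def gens_def)

text \<open>Coefficients at words starting with the letter of \<open>y\<close> single out
  \<open>f y\<close>.\<close>

lemma right_indep_gens: "right_indep p gens (letter \<circ> fst)"
  unfolding right_indep_def
proof (intro allI impI ballI)
  fix Z :: "('a \<times> nat list) set" and f :: "'a \<times> nat list \<Rightarrow> 'a ncps" and y
  assume Z: "finite Z" "Z \<subseteq> gens" and y: "y \<in> Z"
    and sum: "(\<Sum>y\<in>Z. (letter \<circ> fst) y * f y) \<in> p_multiples p"
  have "wcoeff (\<Sum>z\<in>Z. (letter \<circ> fst) z * f z) (fst y # u) = wcoeff (f y) u" for u
  proof -
    have "wcoeff (\<Sum>z\<in>Z. (letter \<circ> fst) z * f z) (fst y # u)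
        = (\<Sum>z\<in>Z. if fst y = fst z then wcoeff (f z) u else 0)"
      by (simp add: wcoeff_letter_mult)
    also have "\<dots> = (\<Sum>z\<in>Z. if z = y then wcoeff (f z) u else 0)"
    proof (rule sum.cong[OF refl])
      fix z assume "z \<in> Z"
      then have "z \<in> B \<times> {[]}" "y \<in> B \<times> {[]}" using Z(2) y unfolding gens_def by blast+
      then have "snd z = []" "snd y = []" by auto
      then have "fst y = fst z \<longleftrightarrow> z = y" by (metis prod_eq_iff)
      then show "(if fst y = fst z then wcoeff (f z) u else 0) = (if z = y then wcoeff (f z) u else 0)"
        by simp
    qed
    finally show ?thesis using Z(1) y by simp
  qed
  then show "f y \<in> p_multiples p" using sum unfolding p_multiples_def mem_Collect_eq by metis
qed

lemma free_lie_injective: "free_lie m g e \<Longrightarrow> e \<in> p_multiples p \<Longrightarrow> g \<in> L (Suc m)"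
  by (rule lie_rel_injective[OF right_indep_gens lie_gens_gens]) (use B in \<open>auto simp: gens_def\<close>)

lemma free_lie_mem: "free_lie m g e \<Longrightarrow> m \<ge> 1 \<and> g \<in> L m"
  by (rule lie_rel_mem[OF lie_gens_gens])

text \<open>So \<open>e\<close> is the leading form of \<open>g\<close> in weight \<open>m\<close>,
  and no power of \<open>p\<close> enters it: it lives in length exactly \<open>m\<close>. This
  later separates Lie elements from \<open>p\<close>-th powers.\<close>

lemma free_lie_delta:
  assumes "free_lie m g e"
  shows "\<delta> g - e \<in> adic p (Suc m) \<and> (\<forall>u. length u \<noteq> m \<longrightarrow> wcoeff e u = 0)"
  using assms
proof (induction rule: lie_rel.induct)
  case (gen y)
  then show ?case by (auto simp: gens_def delta_B wcoeff_letter)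
next
  case (zero m g)
  then show ?case using L_adic[of "Suc m" g] by simp
next
  case (mult m g e h f)
  note mem = free_lie_mem[OF mult.hyps(1)] free_lie_mem[OF mult.hyps(2)]
  have "\<delta> g * \<delta> h \<in> adic p (m + m)" using mem L_adic by (intro adic_mult) auto
  then have "\<delta> g * \<delta> h \<in> adic p (Suc m)" by (rule adic_mono) (use mem in simp)
  then have "(\<delta> g - e) + (\<delta> h - f) + \<delta> g * \<delta> h \<in> adic p (Suc m)"
    using mult.IH by (intro adic_add) auto
  then show ?case using mem mult.IH L_carrier[of g m] L_carrier[of h m] by (simp add: delta_mult algebra_simps)
next
  case (inv m g e)
  note mem = free_lie_mem[OF inv.hyps]
  have g: "g \<in> carrier G" "inv g \<in> L m" using mem L_carrier L_inv by auto
  have "\<delta> g * \<delta> (inv g) \<in> adic p (m + m)" using mem g L_adic by (intro adic_mult) auto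
  then have "\<delta> g * \<delta> (inv g) \<in> adic p (Suc m)" by (rule adic_mono) (use mem in simp)
  from adic_diff[OF adic_uminus[OF conjunct1[OF inv.IH]] this]
  have "- (\<delta> g - e) - \<delta> g * \<delta> (inv g) \<in> adic p (Suc m)" .
  moreover have "\<delta> (inv g) - - e = - (\<delta> g - e) - \<delta> g * \<delta> (inv g)"
    by (subst delta_inv[OF g(1)]) (simp add: algebra_simps)
  ultimately have "\<delta> (inv g) - - e \<in> adic p (Suc m)" by (simp only:)
  then show ?case using inv.IH by simp
next
  case (bracket m g e n h f)
  note mem = free_lie_mem[OF bracket.hyps(1)] free_lie_mem[OF bracket.hyps(2)]
  have c: "g \<in> carrier G" "h \<in> carrier G" "\<delta> g \<in> adic p m" "\<delta> h \<in> adic p n"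
    using mem L_carrier L_adic by auto
  have e: "e \<in> adic p m"
  proof (rule adicI)
    fix u show "int p ^ (m - length u) dvd wcoeff e u"
      using bracket.IH(1) by (cases "length u = m") auto
  qed
  have 1: "ad (\<delta> g - e) (\<delta> h) \<in> adic p (Suc m + n)" "ad e (\<delta> h - f) \<in> adic p (m + Suc n)"
    using bracket.IH c e by (intro ad_adic; simp)+
  have "\<delta> (comm g h) - ad (\<delta> g) (\<delta> h) \<in> adic p (Suc (m + n))"
    using c by (intro delta_comm_adic)
  then have "(\<delta> (comm g h) - ad (\<delta> g) (\<delta> h)) + (ad (\<delta> g - e) (\<delta> h) + ad e (\<delta> h - f)) \<in> adic p (Suc (m + n))"
    using 1 by (intro adic_add) auto
  moreover have "(\<delta> (comm g h) - ad (\<delta> g) (\<delta> h)) + (ad (\<delta> g - e) (\<delta> h) + ad e (\<delta> h - f))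
      = \<delta> (comm g h) - ad e f"
    by (simp add: ad_def algebra_simps)
  ultimately have diff: "\<delta> (comm g h) - ad e f \<in> adic p (Suc (m + n))" by (simp only:)
  have "word_conv a b u = 0"
    if "\<And>v. length v \<noteq> m' \<Longrightarrow> a v = 0" "\<And>v. length v \<noteq> n' \<Longrightarrow> b v = 0" "length u \<noteq> m' + n'"
    for a b :: "'a list \<Rightarrow> int" and u m' n'
    using that
  proof (induction u arbitrary: a m')
    case Nil
    then show ?case by (cases "m' = 0") auto
  next
    case (Cons x u)
    have "word_conv (\<lambda>v. a (x # v)) b u = 0"
    proof (cases m')
      case 0
      then have "(\<lambda>v. a (x # v)) = (\<lambda>v. 0)" using Cons.prems(1) by auto
      then show ?thesis by (simp add: word_conv_zero_left)
    next
      case (Suc k)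
      show ?thesis using Cons.prems by (intro Cons.IH[of k]) (auto simp: Suc)
    qed
    moreover have "a [] * b (x # u) = 0" using Cons.prems by (cases "m' = 0") auto
    ultimately show ?case by simp
  qed
  note homogeneous = this
  have "wcoeff (ad e f) u = 0" if "length u \<noteq> m + n" for u
    using homogeneous[of m "wcoeff e" n "wcoeff f" u] homogeneous[of n "wcoeff f" m "wcoeff e" u]
      bracket.IH that by (simp add: ad_def wcoeff_mult add.commute)
  with diff show ?case by blast
qed

lemma free_lie_1: "g \<in> carrier G \<Longrightarrow> \<exists>e. free_lie 1 g e"
proof (rule generate_induct[where P = "\<lambda>g. \<exists>e. free_lie 1 g e"])
  show "subgroup {g \<in> carrier G. \<exists>e. free_lie 1 g e} G"
  proof
    show "\<one> \<in> {g \<in> carrier G. \<exists>e. free_lie 1 g e}"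
      using lie_rel.zero[OF order.refl L_one] by blast
  qed (auto intro: lie_rel.mult lie_rel.inv)
next
  fix b assume "b \<in> B"
  then show "\<exists>e. free_lie 1 b e"
    using lie_rel.gen[of "(b, [])" gens "\<lambda>_. 1" fst "letter \<circ> fst"] by (auto simp: gens_def)
qed

text \<open>In length \<open>m\<close>, where \<open>e\<close> lives, \<open>adic p (Suc m)\<close>
  asks for exactly one factor \<open>p\<close>.\<close>

lemma free_lie_p_multiples:
  assumes "free_lie m g e" "e \<in> adic p (Suc m)"
  shows "g \<in> L (Suc m)"
proof (rule free_lie_injective[OF assms(1)])
  have "int p dvd wcoeff e u" for u
    using adicD[OF assms(2), of u] free_lie_delta[OF assms(1)] by (cases "length u = m") auto
  then show "e \<in> p_multiples p" by (simp add: p_multiples_def)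
qed

text \<open>\<open>L (Suc i)\<close> is central modulo \<open>L (Suc (Suc i))\<close>, so the
  collection formula of class two holds in the quotient.\<close>

lemma cl_pow_mult:
  assumes "x \<in> carrier G" "y \<in> carrier G" "comm y x \<in> L (Suc i)"
  shows "\<exists>s::nat. cl (Suc (Suc i)) ((x \<otimes> y) [^] p) = cl (Suc (Suc i)) (comm y x [^] s \<otimes> (x [^] p \<otimes> y [^] p))"
proof -
  let ?n = "Suc (Suc i)"
  interpret h: group_hom G "G Mod L ?n" "cl ?n" by (rule cl_hom)
  have comm: "h.H.comm (cl ?n y) (cl ?n x) = cl ?n (comm y x)"
    using assms by (simp only: h.H.comm_def comm_def h.hom_mult h.hom_inv inv_closed m_closed)
  have swap: "cl ?n (comm y x \<otimes> z) = cl ?n (z \<otimes> comm y x)" if "z \<in> carrier G" for z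
    using assms that by (intro cl_comm_swap[of "Suc i" 1]) auto
  have "\<exists>s::nat. (cl ?n x \<otimes>\<^bsub>G Mod L ?n\<^esub> cl ?n y) [^]\<^bsub>G Mod L ?n\<^esub> p
      = h.H.comm (cl ?n y) (cl ?n x) [^]\<^bsub>G Mod L ?n\<^esub> s \<otimes>\<^bsub>G Mod L ?n\<^esub>
        (cl ?n x [^]\<^bsub>G Mod L ?n\<^esub> p \<otimes>\<^bsub>G Mod L ?n\<^esub> cl ?n y [^]\<^bsub>G Mod L ?n\<^esub> p)"
    using swap[OF assms(1)] swap[OF assms(2)] assms
    by (intro h.H.power_mult_central_comm)
      (simp_all only: comm h.hom_closed comm_closed flip: h.hom_mult)
  then show ?thesis
    using assms
    by (simp only: comm h.hom_nat_pow[symmetric] h.hom_mult[symmetric] comm_closed m_closed nat_pow_closed)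
qed

text \<open>Modulo the next term, \<open>L (i + 1)\<close> consists of \<open>p\<close>-th powers from \<open>L i\<close> times Lie elements of
  weight \<open>i + 1\<close>; for \<open>p = 2\<close> and \<open>i = 1\<close> the Lie part absorbs the failure of squaring to be
  additive.\<close>
definition power_lie :: "nat \<Rightarrow> 'a set" where
  "power_lie i = {g \<in> carrier G. \<exists>k\<in>L i. \<exists>c e. free_lie (Suc i) c e \<and>
     cl (Suc (Suc i)) g = cl (Suc (Suc i)) (k [^] p \<otimes> c)}"

lemma power_lieI:
  "k \<in> L i \<Longrightarrow> free_lie (Suc i) c e \<Longrightarrow> g \<in> carrier G \<Longrightarrow>
    cl (Suc (Suc i)) g = cl (Suc (Suc i)) (k [^] p \<otimes> c) \<Longrightarrow> g \<in> power_lie i"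
  unfolding power_lie_def by blast

lemma free_lie_zero: "g \<in> L (Suc (Suc i)) \<Longrightarrow> free_lie (Suc i) g 0"
  by (rule lie_rel.zero) auto

text \<open>For \<open>i = 1\<close> both entries are Lie elements of weight 1. For
  \<open>i \<ge> 2\<close> the commutator has weight \<open>2 * i \<ge> i + 2\<close> and is
  trivial.\<close>

lemma free_lie_comm:
  assumes "i \<ge> 1" "k \<in> L i" "k' \<in> L i"
  shows "\<exists>e. free_lie (Suc i) (comm k k') e"
proof (cases "i = 1")
  case True
  obtain e e' where "free_lie 1 k e" "free_lie 1 k' e'" 
    using free_lie_1[OF L_carrier[OF assms(2)]] free_lie_1[OF L_carrier[OF assms(3)]] by blast
  from lie_rel.bracket[OF this] show ?thesis using True by auto
next
  case False
  have "comm k k' \<in> L (i + i)" using assms by (intro L_comm)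
  then have "comm k k' \<in> L (Suc (Suc i))" by (rule L_monoD) (use assms False in simp)
  then show ?thesis using free_lie_zero by blast
qed

lemma free_lie_nat_pow: "free_lie m g e \<Longrightarrow> \<exists>e'. free_lie m (g [^] (s::nat)) e'"
  using lie_rel_int_pow[OF lie_gens_gens, of "letter \<circ> fst" m g e "int s"] by (auto simp: int_pow_int)

text \<open>\<open>p\<close>-th powers multiply up to a power of \<open>comm k' k\<close>, which is
  Lie of weight \<open>Suc i\<close> by \<open>free_lie_comm\<close>. Being central modulo the next
  term, it can be moved into the Lie factor.\<close>

lemma power_lie_subgroup:
  assumes i: "i \<ge> 1"
  shows "subgroup (power_lie i) G"
proof (rule subgroupI)
  let ?n = "Suc (Suc i)"
  show "power_lie i \<subseteq> carrier G" by (auto simp: power_lie_def)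
  show "power_lie i \<noteq> {}"
    using power_lieI[OF L_one free_lie_zero[OF L_one], of \<one> i] by auto
  have central: "cl ?n (c \<otimes> z) = cl ?n (z \<otimes> c)" if "c \<in> L (Suc i)" "z \<in> carrier G" for c z
    using that by (intro cl_comm_swap[of "Suc i" 1]) auto
  {
    fix g assume "g \<in> power_lie i"
    then obtain k c e where g: "g \<in> carrier G" "k \<in> L i" "free_lie (Suc i) c e"
      "cl ?n g = cl ?n (k [^] p \<otimes> c)" unfolding power_lie_def by blast
    have c: "c \<in> L (Suc i)" "c \<in> carrier G" "k \<in> carrier G"
      using free_lie_mem[OF g(3)] g(2) L_carrier by auto
    have "cl ?n (inv g) = cl ?n (inv (k [^] p \<otimes> c))" using g c by (intro cl_inv_cong) auto
    also have "\<dots> = cl ?n (inv c \<otimes> inv k [^] p)" using c by (simp add: inv_mult_group nat_pow_inv)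
    also have "\<dots> = cl ?n (inv k [^] p \<otimes> inv c)" using c by (intro central) (auto intro: L_inv)
    finally show "inv g \<in> power_lie i"
      using g c by (intro power_lieI[OF L_inv[OF g(2)] lie_rel.inv[OF g(3)]]) auto
  }
  fix g h assume "g \<in> power_lie i" "h \<in> power_lie i"
  then obtain k c e k' c' e' where g: "g \<in> carrier G" "k \<in> L i" "free_lie (Suc i) c e"
      "cl ?n g = cl ?n (k [^] p \<otimes> c)" 
    and h: "h \<in> carrier G" "k' \<in> L i" "free_lie (Suc i) c' e'"
      "cl ?n h = cl ?n (k' [^] p \<otimes> c')" unfolding power_lie_def by blast
  have c: "c \<in> L (Suc i)" "c \<in> carrier G" "k \<in> carrier G" "c' \<in> L (Suc i)" "c' \<in> carrier G" "k' \<in> carrier G"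
    using free_lie_mem[OF g(3)] g(2) free_lie_mem[OF h(3)] h(2) L_carrier by auto
  define t where "t = comm k' k"
  obtain f where f: "free_lie (Suc i) t f" unfolding t_def using free_lie_comm[OF i h(2) g(2)] by blast
  have t: "t \<in> L (Suc i)" "t \<in> carrier G" using free_lie_mem[OF f] L_carrier by auto
  obtain s :: nat where s: "cl ?n ((k \<otimes> k') [^] p) = cl ?n (t [^] s \<otimes> (k [^] p \<otimes> k' [^] p))"
    using cl_pow_mult[of k k' i] t c unfolding t_def by blast
  obtain f' where f': "free_lie (Suc i) (t [^] s) f'" using free_lie_nat_pow[OF f] by blast
  have ts: "inv (t [^] s) \<in> L (Suc i)" using free_lie_mem[OF f'] L_inv by blast
  have "cl ?n (g \<otimes> h) = cl ?n (k [^] p \<otimes> c \<otimes> (k' [^] p \<otimes> c'))"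
    using g h c by (intro cl_mult_cong) auto
  also have "\<dots> = cl ?n (k [^] p \<otimes> (c \<otimes> k' [^] p) \<otimes> c')" using c by (simp add: m_assoc)
  also have "\<dots> = cl ?n (k [^] p \<otimes> (k' [^] p \<otimes> c) \<otimes> c')"
    using c by (intro cl_mult_cong central refl) auto
  also have "\<dots> = cl ?n (inv (t [^] s) \<otimes> (t [^] s \<otimes> (k [^] p \<otimes> k' [^] p)) \<otimes> (c \<otimes> c'))"
    using c t by (simp add: m_assoc)
  also have "\<dots> = cl ?n (inv (t [^] s) \<otimes> (k \<otimes> k') [^] p \<otimes> (c \<otimes> c'))"
    using c t s by (intro cl_mult_cong refl) auto
  also have "\<dots> = cl ?n ((k \<otimes> k') [^] p \<otimes> inv (t [^] s) \<otimes> (c \<otimes> c'))"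
    using c t ts by (intro cl_mult_cong central refl) auto
  also have "\<dots> = cl ?n ((k \<otimes> k') [^] p \<otimes> (inv (t [^] s) \<otimes> (c \<otimes> c')))"
    using c t by (simp add: m_assoc)
  finally have "cl ?n (g \<otimes> h) = cl ?n ((k \<otimes> k') [^] p \<otimes> (inv (t [^] s) \<otimes> (c \<otimes> c')))" .
  then show "g \<otimes> h \<in> power_lie i"
    using g h by (intro power_lieI[OF L_mult[OF g(2) h(2)]
        lie_rel.mult[OF lie_rel.inv[OF f'] lie_rel.mult[OF g(3) h(3)]]]) auto
qed

lemma power_lie_cong:
  "h \<in> power_lie i \<Longrightarrow> g \<in> carrier G \<Longrightarrow> cl (Suc (Suc i)) g = cl (Suc (Suc i)) h \<Longrightarrow> g \<in> power_lie i"
  unfolding power_lie_def by auto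

text \<open>In the inductive step the critical generator is \<open>comm x y\<close> with
  \<open>x = k [^] p \<otimes> c\<close> modulo the next term. The part \<open>comm c y\<close> is a
  Lie element, and \<open>comm y (k [^] p)\<close> turns out to be \<open>a [^] p\<close> with
  \<open>a = comm y k\<close>, up to a Lie element.\<close>

lemma L_subset_power_lie:
  assumes "i \<ge> 1"
  shows "L (Suc i) \<subseteq> power_lie i"
  using assms
proof (induction i rule: nat_induct_at_least)
  case base
  show ?case
  proof (rule lower_p_series_least[OF _ power_lie_subgroup])
    fix x assume x: "x \<in> L 1"
    then show "x [^] p \<in> power_lie 1"
      using L_carrier[OF x] by (intro power_lieI[OF x free_lie_zero[OF L_one]]) auto
    fix y assume y: "y \<in> carrier G"
    then obtain e where "free_lie (Suc 1) (comm x y) e" using free_lie_comm[of 1 x y] x by auto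
    then show "comm x y \<in> power_lie 1"
      using L_carrier[OF x] y by (intro power_lieI[OF L_one]) auto
  qed auto
next
  case (Suc j)
  let ?n = "Suc (Suc (Suc j))"
  show ?case
  proof (rule lower_p_series_least[OF _ power_lie_subgroup])
    fix x assume x: "x \<in> L (Suc j)"
    then show "x [^] p \<in> power_lie (Suc j)"
      using L_carrier[OF x] by (intro power_lieI[OF x free_lie_zero[OF L_one]]) auto
    fix y assume y: "y \<in> carrier G"
    obtain k c e where k: "k \<in> L j" "free_lie (Suc j) c e"
      "cl (Suc (Suc j)) x = cl (Suc (Suc j)) (k [^] p \<otimes> c)"
      using Suc.IH x unfolding power_lie_def by blast
    have c: "c \<in> L (Suc j)" "c \<in> carrier G" "k \<in> carrier G" "k [^] p \<in> L (Suc j)" "x \<in> carrier G"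
      using free_lie_mem[OF k(2)] k(1) L_power[OF Suc.hyps k(1)] x L_carrier by auto
    have "cl ?n (comm x y) = cl ?n (comm (k [^] p \<otimes> c) y)"
      using c y k by (intro cl_comm_cong_left[of "Suc j" 1]) (auto intro: L_mult)
    also have "\<dots> = cl ?n (comm (k [^] p) y \<otimes> comm c y)"
      using c y by (intro cl_comm_mult_left[of "Suc j" 1]) auto
    finally have cl: "cl ?n (comm x y) = cl ?n (comm (k [^] p) y \<otimes> comm c y)" .
    obtain f where f: "free_lie 1 y f" using free_lie_1[OF y] by blast
    have cy: "comm c y \<in> power_lie (Suc j)"
      using lie_rel.bracket[OF k(2) f] c y by (intro power_lieI[OF L_one]) auto
    define a where "a = comm y k"
    \<comment> \<open>Conjugation by \<open>y\<close> sends \<open>k\<close> to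
      \<open>a \<otimes> k\<close>, so \<open>comm y (k [^] p)\<close> is
      \<open>(a \<otimes> k) [^] p\<close> divided by \<open>k [^] p\<close>. Collection leaves
      \<open>a [^] p\<close> and a power of \<open>t = comm k a\<close>.\<close>
    have "a \<in> L (1 + j)" unfolding a_def using k y Suc.hyps by (intro L_comm) auto
    then have a: "a \<in> L (Suc j)" "a \<in> carrier G" using L_carrier by auto
    define t where "t = comm k a"
    have t: "t \<in> L (j + Suc j)" unfolding t_def using k a Suc.hyps by (intro L_comm) auto
    \<comment> \<open>The weight \<open>2 * j + 1\<close> of \<open>t\<close> equals
      \<open>j + 2\<close> only for \<open>j = 1\<close>, where \<open>t\<close> is an iterated
      bracket of elements of weight 1; otherwise \<open>t\<close> is trivial.\<close>
    have t_lie: "\<exists>f. free_lie (Suc (Suc j)) t f"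
    proof (cases "j = 1")
      case True
      obtain e' where "free_lie 1 k e'" using free_lie_1[OF c(3)] by blast
      from lie_rel.bracket[OF this lie_rel.bracket[OF f this]] show ?thesis
        using True by (auto simp: t_def a_def)
    next
      case False
      have "t \<in> L ?n" using t by (rule L_monoD) (use Suc.hyps False in simp)
      then show ?thesis using free_lie_zero by blast
    qed
    have "t \<in> L (Suc (Suc j))" using t by (rule L_monoD) (use Suc.hyps in simp)
    then obtain s :: nat where s: "cl ?n ((a \<otimes> k) [^] p) = cl ?n (t [^] s \<otimes> (a [^] p \<otimes> k [^] p))"
      using cl_pow_mult[of a k "Suc j"] a c unfolding t_def by blast
    obtain f' where f': "free_lie (Suc (Suc j)) (t [^] s) f'" using t_lie free_lie_nat_pow by blast
    have ts: "t [^] s \<in> L (Suc (Suc j))" "t [^] s \<in> carrier G"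
      using free_lie_mem[OF f'] L_carrier by auto
    have "y \<otimes> k [^] (m::nat) \<otimes> inv y = (a \<otimes> k) [^] m" for m
    proof (induction m)
      case (Suc m)
      have "y \<otimes> k [^] Suc m \<otimes> inv y = (y \<otimes> k [^] m \<otimes> inv y) \<otimes> (y \<otimes> k \<otimes> inv y)"
        using y c by (simp add: m_assoc)
      also have "y \<otimes> k \<otimes> inv y = a \<otimes> k" using y c by (simp add: a_def free_simps)
      finally show ?case by (simp add: Suc)
    qed (use y in simp)
    then have "comm y (k [^] p) = (a \<otimes> k) [^] p \<otimes> inv (k [^] p)" using y c by (simp add: comm_def)
    then have "cl ?n (comm y (k [^] p)) = cl ?n (t [^] s \<otimes> (a [^] p \<otimes> k [^] p) \<otimes> inv (k [^] p))"
      using s a c ts by (simp only:, intro cl_mult_cong) auto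
    also have "\<dots> = cl ?n (t [^] s \<otimes> a [^] p)" using a c ts by (simp add: m_assoc)
    also have "\<dots> = cl ?n (a [^] p \<otimes> t [^] s)"
      using a ts by (intro cl_comm_swap[of "Suc (Suc j)" 1]) auto
    finally have "comm y (k [^] p) \<in> power_lie (Suc j)"
      using y c by (intro power_lieI[OF a(1) f']) auto
    then have "inv (comm y (k [^] p)) \<in> power_lie (Suc j)"
      by (rule subgroup.m_inv_closed[OF power_lie_subgroup, rotated]) simp
    then have "comm (k [^] p) y \<otimes> comm c y \<in> power_lie (Suc j)"
      using cy y c by (intro subgroup.m_closed[OF power_lie_subgroup]) (auto simp: inv_comm)
    from power_lie_cong[OF this _ cl] show "comm x y \<in> power_lie (Suc j)"
      using c y by simp
  qed auto
qed

text \<open>Write \<open>g\<close> as \<open>k [^] p \<otimes> c\<close> up to the next term. The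
  leading form \<open>e\<close> of \<open>c\<close> lives in length \<open>Suc i\<close>, so shorter
  words see only \<open>p * \<delta> k\<close>; this forces
  \<open>\<delta> k \<in> adic p (Suc i)\<close>, and the induction hypothesis disposes of
  \<open>k\<close>. Then \<open>c\<close> is left alone, and \<open>free_lie_p_multiples\<close>
  applies.\<close>

theorem magnus_kernel:
  assumes "i \<ge> 1" "g \<in> L i" "\<delta> g \<in> adic p (Suc i)"
  shows "g \<in> L (Suc i)"
  using assms
proof (induction i arbitrary: g rule: nat_induct_at_least)
  case base
  obtain e where e: "free_lie 1 g e" using free_lie_1[OF L_carrier[of g 1]] base by auto
  have "e \<in> adic p (Suc 1)"
    using adic_diff[OF _ conjunct1[OF free_lie_delta[OF e]], of "\<delta> g"] base by simp
  then show ?case using free_lie_p_multiples[OF e] by simp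
next
  case (Suc i)
  let ?n = "Suc (Suc i)"
  obtain k c e where k: "k \<in> L i" "free_lie (Suc i) c e" "cl ?n g = cl ?n (k [^] p \<otimes> c)"
    using L_subset_power_lie[OF Suc.hyps] Suc.prems(1) unfolding power_lie_def by blast
  have c: "c \<in> L (Suc i)" "c \<in> carrier G" "k \<in> carrier G" "k [^] p \<in> L (Suc i)" "g \<in> carrier G"
    using free_lie_mem[OF k(2)] k(1) L_power[OF Suc.hyps k(1)] Suc.prems(1) L_carrier by auto
  obtain z where z: "z \<in> L ?n" "g = z \<otimes> (k [^] p \<otimes> c)"
    using cl_decomp[OF k(3)] c by blast
  have zc: "z \<in> carrier G" "\<delta> z \<in> adic p ?n" using z L_carrier L_adic[of ?n z] by auto
  have "\<delta> (k [^] p) * \<delta> c \<in> adic p (Suc i + Suc i)"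
    using c L_adic by (intro adic_mult) auto
  then have kc: "\<delta> (k [^] p) * \<delta> c \<in> adic p ?n" by (rule adic_mono) simp
  have "\<delta> g = \<delta> z + \<delta> (k [^] p \<otimes> c) + \<delta> z * \<delta> (k [^] p \<otimes> c)"
    unfolding z(2) using zc c by (intro delta_mult) auto
  also have "\<delta> (k [^] p \<otimes> c) = \<delta> (k [^] p) + \<delta> c + \<delta> (k [^] p) * \<delta> c"
    using c by (intro delta_mult) auto
  finally have eq: "\<delta> (k [^] p) + e = \<delta> g - (\<delta> z + \<delta> z * \<delta> (k [^] p \<otimes> c)) - \<delta> (k [^] p) * \<delta> c - (\<delta> c - e)"
    using c by (simp add: delta_mult)
  have sum: "\<delta> (k [^] p) + e \<in> adic p ?n"
    unfolding eq
    using adic_diff[OF adic_diff[OF adic_diff[OF Suc.prems(2) adic_add[OF zc(2) adic_ideal[OF zc(2)]]] kc]]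
      free_lie_delta[OF k(2)] by blast
  have "\<delta> k \<in> adic p (Suc i)"
  proof (rule adicI)
    fix u
    show "int p ^ (Suc i - length u) dvd wcoeff (\<delta> k) u"
    proof (cases "length u \<le> i")
      case True
      have "wcoeff e u = 0" using True free_lie_delta[OF k(2)] by auto
      then have 1: "int p ^ (i + 2 - length u) dvd wcoeff (\<delta> (k [^] p)) u"
        using adicD[OF sum, of u] by simp
      \<comment> \<open>For \<open>i = 1\<close> the word has length at most 1, which is less than
        \<open>p\<close>, so the exceptional term of \<open>wcoeff_power_p\<close> is not
        met.\<close>
      have "i \<ge> 2 \<or> length u < p"
        using True Suc.hyps prime_ge_2_nat[OF p] by linarith
      then have "int p ^ (i + 2 - length u) dvd wcoeff (\<delta> (k [^] p)) u - int p * wcoeff (\<delta> k) u"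
        using c k Suc.hyps L_adic by (intro delta_pow_p) auto
      from dvd_diff[OF 1 this] have "int p ^ (i + 2 - length u) dvd int p * wcoeff (\<delta> k) u" by simp
      moreover have "i + 2 - length u = Suc (Suc i - length u)" using True by simp
      ultimately show ?thesis using prime_gt_0_nat[OF p] by simp
    qed simp
  qed
  then have "k \<in> L (Suc i)" using Suc.IH k(1) by blast
  then have kp: "k [^] p \<in> L ?n" by (intro L_power) auto
  then have "(\<delta> (k [^] p) + e) - \<delta> (k [^] p) \<in> adic p ?n"
    using adic_diff[OF sum L_adic[OF _ kp]] by simp
  then have "c \<in> L ?n" using free_lie_p_multiples[OF k(2)] by simp
  then show ?case unfolding z(2) using z(1) kp by (intro L_mult)
qed

end

subsection \<open>Counting in finite additive groups of functions on words\<close>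

definition add_subgroup :: "'m :: ab_group_add set \<Rightarrow> bool" where
  "add_subgroup H \<longleftrightarrow> finite H \<and> 0 \<in> H \<and> (\<forall>x\<in>H. \<forall>y\<in>H. x - y \<in> H)"

lemma add_subgroup_diff: "add_subgroup H \<Longrightarrow> x \<in> H \<Longrightarrow> y \<in> H \<Longrightarrow> x - y \<in> H"
  by (simp add: add_subgroup_def)

lemma add_subgroup_add:
  assumes "add_subgroup H" "x \<in> H" "y \<in> H"
  shows "x + y \<in> H"
proof -
  have "0 - y \<in> H" using assms unfolding add_subgroup_def by blast
  then have "x - (0 - y) \<in> H" using assms unfolding add_subgroup_def by blast
  then show ?thesis by simp
qed

lemma add_subgroup_card_pos: "add_subgroup H \<Longrightarrow> card H \<ge> 1"
  unfolding add_subgroup_def by (metis One_nat_def Suc_leI card_gt_0_iff empty_iff)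

lemma add_subgroup_image:
  assumes "add_subgroup H" "\<And>x y. f (x - y) = f x - f y"
  shows "add_subgroup (f ` H :: 'n :: ab_group_add set)"
proof -
  have "f 0 = 0" using assms(2)[of 0 0] by simp
  moreover have "f x - f y \<in> f ` H" if "x \<in> H" "y \<in> H" for x y
    using that assms by (metis add_subgroup_diff imageI)
  ultimately show ?thesis
    using assms(1) unfolding add_subgroup_def by (auto intro: rev_image_eqI)
qed

lemma card_image_kernel:
  fixes f :: "'m :: ab_group_add \<Rightarrow> 'n :: ab_group_add"
  assumes H: "add_subgroup H" and f: "\<And>x y. f (x - y) = f x - f y"
  shows "card H = card (f ` H) * card {x \<in> H. f x = 0}"
proof -
  have fin: "finite H" using H by (simp add: add_subgroup_def)
  have "card {x \<in> H. f x = y} = card {x \<in> H. f x = 0}" if y: "y \<in> f ` H" for y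
  proof -
    obtain z where z: "z \<in> H" "y = f z" using y by blast
    have "f (x + z) = f x + f z" for x using f[of "x + z" z] by (simp add: algebra_simps)
    then have "bij_betw (\<lambda>x. x - z) {x \<in> H. f x = y} {x \<in> H. f x = 0}"
      using z f add_subgroup_add[OF H _ z(1)] add_subgroup_diff[OF H _ z(1)]
      by (intro bij_betw_byWitness[where f' = "\<lambda>x. x + z"]) auto
    then show ?thesis by (rule bij_betw_same_card)
  qed
  moreover have "card H = (\<Sum>y\<in>f ` H. card {x \<in> H. f x = y})"
    using sum.image_gen[OF fin, of "\<lambda>_. 1 :: nat" f] by simp
  ultimately show ?thesis by simp
qed

text \<open>The commutator of \<open>e\<close> with the letter \<open>x\<close> in the free associative algebra. It only shifts
  words, so the coefficients may lie in any abelian group.\<close>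
definition brk :: "'x \<Rightarrow> ('x list \<Rightarrow> 'm :: ab_group_add) \<Rightarrow> 'x list \<Rightarrow> 'm" where
  "brk x e u = (if u \<noteq> [] \<and> last u = x then e (butlast u) else 0)
     - (if u \<noteq> [] \<and> hd u = x then e (tl u) else 0)"

lemma brk_diff: "brk x (e - e') = brk x e - brk x e'"
  by (auto simp: brk_def fun_eq_iff)

text \<open>Evaluated at \<open>u @ [x]\<close>, the hypothesis gives \<open>e u = 0\<close> unless
  \<open>u\<close> starts with \<open>x\<close>, in which case that letter may be rotated to the
  end. Repeating this brings another letter to the front, except on powers of
  \<open>x\<close>.\<close>

lemma brk_eq_0:
  assumes "brk x e = 0" "\<And>n. e (replicate n x) = 0"
  shows "e = 0"
proof
  fix u
  show "e u = 0 u"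
  proof (induction "length (takeWhile ((=) x) u)" arbitrary: u rule: less_induct)
    case less
    have "brk x e (u @ [x]) = 0" by (simp add: assms(1))
    then have eq: "e u = (if hd (u @ [x]) = x then e (tl (u @ [x])) else 0)"
      by (simp add: brk_def)
    show ?case
    proof (cases u)
      case Nil
      then show ?thesis using assms(2)[of 0] by simp
    next
      case (Cons y v)
      show ?thesis
      proof (cases "set u \<subseteq> {x}")
        case True
        then have "u = replicate (length u) x" by (metis replicate_length_same singletonD subsetD)
        then show ?thesis using assms(2) by (metis zero_fun_apply)
      next
        case False
        show ?thesis
        proof (cases "y = x")
          case True
          then obtain z where z: "z \<in> set v" "z \<noteq> x" using False Cons by auto
          then have "takeWhile ((=) x) (v @ [x]) = takeWhile ((=) x) v"
            by (intro takeWhile_append1) auto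
          then have "e (v @ [x]) = 0" using less[of "v @ [x]"] True Cons by simp
          then show ?thesis using eq Cons True by simp
        qed (use eq Cons in simp)
      qed
    qed
  qed
qed

text \<open>The values at \<open>u @ [b]\<close> and \<open>u @ [c]\<close> express
  \<open>e u\<close> and \<open>e' u\<close> through words with the first letter of \<open>u\<close>
  removed and \<open>b\<close> or \<open>c\<close> appended; both are 0 if \<open>u\<close> starts
  with neither \<open>b\<close> nor \<open>c\<close>. The number of letters before the first
  \<open>a\<close> decreases until \<open>a\<close> comes to the front.\<close>

lemma brk_sum_eq_0:
  assumes "a \<noteq> b" "a \<noteq> c" "b \<noteq> c" "brk b e + brk c e' = 0"
    and "\<And>u. a \<notin> set u \<Longrightarrow> e u = 0" "\<And>u. a \<notin> set u \<Longrightarrow> e' u = 0"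
  shows "e = 0 \<and> e' = 0"
proof -
  have "e u = 0 \<and> e' u = 0" for u
  proof (induction "length (takeWhile ((\<noteq>) a) u)" arbitrary: u rule: less_induct)
    case less
    have "(brk b e + brk c e') (u @ [b]) = 0" "(brk b e + brk c e') (u @ [c]) = 0"
      by (simp_all only: assms(4) zero_fun_apply)
    then have eq: "e u = (if hd (u @ [b]) = b then e (tl (u @ [b])) else 0) +
        (if hd (u @ [b]) = c then e' (tl (u @ [b])) else 0)"
      "e' u = (if hd (u @ [c]) = b then e (tl (u @ [c])) else 0) +
        (if hd (u @ [c]) = c then e' (tl (u @ [c])) else 0)"
      using assms(3) by (auto simp: brk_def algebra_simps split: if_splits)
    show ?case
    proof (cases "a \<in> set u")
      case True
      then obtain y v where u: "u = y # v" by (cases u) auto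
      show ?thesis
      proof (cases "y = a")
        case False
        then have "a \<in> set v" using True u by auto
        then have "takeWhile ((\<noteq>) a) (v @ [z]) = takeWhile ((\<noteq>) a) v" for z
          by (intro takeWhile_append1) auto
        then have "e (v @ [z]) = 0 \<and> e' (v @ [z]) = 0" for z
          using less[of "v @ [z]"] False u by simp
        then show ?thesis using eq u by simp
      qed (use eq u assms in simp)
    qed (use assms in auto)
  qed
  then show ?thesis by (auto simp: fun_eq_iff)
qed

definition part :: "('x list \<Rightarrow> nat) \<Rightarrow> nat \<Rightarrow> ('x list \<Rightarrow> 'm :: ab_group_add) \<Rightarrow> 'x list \<Rightarrow> 'm" where
  "part d k e u = (if d u = k then e u else 0)"

lemma part_diff: "part d k (e - e') = part d k e - part d k e'"
  by (auto simp: part_def fun_eq_iff)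

text \<open>Length and the number of occurrences of a fixed letter are the two gradings
  used.\<close>

definition graded_by :: "('x list \<Rightarrow> nat) \<Rightarrow> 'x \<Rightarrow> nat \<Rightarrow> bool" where
  "graded_by d x j \<longleftrightarrow> (\<forall>v. d (v @ [x]) = d v + j \<and> d (x # v) = d v + j)"

lemma part_brk:
  assumes "graded_by d x j"
  shows "part d (k + j) (brk x e) = brk x (part d k e)"
proof
  fix u
  have "d u = d (butlast u) + j" if "u \<noteq> []" "last u = x"
    using assms that unfolding graded_by_def by (metis append_butlast_last_id)
  moreover have "d u = d (tl u) + j" if "u \<noteq> []" "hd u = x"
    using assms that unfolding graded_by_def by (metis list.collapse)
  ultimately show "part d (k + j) (brk x e) u = brk x (part d k e) u"
    by (auto simp: part_def brk_def)
qed

text \<open>\<open>W\<close> need not contain the homogeneous components of its elements. Its graded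
  pieces are therefore the lowest-degree components along this filtration.\<close>

definition part_ge :: "('x list \<Rightarrow> nat) \<Rightarrow> nat \<Rightarrow> ('x list \<Rightarrow> 'm :: ab_group_add) set \<Rightarrow> ('x list \<Rightarrow> 'm) set" where
  "part_ge d k W = {e \<in> W. \<forall>u. d u < k \<longrightarrow> e u = 0}"

lemma add_subgroup_part_ge: "add_subgroup W \<Longrightarrow> add_subgroup (part_ge d k W)"
  unfolding add_subgroup_def part_ge_def by (auto intro: finite_subset)

lemma part_ge_0: "part_ge d 0 W = W"
  by (simp add: part_ge_def)

lemma card_part_ge:
  assumes "add_subgroup W"
  shows "card (part_ge d k W) = card (part d k ` part_ge d k W) * card (part_ge d (Suc k) W)"
proof -
  have "{e \<in> part_ge d k W. part d k e = 0} = part_ge d (Suc k) W"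
    by (auto simp: part_ge_def part_def fun_eq_iff less_Suc_eq)
  then show ?thesis
    using card_image_kernel[of "part_ge d k W" "part d k"] add_subgroup_part_ge[OF assms, of d k]
    by (simp add: part_diff)
qed

lemma brk_part_ge:
  assumes "graded_by d x j" "e \<in> part_ge d k W" "brk x e \<in> N"
  shows "brk x e \<in> part_ge d (k + j) N"
proof -
  have "brk x e u = 0" if "d u < k + j" for u
  proof -
    have "part d i e = 0" if "i < k" for i
      using assms(2) that by (auto simp: part_ge_def part_def fun_eq_iff)
    then have *: "part d (i + j) (brk x e) = 0" if "i < k" for i
      using that part_brk[OF assms(1), of i e] by (simp add: brk_def fun_eq_iff)
    show ?thesis
    proof (cases "j \<le> d u")
      case True
      have "part d (d u) (brk x e) = 0" using *[of "d u - j"] True \<open>d u < k + j\<close> by simp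
      then show ?thesis by (simp add: part_def fun_eq_iff) metis
    next
      case False
      have "\<not> (u \<noteq> [] \<and> last u = x)" "\<not> (u \<noteq> [] \<and> hd u = x)"
        using False assms(1) unfolding graded_by_def
        by (metis append_butlast_last_id le_add2, metis list.collapse le_add2)
      then show ?thesis by (auto simp: brk_def)
    qed
  qed
  then show ?thesis using assms(3) by (simp add: part_ge_def)
qed

text \<open>Grade by the number of occurrences of \<open>a\<close>, with graded pieces of dimensions \<open>\<alpha>\<^sub>k\<close> for \<open>W\<close>
  and \<open>\<nu>\<^sub>k\<close> for \<open>N\<close>. Bracketing with \<open>a\<close> is injective, so \<open>\<nu>\<^sub>k \<ge> \<alpha>\<^sub>k\<^sub>-\<^sub>1\<close>; on words containing \<open>a\<close>
  bracketing with \<open>b\<close> and \<open>c\<close> is jointly injective, so \<open>\<nu>\<^sub>k \<ge> 2 \<alpha>\<^sub>k\<close> for \<open>k > 0\<close>; and \<open>\<nu>\<^sub>0 \<ge> \<alpha>\<^sub>0\<close>.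
  Averaging the two bounds gives the factor 3/2.\<close>
lemma card_brk_le:
  fixes W N :: "('x list \<Rightarrow> 'm :: ab_group_add) set"
  assumes abc: "a \<noteq> b" "a \<noteq> c" "b \<noteq> c" and W: "add_subgroup W" and N: "add_subgroup N"
    and brk: "\<And>e x. e \<in> W \<Longrightarrow> x \<in> {a, b, c} \<Longrightarrow> brk x e \<in> N"
    and pure: "\<And>e n. e \<in> W \<Longrightarrow> e (replicate n a) = 0 \<and> e (replicate n b) = 0"
  shows "card W ^ 3 \<le> card N ^ 2"
proof -
  define d where "d = (\<lambda>u. count_list u a)"
  have da: "graded_by d a 1" and db: "graded_by d b 0" and dc: "graded_by d c 0"
    using abc by (auto simp: graded_by_def d_def)
  let ?W = "\<lambda>k. part_ge d k W" and ?N = "\<lambda>k. part_ge d k N"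
  let ?G = "\<lambda>k. part d k ` ?W k" and ?H = "\<lambda>k. part d k ` ?N k"
  have fin: "finite (?G k)" "finite (?H k)" for k
    using add_subgroup_part_ge[OF W, of d k] add_subgroup_part_ge[OF N, of d k]
    by (auto simp: add_subgroup_def)
  have G: "add_subgroup (?G k)" and H: "add_subgroup (?H k)" for k
    by (intro add_subgroup_image add_subgroup_part_ge W N part_diff)+
  have brk_0: "brk x (0 :: 'x list \<Rightarrow> 'm) = 0" for x by (auto simp: brk_def fun_eq_iff)
  have inj_brk: "inj_on (brk x) (?G k)" if "\<And>g n. g \<in> ?G k \<Longrightarrow> g (replicate n x) = 0" for x k
  proof (rule inj_onI)
    fix g g' assume g: "g \<in> ?G k" "g' \<in> ?G k" "brk x g = brk x g'"
    then have "brk x (g - g') = 0" by (simp add: brk_diff)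
    moreover have "(g - g') (replicate n x) = 0" for n
      using that[OF g(1), of n] that[OF g(2), of n] by simp
    ultimately have "g - g' = 0" by (rule brk_eq_0)
    then show "g = g'" by simp
  qed
  have brk_G: "brk x g \<in> ?H (k + j)" if "g \<in> ?G k" "x \<in> {a, b, c}" "graded_by d x j" for g x j k
  proof -
    obtain e where e: "e \<in> ?W k" "g = part d k e" using \<open>g \<in> ?G k\<close> by blast
    have "brk x e \<in> N" using e(1) that(2) by (intro brk) (auto simp: part_ge_def)
    then have "brk x e \<in> ?N (k + j)" by (rule brk_part_ge[OF that(3) e(1)])
    then show ?thesis using part_brk[OF that(3), of k e] e(2) by (metis imageI)
  qed
  have H_a: "card (?G k) \<le> card (?H (Suc k))" for k
  proof (rule card_inj_on_le[OF inj_brk])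
    show "g (replicate n a) = 0" if "g \<in> ?G k" for g n
      using that pure by (auto simp: part_def part_ge_def)
    show "brk a ` ?G k \<subseteq> ?H (Suc k)" using brk_G[OF _ _ da] by auto
  qed (rule fin)
  have H_0: "card (?G 0) \<le> card (?H 0)"
  proof (rule card_inj_on_le[OF inj_brk])
    show "g (replicate n b) = 0" if "g \<in> ?G 0" for g n
      using that pure by (auto simp: part_def part_ge_def)
    show "brk b ` ?G 0 \<subseteq> ?H 0" using brk_G[OF _ _ db] by auto
  qed (rule fin)
  have H_bc: "card (?G k) ^ 2 \<le> card (?H k)" if "k \<ge> 1" for k
  proof -
    have supp: "g u = 0" if "g \<in> ?G k" "a \<notin> set u" for g u
      using that \<open>k \<ge> 1\<close> by (auto simp: part_def d_def count_notin)
    have "inj_on (\<lambda>(g, h). brk b g + brk c h) (?G k \<times> ?G k)"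
    proof (rule inj_onI)
      fix q q' assume q: "q \<in> ?G k \<times> ?G k" "q' \<in> ?G k \<times> ?G k"
        "(case q of (g, h) \<Rightarrow> brk b g + brk c h) = (case q' of (g, h) \<Rightarrow> brk b g + brk c h)"
      obtain g h g' h' where gh: "q = (g, h)" "q' = (g', h')" by fastforce
      have *: "g \<in> ?G k" "h \<in> ?G k" "g' \<in> ?G k" "h' \<in> ?G k"
        "brk b g + brk c h = brk b g' + brk c h'"
        using q by (simp_all add: gh)
      have "brk b (g - g') + brk c (h - h') = 0"
        using *(5) by (simp add: brk_diff algebra_simps)
      then have "g - g' = 0 \<and> h - h' = 0"
        using supp[OF *(1)] supp[OF *(2)] supp[OF *(3)] supp[OF *(4)]
        by (intro brk_sum_eq_0[OF abc]) simp_all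
      then show "q = q'" by (simp add: gh)
    qed
    moreover have "(\<lambda>(g, h). brk b g + brk c h) ` (?G k \<times> ?G k) \<subseteq> ?H k"
    proof (rule image_subsetI)
      fix q assume "q \<in> ?G k \<times> ?G k"
      then obtain g h where q: "q = (g, h)" "g \<in> ?G k" "h \<in> ?G k" by blast
      then have "brk b g \<in> ?H k" "brk c h \<in> ?H k"
        using brk_G[OF _ _ db, of g k] brk_G[OF _ _ dc, of h k] by auto
      then have "brk b g + brk c h \<in> ?H k" by (rule add_subgroup_add[OF H])
      then show "(case q of (g, h) \<Rightarrow> brk b g + brk c h) \<in> ?H k" by (simp only: q prod.case)
    qed
    ultimately have "card (?G k \<times> ?G k) \<le> card (?H k)"
      using fin(2)[of k] by (rule card_inj_on_le)
    then show ?thesis by (simp add: card_cartesian_product power2_eq_square)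
  qed
  \<comment> \<open>Every nonzero function drops out at some stage, and \<open>W\<close> is
    finite.\<close>
  have "\<exists>K. \<forall>k\<ge>K. ?W k = {0}"
  proof -
    have zero: "0 \<in> ?W k" for k using add_subgroup_part_ge[OF W] by (auto simp: add_subgroup_def)
    have "\<exists>k. e \<notin> ?W k" if e: "e \<noteq> 0" for e
    proof -
      obtain u where "e u \<noteq> 0" using e by (auto simp: fun_eq_iff)
      then show ?thesis by (intro exI[of _ "Suc (d u)"]) (auto simp: part_ge_def)
    qed
    then obtain \<kappa> where \<kappa>: "e \<notin> ?W (\<kappa> e)" if "e \<noteq> 0" for e by metis
    define K where "K = Max (\<kappa> ` W)"
    have "?W k = {0}" if "k \<ge> K" for k
    proof -
      have False if "e \<in> ?W k" "e \<noteq> 0" for e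
      proof -
        have "e \<in> W" using that by (auto simp: part_ge_def)
        then have "\<kappa> e \<le> k" using W \<open>k \<ge> K\<close> unfolding K_def add_subgroup_def
          by (meson Max_ge finite_imageI imageI order_trans)
        then have "e \<in> ?W (\<kappa> e)" using that by (auto simp: part_ge_def)
        then show False using \<kappa> that by blast
      qed
      then show ?thesis using zero by blast
    qed
    then show ?thesis by blast
  qed
  then obtain K where K: "\<And>k. k \<ge> K \<Longrightarrow> ?W k = {0}" by blast
  \<comment> \<open>In dimensions: \<open>\<alpha>\<^sub>k\<close> plus three times the later
    \<open>\<alpha>\<close> is at most twice the later \<open>\<nu>\<close>. The two bounds give
    \<open>2 \<nu>\<^sub>k\<^sub>+\<^sub>1 \<ge> \<alpha>\<^sub>k + 2
    \<alpha>\<^sub>k\<^sub>+\<^sub>1\<close>; the third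
    \<open>\<alpha>\<^sub>k\<^sub>+\<^sub>1\<close> is left to the next degree, which is why
    \<open>?G k\<close> appears in the claim.\<close>
  have claim: "card (?G k) * card (?W (Suc k)) ^ 3 \<le> card (?N (Suc k)) ^ 2" if "k \<le> K" for k
    using that
  proof (induction rule: inc_induct)
    case base
    have "card (?G K) = 1" using K[of K] by simp
    moreover have "card (?N (Suc K)) \<ge> 1" using add_subgroup_part_ge[OF N] by (rule add_subgroup_card_pos)
    ultimately show ?case using K[of "Suc K"] by simp
  next
    case (step k)
    let ?g = "card (?G (Suc k))" and ?w = "card (?W (Suc (Suc k)))" and ?h = "card (?H (Suc k))"
    have "card (?G k) * (?g * ?w) ^ 3 = (card (?G k) * ?g ^ 2) * (?g * ?w ^ 3)"
      by (simp add: power2_eq_square power3_eq_cube)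
    also have "\<dots> \<le> (?h * ?h) * card (?N (Suc (Suc k))) ^ 2"
      using step.IH H_a[of k] H_bc[of "Suc k"] by (intro mult_le_mono) auto
    finally show ?case
      by (simp add: card_part_ge[OF W, of d "Suc k"] card_part_ge[OF N, of d "Suc k"] power2_eq_square mult.assoc mult.left_commute)
  qed
  have "card W ^ 3 = card (?G 0) ^ 2 * (card (?G 0) * card (?W 1) ^ 3)"
    using card_part_ge[OF W, of d 0] by (simp add: part_ge_0 power_mult_distrib power2_eq_square power3_eq_cube)
  also have "\<dots> \<le> card (?H 0) ^ 2 * card (?N 1) ^ 2"
    using claim[of 0] H_0 by (intro mult_le_mono power_mono) auto
  also have "\<dots> = card N ^ 2"
    using card_part_ge[OF N, of d 0] by (simp add: part_ge_0 power_mult_distrib)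
  finally show ?thesis .
qed

text \<open>The degree-one part of \<open>A\<close> survives in \<open>N\<close> and in addition contributes brackets of degree two;
  the part of degree at least two is handled by the previous lemma.\<close>
theorem card_expansion:
  fixes A N :: "('x list \<Rightarrow> 'm :: ab_group_add) set"
  assumes abc: "a \<noteq> b" "a \<noteq> c" "b \<noteq> c" and A: "add_subgroup A" and N: "add_subgroup N"
    and AN: "A \<subseteq> N" and brk: "\<And>e x. e \<in> A \<Longrightarrow> x \<in> {a, b, c} \<Longrightarrow> brk x e \<in> N"
    and Nil: "\<And>e. e \<in> A \<Longrightarrow> e [] = 0"
    and pure: "\<And>e n x. e \<in> A \<Longrightarrow> (\<And>y. e [y] = 0) \<Longrightarrow> n \<ge> 1 \<Longrightarrow> x \<in> {a, b} \<Longrightarrow> e (replicate n x) = 0"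
  shows "card A ^ 3 \<le> card N ^ 2"
proof -
  let ?p = "part length :: nat \<Rightarrow> ('x list \<Rightarrow> 'm) \<Rightarrow> 'x list \<Rightarrow> 'm"
  have g: "graded_by length x 1" for x :: 'x by (simp add: graded_by_def)
  have A1: "A \<subseteq> part_ge length 1 A" using Nil by (auto simp: part_ge_def)
  define N1 where "N1 = part_ge length 1 N"
  have N1: "add_subgroup N1" unfolding N1_def by (rule add_subgroup_part_ge[OF N])
  define A' where "A' = ?p 1 ` A"
  define A2 where "A2 = part_ge length 2 A"
  have "part_ge length 1 A = A" using A1 by (auto simp: part_ge_def)
  then have card_A: "card A = card A' * card A2"
    using card_part_ge[OF A, of length 1] by (simp add: A'_def A2_def numeral_2_eq_2)
  have "card N1 \<le> card N"
    using N by (intro card_mono) (auto simp: N1_def part_ge_def add_subgroup_def)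
  moreover have "card N1 = card (?p 1 ` N1) * (card (?p 2 ` part_ge length 2 N) * card (part_ge length 3 N))"
    using card_part_ge[OF N, of length 1] card_part_ge[OF N, of length 2]
    by (simp add: N1_def numeral_2_eq_2 numeral_3_eq_3)
  ultimately have card_N: "card (?p 1 ` N1) * (card (?p 2 ` part_ge length 2 N) * card (part_ge length 3 N)) \<le> card N"
    by simp
  have finN: "finite (part_ge length k N)" for k
    using add_subgroup_part_ge[OF N] by (simp add: add_subgroup_def)
  have 1: "card A' \<le> card (?p 1 ` N1)"
    using A1 AN unfolding A'_def N1_def
    by (intro card_mono finite_imageI finN image_mono) (auto simp: part_ge_def)
  \<comment> \<open>Inclusion pays for two of the three copies of \<open>A'\<close>. The third comes
    from degree two: a linear form killed by the brackets with both \<open>a\<close> and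
    \<open>b\<close> is 0.\<close>
  have 2: "card A' \<le> card (?p 2 ` part_ge length 2 N) ^ 2"
  proof -
    have "inj_on (\<lambda>g. (brk a g, brk b g)) A'"
    proof (rule inj_onI)
      fix g h assume gh: "g \<in> A'" "h \<in> A'" "(brk a g, brk b g) = (brk a h, brk b h)"
      define f where "f = g - h"
      have f: "brk a f = 0" "brk b f = 0" using gh by (auto simp: f_def brk_diff)
      have supp: "f u = 0" if "length u \<noteq> 1" for u
        using gh that by (auto simp: f_def A'_def part_def)
      have "f [x] = 0" for x
      proof (cases "x = a")
        case True
        have "brk b f [x, b] = 0" by (simp add: f)
        then show ?thesis using True abc by (simp add: brk_def)
      next
        case False
        have "brk a f [x, a] = 0" by (simp add: f)
        then show ?thesis using False by (simp add: brk_def)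
      qed
      then have "f u = 0" for u
        using supp[of u] by (cases "length u = 1") (auto simp: length_Suc_conv)
      then have "f = 0" by (auto simp: fun_eq_iff)
      then show "g = h" by (simp add: f_def)
    qed
    moreover have "(\<lambda>g. (brk a g, brk b g)) ` A' \<subseteq> ?p 2 ` part_ge length 2 N \<times> ?p 2 ` part_ge length 2 N"
    proof -
      have "brk x (?p 1 e) \<in> ?p 2 ` part_ge length 2 N" if "e \<in> A" "x \<in> {a, b}" for x e
      proof -
        have "brk x e \<in> part_ge length (1 + 1) N"
          using that A1 brk by (intro brk_part_ge[OF g]) auto
        moreover have "brk x (?p 1 e) = ?p (1 + 1) (brk x e)" by (rule part_brk[OF g, symmetric])
        ultimately show ?thesis by (simp add: numeral_2_eq_2)
      qed
      then show ?thesis by (auto simp: A'_def)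
    qed
    ultimately have "card A' \<le> card (?p 2 ` part_ge length 2 N \<times> ?p 2 ` part_ge length 2 N)"
      using finN by (intro card_inj_on_le) auto
    then show ?thesis by (simp add: card_cartesian_product power2_eq_square)
  qed
  \<comment> \<open>Brackets raise the length by one, so \<open>A2\<close> is charged only to
    lengths from 3 on, disjoint from what \<open>A'\<close> used. Having no linear part, its
    elements satisfy the assumption on pure powers.\<close>
  have 3: "card A2 ^ 3 \<le> card (part_ge length 3 N) ^ 2"
  proof (rule card_brk_le[OF abc])
    show "add_subgroup A2" "add_subgroup (part_ge length 3 N)"
      unfolding A2_def by (intro add_subgroup_part_ge A N)+
    fix e assume e: "e \<in> A2"
    then have eA: "e \<in> A" and single: "e [y] = 0" for y by (auto simp: A2_def part_ge_def)
    show "brk x e \<in> part_ge length 3 N" if "x \<in> {a, b, c}" for x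
    proof -
      have "brk x e \<in> part_ge length (2 + 1) N"
        using e brk[OF eA that] unfolding A2_def by (intro brk_part_ge[OF g])
      then show ?thesis by simp
    qed
    show "e (replicate n a) = 0 \<and> e (replicate n b) = 0" for n
      using pure[OF eA single, of n] Nil[OF eA] by (cases "n = 0") auto
  qed
  have "card A ^ 3 = card A' ^ 2 * card A' * card A2 ^ 3"
    by (simp add: card_A power_mult_distrib power2_eq_square power3_eq_cube)
  also have "\<dots> \<le> card (?p 1 ` N1) ^ 2 * card (?p 2 ` part_ge length 2 N) ^ 2 * card (part_ge length 3 N) ^ 2"
    using 1 2 3 by (intro mult_le_mono power_mono) auto
  also have "\<dots> = (card (?p 1 ` N1) * (card (?p 2 ` part_ge length 2 N) * card (part_ge length 3 N))) ^ 2"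
    by (simp add: power_mult_distrib mult.assoc)
  also have "\<dots> \<le> card N ^ 2" using card_N by (rule power_mono) simp
  finally show ?thesis .
qed

subsection \<open>The circle group\<close>

quotient_type circle = real / "\<lambda>x y. x - y \<in> \<int>"
proof (rule equivpI)
  show "symp (\<lambda>x y :: real. x - y \<in> \<int>)"
    by (rule sympI) (metis Ints_minus minus_diff_eq)
  show "transp (\<lambda>x y :: real. x - y \<in> \<int>)"
  proof (rule transpI)
    fix x y z :: real assume "x - y \<in> \<int>" "y - z \<in> \<int>"
    then have "(x - y) + (y - z) \<in> \<int>" by (rule Ints_add)
    then show "x - z \<in> \<int>" by simp
  qed
qed (simp add: reflp_def)

instantiation circle :: ab_group_add
begin

lift_definition zero_circle :: circle is 0 .

lift_definition plus_circle :: "circle \<Rightarrow> circle \<Rightarrow> circle" is "(+)"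
  by (metis Ints_add add_diff_add)

lift_definition uminus_circle :: "circle \<Rightarrow> circle" is uminus
  by (metis Ints_minus minus_diff_minus)

definition minus_circle :: "circle \<Rightarrow> circle \<Rightarrow> circle" where "minus_circle x y = x + - y"

instance
proof
  fix x y z :: circle
  show "x + y + z = x + (y + z)" by transfer (simp add: algebra_simps)
  show "x + y = y + x" by transfer (simp add: algebra_simps)
  show "0 + x = x" by transfer simp
  show "- x + x = 0" by transfer simp
  show "x - y = x + - y" by (simp add: minus_circle_def)
qed

end

lift_definition to_circle :: "real \<Rightarrow> circle" is "\<lambda>x. x" .

lemma to_circle_add: "to_circle (x + y) = to_circle x + to_circle y"
  by transfer simp

lemma to_circle_eq_0: "to_circle x = 0 \<longleftrightarrow> x \<in> \<int>"
  by transfer simp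

subsection \<open>Cardinalities of sections\<close>

lemma card_vectorspace_finite:
  assumes "vectorspace K V" "finite (carrier V)"
  shows "card (carrier V) = card (carrier K) ^ vectorspace.dim K V"
proof -
  interpret vectorspace K V by (rule assms)
  have "span (carrier V) = carrier V"
    using in_own_span[of "carrier V"] span_is_subset2[of "carrier V"] by auto
  then have "fin_dim" unfolding fin_dim_def using assms(2) by blast
  then obtain A where A: "finite A" "basis A" using finite_basis_exists by blast
  have AV: "A \<subseteq> carrier V" using A(2) by (simp add: basis_def)
  have unique: "\<exists>!a. a \<in> A \<rightarrow>\<^sub>E carrier K \<and> lincomb a A = v" if "v \<in> carrier V" for v
    using basis_criterion[OF A(1) AV] A(2) that by blast
  have closed: "lincomb a A \<in> carrier V" if "a \<in> A \<rightarrow>\<^sub>E carrier K" for a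
    using that AV by (intro lincomb_closed) (auto simp: PiE_def)
  have inj: "a = b"
    if "a \<in> A \<rightarrow>\<^sub>E carrier K" "b \<in> A \<rightarrow>\<^sub>E carrier K" "lincomb a A = lincomb b A" for a b
    by (rule trans[OF the1_equality[OF unique[OF closed[OF that(2)]], OF conjI[OF that(1,3)], symmetric]
          the1_equality[OF unique[OF closed[OF that(2)]], OF conjI[OF that(2) refl]]])
  have "bij_betw (\<lambda>a. lincomb a A) (A \<rightarrow>\<^sub>E carrier K) (carrier V)"
    unfolding bij_betw_def
  proof
    show "inj_on (\<lambda>a. lincomb a A) (A \<rightarrow>\<^sub>E carrier K)" by (rule inj_onI) (rule inj)
    show "(\<lambda>a. lincomb a A) ` (A \<rightarrow>\<^sub>E carrier K) = carrier V"
    proof (rule subset_antisym; rule subsetI)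
      fix v assume "v \<in> (\<lambda>a. lincomb a A) ` (A \<rightarrow>\<^sub>E carrier K)"
      then show "v \<in> carrier V" by (elim imageE) (simp only: closed)
    next
      fix v assume "v \<in> carrier V"
      from ex1_implies_ex[OF unique[OF this]] show "v \<in> (\<lambda>a. lincomb a A) ` (A \<rightarrow>\<^sub>E carrier K)"
        by (elim exE conjE) (rule image_eqI, rule sym)
    qed
  qed
  then have "card (carrier V) = card (A \<rightarrow>\<^sub>E carrier K)" by (rule bij_betw_same_card[symmetric])
  also have "\<dots> = card (carrier K) ^ card A" using A(1) by (simp add: card_PiE)
  also have "card A = dim" using dim_basis[OF A] by simp
  finally show ?thesis .
qed

lemma card_image_eq:
  assumes "\<And>x y. x \<in> H \<Longrightarrow> y \<in> H \<Longrightarrow> f x = f y \<longleftrightarrow> g x = g y"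
  shows "card (f ` H) = card (g ` H) \<and> (finite (g ` H) \<longrightarrow> finite (f ` H))"
proof -
  define h where "h = (\<lambda>z. g (SOME x. x \<in> H \<and> f x = z))"
  have h: "h (f x) = g x" if "x \<in> H" for x
  proof -
    have "(SOME y. y \<in> H \<and> f y = f x) \<in> H \<and> f (SOME y. y \<in> H \<and> f y = f x) = f x"
      by (rule someI[of "\<lambda>y. y \<in> H \<and> f y = f x" x]) (use that in simp)
    then show ?thesis using assms that unfolding h_def by blast
  qed
  have "bij_betw h (f ` H) (g ` H)"
    unfolding bij_betw_def inj_on_def using assms h by (auto simp: image_image)
  then show ?thesis using bij_betw_same_card bij_betw_finite by blast
qed

lemma (in group) carrier_section_group:
  assumes N: "N \<lhd> G" and H: "subgroup H G"
  shows "carrier (section_group G H N) = (\<lambda>h. N #> h) ` H"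
proof -
  interpret N: normal N G by (rule N)
  have HG: "H \<subseteq> carrier G" using H by (rule subgroup.subset)
  have coset: "N #> (h \<otimes> n) = N #> h" if "h \<in> H" "n \<in> N" for h n
  proof -
    have c: "h \<in> carrier G" "n \<in> carrier G" using that HG by auto
    then have "(h \<otimes> n \<otimes> inv h) \<otimes> h = h \<otimes> n" by (simp add: m_assoc)
    then have "h \<otimes> n \<in> N #> h"
      using N.inv_op_closed2[OF c(1) that(2)] unfolding r_coset_def by (metis UN_I singletonI)
    then show ?thesis using repr_independence c(1) N.subgroup_axioms by metis
  qed
  have "carrier (section_group G H N) = (\<lambda>h. N #> h) ` (H <#> N)"
    by (auto simp: section_group_def FactGroup_def RCOSETS_def r_coset_def)
  also have "\<dots> = (\<lambda>h. N #> h) ` H"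
  proof (rule subset_antisym; rule subsetI)
    fix X assume "X \<in> (\<lambda>h. N #> h) ` (H <#> N)"
    then show "X \<in> (\<lambda>h. N #> h) ` H" using coset by (auto simp: set_mult_def)
  next
    fix X assume "X \<in> (\<lambda>h. N #> h) ` H"
    then obtain h where h: "h \<in> H" "X = N #> h" by blast
    then have "h \<otimes> \<one> \<in> H <#> N" unfolding set_mult_def using N.one_closed by blast
    then show "X \<in> (\<lambda>h. N #> h) ` (H <#> N)" using h HG by auto
  qed
  finally show ?thesis .
qed

text \<open>The multiplicity \<open>k\<close> of \<open>p\<close> in \<open>n\<close> satisfies
  \<open>k < p ^ k \<le> n\<close>, so cancelling \<open>n\<close> costs at most
  \<open>n - 1\<close> factors of \<open>p\<close>.\<close>

lemma dvd_of_dvd_mult_power: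
  assumes p: "prime p" and n: "n \<ge> 1" and dvd: "int p ^ i dvd int n * c"
  shows "int p ^ (i + 1 - n) dvd c"
proof -
  define k where "k = multiplicity p n"
  have nz: "n \<noteq> 0" "\<not> is_unit p" using n prime_gt_1_nat[OF p] by auto
  obtain m where m: "n = p ^ k * m" "\<not> p dvd m"
    unfolding k_def using multiplicity_decompose'[OF nz] .
  have "p ^ k dvd n" using m(1) by (rule dvdI)
  have "k < n"
  proof -
    have "k < p ^ k" using prime_gt_1_nat[OF p] by (simp add: power_gt_expt)
    also have "\<dots> \<le> n" using \<open>p ^ k dvd n\<close> n by (intro dvd_imp_le) auto
    finally show ?thesis .
  qed
  show ?thesis
  proof (cases "k \<le> i")
    case True
    have "int p ^ (k + (i - k)) dvd int p ^ k * (int m * c)"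
      using dvd True by (simp add: m(1) mult.assoc)
    then have "int p ^ (i - k) dvd int m * c"
      unfolding power_add using prime_gt_0_nat[OF p] by simp
    moreover have "coprime (int p ^ (i - k)) (int m)"
      using prime_imp_coprime[OF p m(2)] by simp
    ultimately have "int p ^ (i - k) dvd c" by (simp add: coprime_dvd_mult_right_iff)
    then show ?thesis using \<open>k < n\<close> by (elim dvd_trans[OF le_imp_power_dvd, rotated]) simp
  next
    case False
    then show ?thesis using \<open>k < n\<close> by simp
  qed
qed

text \<open>For \<open>f \<in> adic p n\<close> the coefficient at \<open>u\<close> is \<open>p ^ (n - length u) * c\<close>, and the value below is
  \<open>c / p\<close> modulo 1: the field with \<open>p\<close> elements is realised inside the circle, which unlike the
  field itself is a type independent of \<open>p\<close>.\<close>
definition residue_fun :: "nat \<Rightarrow> nat \<Rightarrow> 'x ncps \<Rightarrow> 'x list \<Rightarrow> circle" where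
  "residue_fun p n f u = to_circle (real_of_int (wcoeff f u) / real p ^ (Suc n - length u))"

lemma to_circle_diff: "to_circle (x - y) = to_circle x - to_circle y"
  using to_circle_add[of "x - y" y] by (simp add: algebra_simps)

lemma residue_fun_diff: "residue_fun p n (f - g) = residue_fun p n f - residue_fun p n g"
  by (auto simp: residue_fun_def fun_eq_iff to_circle_diff diff_divide_distrib)

lemma residue_fun_add: "residue_fun p n (f + g) = residue_fun p n f + residue_fun p n g"
  by (auto simp: residue_fun_def fun_eq_iff to_circle_add add_divide_distrib)

lemma to_circle_divide_eq_0:
  assumes "p > 0"
  shows "to_circle (real_of_int c / real p ^ k) = 0 \<longleftrightarrow> int p ^ k dvd c"
proof
  assume "to_circle (real_of_int c / real p ^ k) = 0"
  then obtain j :: int where "real_of_int c / real p ^ k = of_int j"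
    by (auto simp: to_circle_eq_0 elim: Ints_cases)
  then have "real_of_int c = of_int (j * int p ^ k)" using assms by (simp add: field_simps)
  then show "int p ^ k dvd c" by (simp only: of_int_eq_iff dvd_triv_right)
next
  assume "int p ^ k dvd c"
  then obtain j where "c = int p ^ k * j" ..
  then have "real_of_int c / real p ^ k = of_int j" using assms by simp
  then show "to_circle (real_of_int c / real p ^ k) = 0" by (simp add: to_circle_eq_0)
qed

lemma residue_fun_eq_0: "p > 0 \<Longrightarrow> residue_fun p n f u = 0 \<longleftrightarrow> int p ^ (Suc n - length u) dvd wcoeff f u"
  by (simp add: residue_fun_def to_circle_divide_eq_0)

lemma residue_fun_eq_iff:
  assumes "p > 0"
  shows "residue_fun p n f = residue_fun p n g \<longleftrightarrow> f - g \<in> adic p (Suc n)"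
proof -
  have "residue_fun p n f = residue_fun p n g \<longleftrightarrow> residue_fun p n (f - g) = 0"
    by (simp add: residue_fun_diff)
  also have "\<dots> \<longleftrightarrow> f - g \<in> adic p (Suc n)"
    using assms by (auto simp: fun_eq_iff residue_fun_eq_0 adic_def)
  finally show ?thesis .
qed

text \<open>The factor \<open>p\<close> cancels against the larger denominator, so multiplication by
  \<open>p\<close> is invisible in the residues. On words longer than \<open>Suc n\<close> both
  denominators are 1 and both values 0.\<close>

lemma residue_fun_Suc:
  assumes "p > 0"
  shows "residue_fun p (Suc n) (of_nat p * f) = residue_fun p n f"
proof
  fix u
  show "residue_fun p (Suc n) (of_nat p * f) u = residue_fun p n f u"
  proof (cases "length u \<le> Suc n")
    case True
    then show ?thesis using assms by (simp add: residue_fun_def Suc_diff_le)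
  next
    case False
    then have "residue_fun p (Suc n) (of_nat p * f) u = 0" "residue_fun p n f u = 0"
      using assms by (simp_all add: residue_fun_eq_0)
    then show ?thesis by simp
  qed
qed

lemma residue_fun_brk:
  "residue_fun p (Suc n) (ad f (letter x)) = brk x (residue_fun p n f)"
proof
  fix u
  have zero: "to_circle 0 = 0" by (simp add: to_circle_eq_0)
  show "residue_fun p (Suc n) (ad f (letter x)) u = brk x (residue_fun p n f) u"
    by (cases u)
      (auto simp: residue_fun_def ad_def brk_def wcoeff_mult_letter wcoeff_letter_mult zero
        diff_divide_distrib to_circle_diff)
qed

section \<open>Leading terms of elements of the lower p-series\<close>

context free_p_series
begin

abbreviation \<sigma> :: "nat \<Rightarrow> 'a \<Rightarrow> 'a list \<Rightarrow> circle" where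
  "\<sigma> n g \<equiv> residue_fun p n (\<delta> g)"

lemma p_pos: "p > 0" using p by (rule prime_gt_0_nat)

lemma sigma_mult:
  assumes "n \<ge> 1" "g \<in> L n" "h \<in> L n"
  shows "\<sigma> n (g \<otimes> h) = \<sigma> n g + \<sigma> n h"
proof -
  have "\<delta> g * \<delta> h \<in> adic p (n + n)" using assms L_adic by (intro adic_mult) auto
  then have "\<delta> g * \<delta> h \<in> adic p (Suc n)" by (rule adic_mono) (use assms in simp)
  then have "\<sigma> n (g \<otimes> h) = residue_fun p n (\<delta> g + \<delta> h)"
    using assms p_pos L_carrier[of g n] L_carrier[of h n] by (simp add: residue_fun_eq_iff delta_mult)
  then show ?thesis by (simp add: residue_fun_add)
qed

text \<open>Here the kernel theorem enters: \<open>\<sigma> n\<close> embeds the quotient of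
  \<open>L n\<close> by \<open>L (Suc n)\<close> into functions on words.\<close>

lemma sigma_eq_0: "n \<ge> 1 \<Longrightarrow> g \<in> L n \<Longrightarrow> \<sigma> n g = 0 \<longleftrightarrow> g \<in> L (Suc n)"
proof -
  assume g: "n \<ge> 1" "g \<in> L n"
  have "\<sigma> n g = 0 \<longleftrightarrow> \<delta> g \<in> adic p (Suc n)"
  proof -
    have "residue_fun p n (0 :: 'a ncps) = 0" using residue_fun_diff[of p n 0 "0 :: 'a ncps"] by simp
    then show ?thesis using residue_fun_eq_iff[OF p_pos, of n "\<delta> g" 0] by (simp only: diff_0_right)
  qed
  then show ?thesis using magnus_kernel g L_adic[of "Suc n" g] by auto
qed

lemma sigma_diff:
  assumes "n \<ge> 1" "g \<in> L n" "h \<in> L n"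
  shows "\<sigma> n (g \<otimes> inv h) = \<sigma> n g - \<sigma> n h"
proof -
  have "\<sigma> n (g \<otimes> inv h \<otimes> h) = \<sigma> n (g \<otimes> inv h) + \<sigma> n h"
    using assms by (intro sigma_mult L_mult L_inv)
  moreover have "g \<otimes> inv h \<otimes> h = g"
    using assms(2,3) L_carrier by (simp add: m_assoc)
  ultimately show ?thesis by (simp add: algebra_simps)
qed

lemma sigma_eq_iff:
  assumes "n \<ge> 1" "g \<in> L n" "h \<in> L n"
  shows "\<sigma> n g = \<sigma> n h \<longleftrightarrow> cl (Suc n) g = cl (Suc n) h"
proof -
  have "\<sigma> n g = \<sigma> n h \<longleftrightarrow> \<sigma> n (g \<otimes> inv h) = 0" using assms by (simp add: sigma_diff)
  also have "\<dots> \<longleftrightarrow> g \<otimes> inv h \<in> L (Suc n)"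
    using assms by (intro sigma_eq_0 L_mult L_inv)
  also have "\<dots> \<longleftrightarrow> cl (Suc n) g = cl (Suc n) h"
    using assms L_carrier[of g n] L_carrier[of h n] by (simp add: cl_eq_iff)
  finally show ?thesis .
qed

text \<open>For \<open>n = 1\<close> and \<open>p = 2\<close> the square of
  \<open>\<delta> g\<close> would contribute in the same weight; this is the use of
  \<open>i \<ge> 2\<close>.\<close>

lemma sigma_pow:
  assumes "n \<ge> 2" "g \<in> L n"
  shows "\<sigma> (Suc n) (g [^] p) = \<sigma> n g"
proof -
  have g: "g \<in> carrier G" "\<delta> g \<in> adic p n" using assms L_carrier L_adic by auto
  have "\<delta> (g [^] p) - of_nat p * \<delta> g \<in> adic p (Suc (Suc n))"
  proof (rule adicI)
    fix u show "int p ^ (Suc (Suc n) - length u) dvd wcoeff (\<delta> (g [^] p) - of_nat p * \<delta> g) u"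
      using delta_pow_p[OF g, of u] assms(1) by simp
  qed
  then have "\<sigma> (Suc n) (g [^] p) = residue_fun p (Suc n) (of_nat p * \<delta> g)"
    by (simp add: residue_fun_eq_iff p_pos)
  then show ?thesis by (simp add: residue_fun_Suc p_pos)
qed

lemma sigma_comm:
  assumes "n \<ge> 1" "g \<in> L n" "x \<in> B"
  shows "\<sigma> (Suc n) (comm g x) = brk x (\<sigma> n g)"
proof -
  have g: "g \<in> carrier G" "\<delta> g \<in> adic p n" "x \<in> carrier G" using assms L_carrier L_adic B by auto
  have "\<delta> (comm g x) - ad (\<delta> g) (\<delta> x) \<in> adic p (Suc (n + 1))"
    using g by (intro delta_comm_adic delta_adic_1)
  then have "\<sigma> (Suc n) (comm g x) = residue_fun p (Suc n) (ad (\<delta> g) (letter x))"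
    using assms(3) by (simp add: residue_fun_eq_iff p_pos delta_B)
  then show ?thesis by (simp add: residue_fun_brk)
qed

text \<open>Multiplying by the inverse of \<open>b\<close> undoes multiplying by \<open>b\<close>,
  so the third premise covers inverse letters without touching their infinite series.\<close>

lemma left_mult_induct:
  assumes "P \<one>" "\<And>b g. b \<in> B \<Longrightarrow> g \<in> carrier G \<Longrightarrow> P g \<Longrightarrow> P (b \<otimes> g)"
    and "\<And>b g. b \<in> B \<Longrightarrow> g \<in> carrier G \<Longrightarrow> P (b \<otimes> g) \<Longrightarrow> P g" and "g \<in> carrier G"
  shows "P g"
proof -
  have "P (word_value G w) \<and> word_value G w \<in> carrier G" if "set w \<subseteq> UNIV \<times> B" for w
    using that
  proof (induction w)
    case Nil
    then show ?case using assms(1) by (simp add: word_value_def)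
  next
    case (Cons a w)
    obtain b x where a: "a = (b, x)" by (cases a)
    have w: "P (word_value G w)" "word_value G w \<in> carrier G" using Cons by auto
    have x: "x \<in> B" "x \<in> carrier G" using Cons.prems a B by auto
    show ?case
    proof (cases b)
      case True
      then show ?thesis using assms(2)[OF x(1) w(2,1)] w x by (simp add: a word_value_def)
    next
      case False
      have "x \<otimes> (inv x \<otimes> word_value G w) = word_value G w" using w x by simp
      then have "P (inv x \<otimes> word_value G w)"
        using assms(3)[OF x(1), of "inv x \<otimes> word_value G w"] w x by simp
      then show ?thesis using False w x by (simp add: a word_value_def)
    qed
  qed
  then show ?thesis using word_value_surj[OF B(2)] B(3) assms(4) by blast
qed

lemma coeff_support:
  assumes "g \<in> carrier G" "\<not> set u \<subseteq> B"
  shows "wcoeff (\<mu> g) u = 0"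
  using assms(2)
proof (induction g arbitrary: u rule: left_mult_induct)
  case 1
  then show ?case by (auto simp: mu_one wcoeff_1)
next
  case (2 b g)
  then have "b \<in> carrier G" using B by blast
  then show ?case
    using 2 by (cases u) (auto simp: mu_mult mu_B distrib_right wcoeff_letter_mult)
next
  case (3 b g)
  then have b: "b \<in> carrier G" using B by blast
  have IH: "wcoeff (\<mu> g) v + wcoeff (letter b * \<mu> g) v = 0" if "\<not> set v \<subseteq> B" for v
    using 3(3)[OF that] b 3 by (simp add: mu_mult mu_B distrib_right)
  from 3(4) show ?case
  proof (induction u)
    case (Cons y v)
    show ?case
    proof (cases "y = b")
      case True
      then show ?thesis using IH[OF Cons.prems] Cons 3(1) by (simp add: wcoeff_letter_mult)
    qed (use IH[OF Cons.prems] in \<open>simp add: wcoeff_letter_mult\<close>)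
  qed simp
qed (rule assms(1))

text \<open>In the variable \<open>x\<close> alone, \<open>\<mu> g\<close> is the binomial series \<open>(1 + x) ^ m\<close> with \<open>m\<close> the exponent
  sum of \<open>x\<close> in \<open>g\<close>; the recurrence characterises its coefficients.\<close>
lemma coeff_replicate_recurrence:
  assumes "x \<in> B" "g \<in> carrier G"
  shows "int (Suc n) * wcoeff (\<mu> g) (replicate (Suc n) x)
    = (wcoeff (\<mu> g) [x] - int n) * wcoeff (\<mu> g) (replicate n x)"
proof -
  define c where "c = (\<lambda>g n. wcoeff (\<mu> g) (replicate n x))"
  have c_other: "c (b \<otimes> g) n = c g n" if "b \<in> B" "b \<noteq> x" "g \<in> carrier G" for b g n
    using that subsetD[OF B(2) that(1)]
    by (cases n) (simp_all add: c_def mu_mult mu_B distrib_right wcoeff_letter wcoeff_letter_mult)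
  have c_x: "c (x \<otimes> g) (Suc n) = c g (Suc n) + c g n" if "g \<in> carrier G" for g n
    using that assms(1) B(2) by (auto simp: c_def mu_mult mu_B distrib_right wcoeff_letter_mult)
  have c_0: "c g 0 = 1" if "g \<in> carrier G" for g
    using coeff_delta_Nil[OF that] by (simp add: c_def mu_eq wcoeff_1)
  have "\<forall>n. int (Suc n) * c g (Suc n) = (c g 1 - int n) * c g n"
  proof (rule left_mult_induct[OF _ _ _ assms(2)])
    show "\<forall>n. int (Suc n) * c \<one> (Suc n) = (c \<one> 1 - int n) * c \<one> n"
      by (auto simp: c_def mu_one wcoeff_1)
  next
    fix b g assume b: "b \<in> B" and g: "g \<in> carrier G"
      and IH: "\<forall>n. int (Suc n) * c g (Suc n) = (c g 1 - int n) * c g n"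
    show "\<forall>n. int (Suc n) * c (b \<otimes> g) (Suc n) = (c (b \<otimes> g) 1 - int n) * c (b \<otimes> g) n"
    proof (cases "b = x")
      case True
      have c1: "c (x \<otimes> g) 1 = c g 1 + 1" using c_x[OF g, of 0] c_0[OF g] by simp
      show ?thesis
      proof
        fix n
        show "int (Suc n) * c (b \<otimes> g) (Suc n) = (c (b \<otimes> g) 1 - int n) * c (b \<otimes> g) n"
        proof (cases n)
          case 0
          then show ?thesis using True g B(2) b c_0[of "x \<otimes> g"] by auto
        next
          case (Suc k)
          have "int (Suc n) * c g (Suc n) = (c g 1 - int n) * c g n"
            "int n * c g n = (c g 1 - int k) * c g k"
            using IH[rule_format, of n] IH[rule_format, of k] Suc by auto
          then show ?thesis
            unfolding True c1 c_x[OF g] by (simp add: Suc c_x[OF g] algebra_simps)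
        qed
      qed
    qed (use IH b g c_other in simp)
  next
    fix b g assume b: "b \<in> B" and g: "g \<in> carrier G"
      and IH: "\<forall>n. int (Suc n) * c (b \<otimes> g) (Suc n) = (c (b \<otimes> g) 1 - int n) * c (b \<otimes> g) n"
    show "\<forall>n. int (Suc n) * c g (Suc n) = (c g 1 - int n) * c g n"
    proof (cases "b = x")
      case True
      have c1: "c (x \<otimes> g) 1 = c g 1 + 1" using c_x[OF g, of 0] c_0[OF g] by simp
      have "int (Suc n) * c g (Suc n) = (c g 1 - int n) * c g n" for n
      proof (induction n)
        case 0
        then show ?case using c_0[OF g] by simp
      next
        case (Suc k)
        have "int (Suc (Suc k)) * (c g (Suc (Suc k)) + c g (Suc k))
            = (c g 1 + 1 - int (Suc k)) * (c g (Suc k) + c g k)"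
          using IH[rule_format, of "Suc k"] unfolding True c1 c_x[OF g] by simp
        then show ?case using Suc by (simp add: algebra_simps)
      qed
      then show ?thesis by blast
    qed (use IH b g c_other in simp)
  qed
  then show ?thesis by (simp add: c_def)
qed

text \<open>The identity \<open>n * (m choose n) = m * (m - 1 choose n - 1)\<close>: the exponent
  sum of \<open>x\<close> in \<open>inv x \<otimes> g\<close> is \<open>m - 1\<close>.\<close>

lemma coeff_replicate_absorb:
  assumes "x \<in> B" "g \<in> carrier G" "n \<ge> 1"
  shows "int n * wcoeff (\<mu> g) (replicate n x)
    = wcoeff (\<mu> g) [x] * wcoeff (\<mu> (inv x \<otimes> g)) (replicate (n - 1) x)"
proof -
  define h where "h = inv x \<otimes> g"
  have x: "x \<in> carrier G" using assms B by blast
  have h: "h \<in> carrier G" "g = x \<otimes> h" using assms x by (auto simp: h_def)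
  have c: "wcoeff (\<mu> g) (replicate (Suc k) x)
      = wcoeff (\<mu> h) (replicate (Suc k) x) + wcoeff (\<mu> h) (replicate k x)" for k
    unfolding h(2) using x h assms by (simp add: mu_mult mu_B distrib_right wcoeff_letter_mult)
  obtain k where n: "n = Suc k" using assms(3) by (cases n) auto
  have "wcoeff (\<mu> h) [] = 1" using coeff_delta_Nil[OF h(1)] by (simp add: mu_eq wcoeff_1)
  then have "wcoeff (\<mu> g) [x] = wcoeff (\<mu> h) [x] + 1" using c[of 0] by simp
  then show ?thesis
    using coeff_replicate_recurrence[OF assms(1) h(1), of k] c[of k]
    by (simp add: n h_def[symmetric] algebra_simps)
qed

text \<open>The hypothesis says that \<open>p ^ i\<close> divides the exponent sum of
  \<open>x\<close>. By absorption it divides \<open>n\<close> times the coefficient at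
  \<open>x ^ n\<close>, and dividing by \<open>n\<close> costs less than weight \<open>i\<close>
  allows. This supplies the assumption on pure powers in the counting argument.\<close>

lemma sigma_replicate:
  assumes "x \<in> B" "g \<in> carrier G" "n \<ge> 1" "i \<ge> 1" "\<sigma> i g [x] = 0"
  shows "\<sigma> i g (replicate n x) = 0"
proof -
  have eq: "wcoeff (\<delta> g) u = wcoeff (\<mu> g) u" if "u \<noteq> []" for u
    using that by (simp add: \<delta>_def wcoeff_1)
  have "int p ^ i dvd wcoeff (\<mu> g) [x]"
    using assms(5) p_pos by (simp add: residue_fun_eq_0 eq)
  then have "int p ^ i dvd int n * wcoeff (\<mu> g) (replicate n x)"
    unfolding coeff_replicate_absorb[OF assms(1-3)] by (rule dvd_mult2)
  then have "int p ^ (i + 1 - n) dvd wcoeff (\<mu> g) (replicate n x)"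
    by (rule dvd_of_dvd_mult_power[OF p assms(3)])
  then show ?thesis using p_pos assms(3) by (simp add: residue_fun_eq_0 eq)
qed

lemma finite_sigma:
  assumes "n \<ge> 1"
  shows "finite (\<sigma> n ` L n)"
proof (rule finite_subset)
  let ?W = "{u. set u \<subseteq> B \<and> length u \<le> n}"
  let ?V = "insert 0 ((\<lambda>j :: int. to_circle (of_int j / real p)) ` {0..<int p})"
  show "finite {f. \<forall>u. (u \<in> ?W \<longrightarrow> f u \<in> ?V) \<and> (u \<notin> ?W \<longrightarrow> f u = 0)}"
    using B(1) by (intro finite_set_of_finite_funs finite_lists_length_le) auto
  show "\<sigma> n ` L n \<subseteq> {f. \<forall>u. (u \<in> ?W \<longrightarrow> f u \<in> ?V) \<and> (u \<notin> ?W \<longrightarrow> f u = 0)}"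
  proof (rule image_subsetI)
    fix g assume g: "g \<in> L n"
    have "\<sigma> n g u \<in> ?V" if "length u \<le> n" for u
    proof -
      obtain c where c: "wcoeff (\<delta> g) u = int p ^ (n - length u) * c"
        using adicD[OF L_adic[OF assms g], of u] by (auto elim: dvdE)
      have "real_of_int (wcoeff (\<delta> g) u) / real p ^ (Suc n - length u) = of_int c / real p"
        using p_pos that by (simp add: c Suc_diff_le)
      also have "of_int c / real p = of_int (c mod int p) / real p + of_int (c div int p)"
      proof -
        have "real_of_int c = of_int (int p * (c div int p) + c mod int p)"
          by (simp only: mult_div_mod_eq)
        also have "\<dots> = real p * of_int (c div int p) + of_int (c mod int p)"
          by (simp only: of_int_add of_int_mult of_int_of_nat_eq)
        finally show ?thesis using p_pos by (simp add: add_divide_distrib)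
      qed
      finally have "\<sigma> n g u = to_circle (of_int (c mod int p) / real p + of_int (c div int p))"
        by (simp add: residue_fun_def)
      also have "\<dots> = to_circle (of_int (c mod int p) / real p)"
        using to_circle_eq_0[of "of_int (c div int p)"] by (simp add: to_circle_add)
      finally show ?thesis using p_pos by auto
    qed
    moreover have "\<sigma> n g u = 0" if "length u > n" for u
      using that p_pos by (simp add: residue_fun_eq_0)
    moreover have "\<sigma> n g u = 0" if "\<not> set u \<subseteq> B" for u
    proof -
      have "wcoeff (\<delta> g) u = 0"
        using coeff_support[OF L_carrier[OF g] that] that by (auto simp: \<delta>_def wcoeff_1)
      then show ?thesis using p_pos by (simp add: residue_fun_eq_0)
    qed
    ultimately show "\<sigma> n g \<in> {f. \<forall>u. (u \<in> ?W \<longrightarrow> f u \<in> ?V) \<and> (u \<notin> ?W \<longrightarrow> f u = 0)}"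
      by (auto simp: not_le)
  qed
qed

lemma add_subgroup_sigma:
  assumes "n \<ge> 1" "subgroup H G" "H \<subseteq> L n"
  shows "add_subgroup (\<sigma> n ` H)"
  unfolding add_subgroup_def
proof (intro conjI ballI)
  show "finite (\<sigma> n ` H)" using finite_sigma[OF assms(1)] assms(3) by (meson finite_subset image_mono)
  have "\<sigma> n \<one> = 0" using assms(1) L_one by (subst sigma_eq_0) auto
  then show "0 \<in> \<sigma> n ` H" using subgroup.one_closed[OF assms(2)] by (metis imageI)
  fix x y assume "x \<in> \<sigma> n ` H" "y \<in> \<sigma> n ` H"
  then obtain g h where gh: "g \<in> H" "h \<in> H" "x = \<sigma> n g" "y = \<sigma> n h" by blast
  have "\<sigma> n (g \<otimes> inv h) = x - y" using gh assms(1,3) by (auto intro: sigma_diff)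
  moreover have "g \<otimes> inv h \<in> H"
    using gh subgroup.m_closed[OF assms(2)] subgroup.m_inv_closed[OF assms(2)] by blast
  ultimately show "x - y \<in> \<sigma> n ` H" by (metis imageI)
qed

text \<open>On \<open>H\<close> the coset map and \<open>\<sigma> n\<close> have the same fibres,
  and the order of a finite space determines its dimension.\<close>

lemma card_sigma_section:
  assumes "n \<ge> 1" "subgroup H G" "H \<subseteq> L n"
  shows "card (\<sigma> n ` H) = p ^ Fp_dim p (section_group G H (L (Suc n)))"
proof -
  let ?S = "section_group G H (L (Suc n))"
  have carrier: "carrier ?S = cl (Suc n) ` H"
    by (rule carrier_section_group[OF L_normal assms(2)])
  have eq: "\<And>x y. x \<in> H \<Longrightarrow> y \<in> H \<Longrightarrow> cl (Suc n) x = cl (Suc n) y \<longleftrightarrow> \<sigma> n x = \<sigma> n y"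
    using assms by (subst sigma_eq_iff) auto
  have "finite (\<sigma> n ` H)" using finite_sigma[OF assms(1)] assms(3) by (meson finite_subset image_mono)
  then have card: "card (carrier ?S) = card (\<sigma> n ` H)" "finite (carrier ?S)"
    using card_image_eq[of H "cl (Suc n)" "\<sigma> n", OF eq] unfolding carrier by auto
  obtain k where n: "n = Suc k" using assms(1) by (cases n) auto
  have "vectorspace (residue_ring (int p)) (Fp_space ?S)"
    unfolding n using p is_group assms(2,3) by (intro lower_p_series_section_vectorspace) (simp_all add: n)
  from card_vectorspace_finite[OF this] have
    "card (carrier (Fp_space ?S)) = card (carrier (residue_ring (int p))) ^ Fp_dim p ?S"
    using card(2) by (simp add: Fp_dim_def Fp_space_def)
  moreover have "card (carrier (residue_ring (int p))) = p"
    by (simp add: residue_ring_def)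
  ultimately show ?thesis using card(1) by (simp add: Fp_space_def)
qed

end


section \<open>The dimension estimates\<close>

theorem theorem4p12:
  fixes F :: "('a, 'b) monoid_scheme" and U :: "'a set" and p d i :: nat
  assumes "prime p" and "d \<ge> 3" and "i \<ge> 2"
    and "free_group_of_rank F d"
    and "U \<lhd> F" and "U \<subseteq> lower_p_series p F 2"
  defines "U2 \<equiv> lower_p_series p (F\<lparr>carrier := U\<rparr>) 2"
    and "V \<equiv> power_subgroup F U p <#>\<^bsub>F\<^esub> commutator_subgroup F U (carrier F)"
  defines "Q \<equiv> section_group F (U \<inter> lower_p_series p F i) (lower_p_series p F (i + 1))"
    and "R \<equiv> section_group F (U2 \<inter> lower_p_series p F (i + 1)) (lower_p_series p F (i + 2))"
    and "S \<equiv> section_group F (V \<inter> lower_p_series p F (i + 1)) (lower_p_series p F (i + 2))"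
  shows "Fp_dim p R \<ge> Fp_dim p Q \<and> real (Fp_dim p S) \<ge> 3 / 2 * real (Fp_dim p Q)"
proof -
  have "group F" using assms(4) by (simp add: free_group_of_rank_def)
  then interpret group F .
  obtain B where basis: "finite B" "card B = d" "free_basis F B"
    using assms(4) by (auto simp: free_group_of_rank_def)
  obtain \<mu> :: "'a \<Rightarrow> 'a ncps" where \<mu>:
    "\<And>g h. g \<in> carrier F \<Longrightarrow> h \<in> carrier F \<Longrightarrow> \<mu> (g \<otimes>\<^bsub>F\<^esub> h) = \<mu> g * \<mu> h"
    "\<mu> \<one>\<^bsub>F\<^esub> = 1" "\<And>b. b \<in> B \<Longrightarrow> \<mu> b = 1 + letter b"
    using magnus_map_exists[OF basis(3)] by blast
  interpret free_p_series F p B \<mu>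
    using assms(1) basis \<mu> by unfold_locales (auto simp: free_basis_def)
  have i: "i \<ge> 1" using assms(3) by simp
  have U: "subgroup U F" using assms(5) by (rule normal_imp_subgroup)
  have V: "subgroup V F"
    unfolding V_def
    by (intro normal_imp_subgroup normal_subgroup_set_mult_closed power_subgroup_normal
        commutator_subgroup_normal assms(5) normal_self)
  interpret U: group "F\<lparr>carrier := U\<rparr>" using subgroup_imp_group[OF U] .
  have U2: "subgroup U2 F"
    unfolding U2_def by (intro incl_subgroup[OF U] U.lower_p_series_subgroup)
  have pow_U2: "g [^]\<^bsub>F\<^esub> p \<in> U2" if "g \<in> U" for g
    using U.lower_p_series_power[of 1 g p] that
    by (simp add: U2_def numeral_2_eq_2 nat_pow_consistent[symmetric])
  have pow_V: "g [^]\<^bsub>F\<^esub> p \<in> V" if g: "g \<in> U" for g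
  proof -
    have "g [^]\<^bsub>F\<^esub> p \<in> power_subgroup F U p"
      unfolding power_subgroup_def using g by (intro generate.incl) auto
    moreover have "\<one>\<^bsub>F\<^esub> \<in> commutator_subgroup F U (carrier F)"
      unfolding commutator_subgroup_def by (rule generate.one)
    ultimately have "g [^]\<^bsub>F\<^esub> p \<otimes>\<^bsub>F\<^esub> \<one>\<^bsub>F\<^esub> \<in> V" unfolding V_def set_mult_def by blast
    then show ?thesis using subgroup.mem_carrier[OF U g] by simp
  qed
  have comm_V: "comm g x \<in> V" if g: "g \<in> U" and x: "x \<in> carrier F" for g x
  proof -
    have "comm g x \<in> commutator_subgroup F U (carrier F)"
      unfolding commutator_subgroup_def comm_def using g x by (intro generate.incl) auto
    moreover have "\<one>\<^bsub>F\<^esub> \<in> power_subgroup F U p"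
      unfolding power_subgroup_def by (rule generate.one)
    ultimately have "\<one>\<^bsub>F\<^esub> \<otimes>\<^bsub>F\<^esub> comm g x \<in> V" unfolding V_def set_mult_def by blast
    then show ?thesis using subgroup.mem_carrier[OF U g] x by simp
  qed
  define A where "A = \<sigma> i ` (U \<inter> L i)"
  define N where "N = \<sigma> (Suc i) ` (V \<inter> L (Suc i))"
  define M where "M = \<sigma> (Suc i) ` (U2 \<inter> L (Suc i))"
  have sub: "subgroup (U \<inter> L i) F" "subgroup (V \<inter> L (Suc i)) F" "subgroup (U2 \<inter> L (Suc i)) F"
    using U V U2 L_subgroup by (auto intro: subgroups_Inter_pair)
  have A: "add_subgroup A" and N: "add_subgroup N" and M: "add_subgroup M"
    unfolding A_def N_def M_def using sub i by (intro add_subgroup_sigma; simp)+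
  have card_A: "card A = p ^ Fp_dim p Q" and card_N: "card N = p ^ Fp_dim p S"
    and card_M: "card M = p ^ Fp_dim p R"
    unfolding A_def N_def M_def Q_def R_def S_def
    using card_sigma_section[OF i sub(1)] card_sigma_section[OF _ sub(2)] card_sigma_section[OF _ sub(3)]
    by simp_all
  \<comment> \<open>Taking \<open>p\<close>-th powers moves \<open>U\<close> into both
    \<open>U2\<close> and \<open>V\<close> and \<open>L i\<close> into \<open>L (Suc i)\<close>,
    without changing the leading term. So \<open>A\<close> is contained in \<open>M\<close> and in
    \<open>N\<close>.\<close>
  have pow_L: "\<sigma> i g = \<sigma> (Suc i) (g [^]\<^bsub>F\<^esub> p)" "g [^]\<^bsub>F\<^esub> p \<in> L (Suc i)" if "g \<in> L i" for g
    using sigma_pow[OF assms(3) that] L_power[OF i that] by auto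
  have AM: "A \<subseteq> M"
  proof
    fix e assume "e \<in> A"
    then obtain g where g: "g \<in> U" "g \<in> L i" "e = \<sigma> i g" unfolding A_def by blast
    then show "e \<in> M"
      unfolding M_def using pow_L[OF g(2)] pow_U2[OF g(1)] by (metis IntI imageI)
  qed
  have AN: "A \<subseteq> N"
  proof
    fix e assume "e \<in> A"
    then obtain g where g: "g \<in> U" "g \<in> L i" "e = \<sigma> i g" unfolding A_def by blast
    then show "e \<in> N"
      unfolding N_def using pow_L[OF g(2)] pow_V[OF g(1)] by (metis IntI imageI)
  qed
  have brk: "brk x e \<in> N" if "e \<in> A" and x: "x \<in> B" for x e
  proof -
    obtain g where g: "g \<in> U" "g \<in> L i" "e = \<sigma> i g" using \<open>e \<in> A\<close> unfolding A_def by blast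
    have "x \<in> carrier F" using x B(2) by blast
    then have "comm g x \<in> V" "comm g x \<in> L (Suc i)"
      using comm_V[OF g(1)] L_comm[OF i order.refl g(2), of x] by auto
    then show ?thesis
      unfolding N_def g(3) sigma_comm[OF i g(2) x, symmetric] by blast
  qed
  \<comment> \<open>The assumption \<open>d \<ge> 3\<close> supplies the three variables of the
    counting argument.\<close>
  obtain a b c where abc: "a \<in> B" "b \<in> B" "c \<in> B" "a \<noteq> b" "a \<noteq> c" "b \<noteq> c"
  proof -
    obtain T where T: "T \<subseteq> B" "card T = 3"
      using assms(2) basis(2) obtain_subset_with_card_n[of 3 B] by auto
    from T(2) obtain a b c where "T = {a, b, c}" "a \<noteq> b" "a \<noteq> c" "b \<noteq> c"
      by (auto simp: card_3_iff)
    then show thesis using T(1) that by blast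
  qed
  have "card A ^ 3 \<le> card N ^ 2"
  proof (rule card_expansion[OF abc(4-6) A N AN])
    show "brk x e \<in> N" if "e \<in> A" "x \<in> {a, b, c}" for e x
      using that abc by (intro brk) auto
    show "e [] = 0" if e: "e \<in> A" for e
    proof -
      obtain g where g: "g \<in> L i" "e = \<sigma> i g" using e unfolding A_def by blast
      then show ?thesis
        using coeff_delta_Nil[OF L_carrier[OF g(1)]] by (simp add: residue_fun_eq_0 p_pos)
    qed
    \<comment> \<open>Functions in \<open>A\<close> are leading terms of group elements, so the
      binomial shape of the coefficients at pure powers applies.\<close>
    show "e (replicate n x) = 0"
      if e: "e \<in> A" and single: "\<And>y. e [y] = 0" and n: "n \<ge> 1" and x: "x \<in> {a, b}" for e n x
    proof -
      obtain g where g: "g \<in> L i" "e = \<sigma> i g" using e unfolding A_def by blast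
      have "x \<in> B" using x abc by auto
      then show ?thesis
        using single[of x] unfolding g(2) by (intro sigma_replicate L_carrier[OF g(1)] n i)
    qed
  qed
  then have "p ^ (Fp_dim p Q * 3) \<le> p ^ (Fp_dim p S * 2)"
    by (simp add: card_A card_N power_mult)
  then have "Fp_dim p Q * 3 \<le> Fp_dim p S * 2"
    using prime_gt_1_nat[OF assms(1)] by (simp add: power_increasing_iff)
  moreover have "card A \<le> card M" using M AM by (intro card_mono) (auto simp: add_subgroup_def)
  then have "Fp_dim p Q \<le> Fp_dim p R"
    using prime_gt_1_nat[OF assms(1)] by (simp add: card_A card_M power_increasing_iff)
  ultimately show ?thesis by simp
qed

end
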